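(* Consider Morse polynomials of degree 4 whose degree-4 homogeneous part is non-degenerate and vanishes on exactly two distinct real lines in $\mathbb R^2$. For such a polynomial let $M$ be the number of its critical points in $\mathbb R^2$ and $m_+$ the number of its local maxima. Then the set of pairs $(M,m_+)$ realized by such polynomials is exactly the set of pairs with $M\in\{1,3,5,7,9\}$ and $0\le m_+<M/2$.
   Context: A homogeneous polynomial of degree 4 in $(x,y)$ with real coefficients is called non-degenerate if it is a product of four pairwise non-proportional linear forms over $\mathbb C$. A Morse polynomial of degree 4 is a real polynomial $\mathbb R^2\to\mathbb R$ of degree 4 with non-degenerate degree-4 homogeneous part, all of whose critical points in $\mathbb C^2$ are non-degenerate (there are then exactly 9 of them in $\mathbb C^2$). *)

theory Defs
  imports "HOL-Analysis.Analysis"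
begin

text \<open>A real polynomial of degree at most 4 in two variables is represented by its
coefficient function c, where c i j is the coefficient of x^i y^j, with
c i j = 0 whenever i + j > 4.\<close>

definition deg4_coeffs :: "(nat \<Rightarrow> nat \<Rightarrow> real) \<Rightarrow> bool" where
  "deg4_coeffs c \<longleftrightarrow> (\<forall>i j. 4 < i + j \<longrightarrow> c i j = 0)"

definition peval :: "(nat \<Rightarrow> nat \<Rightarrow> real) \<Rightarrow> 'a::real_field \<Rightarrow> 'a \<Rightarrow> 'a" where
  "peval c x y = (\<Sum>i\<le>4. \<Sum>j\<le>4. of_real (c i j) * x ^ i * y ^ j)"

definition top4 :: "(nat \<Rightarrow> nat \<Rightarrow> real) \<Rightarrow> 'a::real_field \<Rightarrow> 'a \<Rightarrow> 'a" where
  "top4 c x y = (\<Sum>i\<le>4. of_real (c i (4 - i)) * x ^ i * y ^ (4 - i))"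

definition pdx :: "(nat \<Rightarrow> nat \<Rightarrow> real) \<Rightarrow> 'a::real_field \<Rightarrow> 'a \<Rightarrow> 'a" where
  "pdx c x y = (\<Sum>i\<le>4. \<Sum>j\<le>4. of_real (c i j) * of_nat i * x ^ (i - 1) * y ^ j)"

definition pdy :: "(nat \<Rightarrow> nat \<Rightarrow> real) \<Rightarrow> 'a::real_field \<Rightarrow> 'a \<Rightarrow> 'a" where
  "pdy c x y = (\<Sum>i\<le>4. \<Sum>j\<le>4. of_real (c i j) * of_nat j * x ^ i * y ^ (j - 1))"

definition pdxx :: "(nat \<Rightarrow> nat \<Rightarrow> real) \<Rightarrow> 'a::real_field \<Rightarrow> 'a \<Rightarrow> 'a" where
  "pdxx c x y = (\<Sum>i\<le>4. \<Sum>j\<le>4. of_real (c i j) * of_nat (i * (i - 1)) * x ^ (i - 2) * y ^ j)"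

definition pdyy :: "(nat \<Rightarrow> nat \<Rightarrow> real) \<Rightarrow> 'a::real_field \<Rightarrow> 'a \<Rightarrow> 'a" where
  "pdyy c x y = (\<Sum>i\<le>4. \<Sum>j\<le>4. of_real (c i j) * of_nat (j * (j - 1)) * x ^ i * y ^ (j - 2))"

definition pdxy :: "(nat \<Rightarrow> nat \<Rightarrow> real) \<Rightarrow> 'a::real_field \<Rightarrow> 'a \<Rightarrow> 'a" where
  "pdxy c x y = (\<Sum>i\<le>4. \<Sum>j\<le>4. of_real (c i j) * of_nat (i * j) * x ^ (i - 1) * y ^ (j - 1))"

definition nondeg_top :: "(nat \<Rightarrow> nat \<Rightarrow> real) \<Rightarrow> bool" where
  "nondeg_top c \<longleftrightarrow> (\<exists>a b :: nat \<Rightarrow> complex.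
      (\<forall>x y :: complex. top4 c x y = (\<Prod>k<4. a k * x + b k * y)) \<and>
      (\<forall>k<4. \<forall>l<4. k \<noteq> l \<longrightarrow> a k * b l - a l * b k \<noteq> 0))"

definition crit_points :: "(nat \<Rightarrow> nat \<Rightarrow> real) \<Rightarrow> ('a::real_field \<times> 'a) set" where
  "crit_points c = {(x, y). pdx c x y = 0 \<and> pdy c x y = 0}"

definition hess_det :: "(nat \<Rightarrow> nat \<Rightarrow> real) \<Rightarrow> 'a::real_field \<Rightarrow> 'a \<Rightarrow> 'a" where
  "hess_det c x y = pdxx c x y * pdyy c x y - pdxy c x y * pdxy c x y"

definition morse4 :: "(nat \<Rightarrow> nat \<Rightarrow> real) \<Rightarrow> bool" where
  "morse4 c \<longleftrightarrow> deg4_coeffs c \<and> nondeg_top c \<and>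
     (\<forall>(x, y) \<in> (crit_points c :: (complex \<times> complex) set). hess_det c x y \<noteq> 0)"

definition real_zero_lines :: "(nat \<Rightarrow> nat \<Rightarrow> real) \<Rightarrow> (real \<times> real) set set" where
  "real_zero_lines c = {{(t * x, t * y) | t. True} | x y.
      (x, y) \<noteq> (0, 0) \<and> top4 c x y = (0::real)}"

definition local_max_points :: "(nat \<Rightarrow> nat \<Rightarrow> real) \<Rightarrow> (real \<times> real) set" where
  "local_max_points c = {p. \<exists>e>0. \<forall>q. dist q p < e \<longrightarrow>
      peval c (fst q) (snd q) \<le> peval c (fst p) (snd p)}"

end

theory Submission
  imports Defs "HOL-Computational_Algebra.Fundamental_Theorem_Algebra"
begin

text \<open>
  A real linear change of coordinates turns the leading part into
  \<open>x\<^sup>4 + 2 l x\<^sup>2 y\<^sup>2 - y\<^sup>4\<close>, so that the critical points are the common zeros of the cubics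
  \<open>P = x\<^sup>3 + l x y\<^sup>2 + \<dots>\<close> and \<open>Q = y\<^sup>3 - l x\<^sup>2 y + \<dots>\<close>, and the Hessian determinant is a negative
  multiple of their Jacobian \<open>J\<close>. By the Euler--Jacobi formula the functional
  \<open>g \<mapsto> \<Sum> g(z) / J(z)\<close>, summed over the complex critical points, kills all \<open>g\<close> of degree at most 3
  and depends only on the leading part of \<open>g\<close> in degree 4. Evaluated at \<open>J\<close> it counts 9 complex
  critical points. The form \<open>g \<mapsto> \<Sum> g(z)\<^sup>2 / J(z)\<close> on quadratic polynomials is nonpositive on the
  span of \<open>1, x, y, x\<^sup>2 - y\<^sup>2\<close> and nonnegative on the span of \<open>1, x, y, x\<^sup>2 + y\<^sup>2, xy\<close>; since no nonzero
  quadratic polynomial vanishes at all critical points, these dimensions bound the numbers of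
  extrema and saddles from below, which gives exactly one saddle more than extrema. Hence
  \<open>M = 2 e + 1\<close> with \<open>e \<le> 4\<close> extrema. Conversely, all distributions of maxima and minima are realized
  by polynomials that are even in \<open>x\<close>, except for four extrema of the same kind, which need a
  polynomial without symmetry.
\<close>

section \<open>Moments of functionals that vanish on the ideal of two cubics\<close>

text \<open>The Euler--Jacobi formula is obtained by linear algebra instead of residue theory. A
  functional on polynomials is stored as its moment sequence: \<open>u i j\<close> is its value at
  x^i y^j. Vanishing on the ideal (P, Q) becomes a pair of recurrences, whose solutions form a
  finite-dimensional space on which the two index shifts act and commute. The obstacle is to show
  that every solution is a combination of evaluations at common zeros: splitting the annihilating
  polynomials of the shifts into linear factors reduces this to joint eigenvectors, where
  nondegeneracy excludes derivatives at a point. One solution with known moments up to degree 4 is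
  built explicitly, and the Bezoutian identifies its weights as 1 / J. The two spans of quadratic
  polynomials are chosen to cancel l: the form is (2 a20 a02 + a11^2 - l a20^2 + l a02^2) / (1 +
  l^2), so affine functions lie in its radical, a02 = - a20 with a11 = 0 leaves - 2 a20^2, and a02 =
  a20 leaves 2 a20^2 + a11^2. A pair of conjugate zeros contributes one positive and one negative
  square, hence counts towards both bounds.\<close>

lemma underdetermined_system:
  fixes a :: "'i \<Rightarrow> 'k \<Rightarrow> 'f::field"
  assumes "finite I" "finite K" "card I < card K"
  shows "\<exists>x. (\<exists>k\<in>K. x k \<noteq> 0) \<and> (\<forall>i\<in>I. (\<Sum>k\<in>K. a i k * x k) = 0)"
  using assms
proof (induction I arbitrary: K a rule: finite_induct)
  case empty
  then obtain k where "k \<in> K" by fastforce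
  then show ?case by (intro exI[of _ "\<lambda>_. 1"]) auto
next
  case (insert i I)
  show ?case
  proof (cases "\<forall>k\<in>K. a i k = 0")
    case True
    have "card I < card K" using insert by simp
    then obtain x where "\<exists>k\<in>K. x k \<noteq> 0" "\<forall>i\<in>I. (\<Sum>k\<in>K. a i k * x k) = 0"
      using insert.IH[of K a] insert.prems(1) by blast
    with True show ?thesis by (intro exI[of _ x]) auto
  next
    case False
    then obtain k0 where k0: "k0 \<in> K" "a i k0 \<noteq> 0" by blast
    define K' where "K' = K - {k0}"
    have K': "finite K'" "K = insert k0 K'" "k0 \<notin> K'" using k0 insert.prems unfolding K'_def by auto
    have "card I < card K'" using insert K' by simp
    then obtain x where x: "\<exists>k\<in>K'. x k \<noteq> 0"
      "\<forall>j\<in>I. (\<Sum>k\<in>K'. (a j k - a j k0 * a i k / a i k0) * x k) = 0"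
      using insert.IH[of K' "\<lambda>j k. a j k - a j k0 * a i k / a i k0"] K'(1) by blast
    \<comment> \<open>Gaussian elimination: equation \<open>i\<close> is solved for the pivot
      unknown \<open>k0\<close>, and the other equations were reduced accordingly.\<close>
    define c where "c = - (\<Sum>k\<in>K'. a i k * x k) / a i k0"
    define y where "y = x(k0 := c)"
    have sum_y: "(\<Sum>k\<in>K. a j k * y k) = a j k0 * c + (\<Sum>k\<in>K'. a j k * x k)" for j
    proof -
      have "(\<Sum>k\<in>K'. a j k * y k) = (\<Sum>k\<in>K'. a j k * x k)"
        by (rule sum.cong) (use K' in \<open>auto simp: y_def\<close>)
      then show ?thesis using K' by (simp add: y_def)
    qed
    have "(\<Sum>k\<in>K. a j k * y k) = 0" if "j \<in> insert i I" for j
    proof (cases "j = i")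
      case True
      then show ?thesis using k0 unfolding sum_y by (simp add: c_def)
    next
      case False
      then have "j \<in> I" using that by simp
      then have "0 = (\<Sum>k\<in>K'. (a j k - a j k0 * a i k / a i k0) * x k)"
        using x(2) by simp
      also have "\<dots> = (\<Sum>k\<in>K'. a j k * x k - a j k0 / a i k0 * (a i k * x k))"
        by (rule sum.cong) (auto simp: algebra_simps)
      also have "\<dots> = (\<Sum>k\<in>K'. a j k * x k) - a j k0 / a i k0 * (\<Sum>k\<in>K'. a i k * x k)"
        by (simp add: sum_subtractf sum_distrib_left)
      finally show ?thesis unfolding sum_y by (simp add: c_def)
    qed
    moreover have "\<exists>k\<in>K. y k \<noteq> 0" using x(1) K' by (auto simp: y_def)
    ultimately show ?thesis by blast
  qed
qed

text \<open>The exponents of all monomials of degree at most 4, listed explicitly so that sums over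
  them unfold.\<close>

definition shifts4 :: "(nat \<times> nat) set" where
  "shifts4 = {(0,0), (0,1), (0,2), (0,3), (0,4), (1,0), (1,1), (1,2), (1,3),
    (2,0), (2,1), (2,2), (3,0), (3,1), (4,0)}"

lemma finite_shifts4 [simp]: "finite shifts4"
  by (simp add: shifts4_def)

lemma shifts4_le: "h \<in> shifts4 \<Longrightarrow> fst h + snd h \<le> 4"
  by (auto simp: shifts4_def)

text \<open>The sequence with the two recurrences \<open>u(i + 5, j) = - \<dots>\<close> and \<open>u(i, j + 5) = - \<dots>\<close> whose only
  nonzero value with \<open>i, j \<le> 4\<close> is \<open>u(4, 4) = 1\<close>. The equations give precedence to the first
  recurrence, so the second one needs a proof.\<close>
function rec_seq ::
  "(nat \<times> nat \<Rightarrow> complex) \<Rightarrow> (nat \<times> nat \<Rightarrow> complex) \<Rightarrow> nat \<Rightarrow> nat \<Rightarrow> complex" where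
  "rec_seq r s i j =
    (if 5 \<le> i then - (\<Sum>h\<in>shifts4. r h * rec_seq r s (i - 5 + fst h) (j + snd h))
     else if 5 \<le> j then - (\<Sum>h\<in>shifts4. s h * rec_seq r s (i + fst h) (j - 5 + snd h))
     else if i = 4 \<and> j = 4 then 1 else 0)"
  by auto
termination
  by (relation "Wellfounded.measure (\<lambda>(r, s, i, j). i + j)") (auto dest!: shifts4_le)

declare rec_seq.simps [simp del]

lemma rec_seq_fst:
  "rec_seq r s (i + 5) j = - (\<Sum>h\<in>shifts4. r h * rec_seq r s (i + fst h) (j + snd h))"
  by (subst rec_seq.simps) simp

text \<open>The recurrences are compatible because x^5 + ... and y^5 + ... act by commuting shifts:
  expand the first index, apply the second recurrence to the resulting terms, which have smaller
  total degree, and exchange the two sums.\<close>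

lemma rec_seq_snd:
  "rec_seq r s i (j + 5) = - (\<Sum>h\<in>shifts4. s h * rec_seq r s (i + fst h) (j + snd h))"
proof (induction "i + j" arbitrary: i j rule: less_induct)
  case less
  show ?case
  proof (cases "5 \<le> i")
    case False
    then show ?thesis by (subst rec_seq.simps) simp
  next
    case True
    then obtain m where m: "i = m + 5" by (metis add.commute le_Suc_ex)
    have "rec_seq r s i (j + 5) = - (\<Sum>h\<in>shifts4. r h * rec_seq r s (m + fst h) (j + snd h + 5))"
      unfolding m rec_seq_fst by (simp add: ac_simps)
    also have "\<dots> = - (\<Sum>h\<in>shifts4. r h *
        - (\<Sum>h'\<in>shifts4. s h' * rec_seq r s (m + fst h + fst h') (j + snd h + snd h')))"
    proof (intro arg_cong[where f = uminus] sum.cong refl arg_cong2[where f = "(*)"])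
      fix h :: "nat \<times> nat" assume "h \<in> shifts4"
      then have "m + fst h + (j + snd h) < i + j" using shifts4_le[of h] by (simp add: m)
      from less[OF this] show "rec_seq r s (m + fst h) (j + snd h + 5) =
        - (\<Sum>h'\<in>shifts4. s h' * rec_seq r s (m + fst h + fst h') (j + snd h + snd h'))" .
    qed
    also have "\<dots> = (\<Sum>h'\<in>shifts4. \<Sum>h\<in>shifts4. r h * (s h' * rec_seq r s (m + fst h + fst h') (j + snd h + snd h')))"
      by (subst sum.swap) (simp add: sum_distrib_left sum_negf)
    also have "\<dots> = - (\<Sum>h'\<in>shifts4. s h' * rec_seq r s (m + fst h' + 5) (j + snd h'))"
      unfolding rec_seq_fst by (simp add: sum_distrib_left sum_negf ac_simps)
    finally show ?thesis by (simp add: m ac_simps)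
  qed
qed

text \<open>Each recurrence lowers the total degree, as it trades a shift by 5 for shifts of degree
  at most 4. Hence nothing below the degree 8 of the seed (4, 4) can be nonzero.\<close>

lemma rec_seq_low_degree: "i + j < 8 \<Longrightarrow> rec_seq r s i j = 0"
proof (induction "i + j" arbitrary: i j rule: less_induct)
  case less
  show ?case
    by (subst rec_seq.simps) (use less in \<open>auto intro!: sum.neutral dest!: shifts4_le\<close>)
qed

lemma rec_seq_degree_8: "i + j = 8 \<Longrightarrow> rec_seq r s i j = (if i = 4 then 1 else 0)"
  by (subst rec_seq.simps) (auto intro!: sum.neutral rec_seq_low_degree dest!: shifts4_le)

text \<open>If \<open>u\<close> holds the moments of a functional, this is its value at x^i y^j
  times the quadratic polynomial with coefficients \<open>p\<close>.\<close>

definition quad_shift :: "(nat \<Rightarrow> nat \<Rightarrow> complex) \<Rightarrow> (nat \<Rightarrow> nat \<Rightarrow> complex) \<Rightarrow> nat \<Rightarrow> nat \<Rightarrow> complex" where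
  "quad_shift p u i j = p 2 0 * u (i + 2) j + p 1 1 * u (i + 1) (j + 1) + p 0 2 * u i (j + 2)
     + p 1 0 * u (i + 1) j + p 0 1 * u i (j + 1) + p 0 0 * u i j"

definition quad :: "(nat \<Rightarrow> nat \<Rightarrow> 'a::comm_ring_1) \<Rightarrow> 'a \<Rightarrow> 'a \<Rightarrow> 'a" where
  "quad p x y = p 2 0 * x\<^sup>2 + p 1 1 * x * y + p 0 2 * y\<^sup>2 + p 1 0 * x + p 0 1 * y + p 0 0"

text \<open>Multiplying the weights by \<open>fst z - fst z1\<close> or
  \<open>snd z - snd z1\<close> only combines shifted moments, so all moments still vanish, but the
  point \<open>z1\<close> drops out. Removing every point except \<open>z0\<close> isolates its
  weight.\<close>

lemma characters_independent:
  fixes w :: "complex \<times> complex \<Rightarrow> complex"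
  assumes "finite S" "\<And>i j. (\<Sum>z\<in>S. w z * fst z ^ i * snd z ^ j) = 0" "z0 \<in> S"
  shows "w z0 = 0"
proof -
  have "\<exists>g. g z0 \<noteq> 0 \<and> (\<forall>z\<in>T. g z = 0) \<and>
      (\<forall>i j. (\<Sum>z\<in>S. w z * g z * fst z ^ i * snd z ^ j) = 0)"
    if "finite T" "z0 \<notin> T" for T :: "(complex \<times> complex) set"
    using that
  proof (induction T rule: finite_induct)
    case empty
    then show ?case using assms(2) by (intro exI[of _ "\<lambda>_. 1"]) simp
  next
    case (insert z1 T)
    then obtain g where g: "g z0 \<noteq> 0" "\<forall>z\<in>T. g z = 0"
      "\<And>i j. (\<Sum>z\<in>S. w z * g z * fst z ^ i * snd z ^ j) = 0" by auto
    have fst_step: "(\<Sum>z\<in>S. w z * (g z * (fst z - fst z1)) * fst z ^ i * snd z ^ j) = 0" for i j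
    proof -
      have "(\<Sum>z\<in>S. w z * (g z * (fst z - fst z1)) * fst z ^ i * snd z ^ j) =
         (\<Sum>z\<in>S. w z * g z * fst z ^ Suc i * snd z ^ j - fst z1 * (w z * g z * fst z ^ i * snd z ^ j))"
        by (simp add: algebra_simps)
      also have "\<dots> = 0" unfolding sum_subtractf sum_distrib_left[symmetric] g(3) by simp
      finally show ?thesis .
    qed
    have snd_step: "(\<Sum>z\<in>S. w z * (g z * (snd z - snd z1)) * fst z ^ i * snd z ^ j) = 0" for i j
    proof -
      have "(\<Sum>z\<in>S. w z * (g z * (snd z - snd z1)) * fst z ^ i * snd z ^ j) =
         (\<Sum>z\<in>S. w z * g z * fst z ^ i * snd z ^ Suc j - snd z1 * (w z * g z * fst z ^ i * snd z ^ j))"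
        by (simp add: algebra_simps)
      also have "\<dots> = 0" unfolding sum_subtractf sum_distrib_left[symmetric] g(3) by simp
      finally show ?thesis .
    qed
    show ?case
    proof (cases "fst z0 = fst z1")
      case True
      then have "snd z0 \<noteq> snd z1" using insert by (auto simp: prod_eq_iff)
      then show ?thesis using g snd_step by (intro exI[of _ "\<lambda>z. g z * (snd z - snd z1)"]) auto
    next
      case False
      then show ?thesis using g fst_step by (intro exI[of _ "\<lambda>z. g z * (fst z - fst z1)"]) auto
    qed
  qed
  from this[of "S - {z0}"] assms(1) obtain g where g: "g z0 \<noteq> 0" "\<forall>z\<in>S - {z0}. g z = 0"
    "\<And>i j. (\<Sum>z\<in>S. w z * g z * fst z ^ i * snd z ^ j) = 0" by auto
  have "0 = (\<Sum>z\<in>S. w z * g z)" using g(3)[of 0 0] by simp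
  also have "\<dots> = w z0 * g z0"
    using assms(1,3) g(2) by (subst sum.remove[OF assms(1,3)]) simp
  finally show ?thesis using g(1) by simp
qed

text \<open>The entry at index 0 of the sequence obtained by applying \<open>m\<close>, read as a
  polynomial in the shift operator, to \<open>x\<close>.\<close>

definition pairing :: "complex poly \<Rightarrow> (nat \<Rightarrow> complex) \<Rightarrow> complex" where
  "pairing m x = (\<Sum>k\<le>degree m. coeff m k * x k)"

lemma pairing_bound: "degree m \<le> n \<Longrightarrow> pairing m x = (\<Sum>k\<le>n. coeff m k * x k)"
  unfolding pairing_def by (rule sum.mono_neutral_left) (auto simp: coeff_eq_0)

text \<open>Splitting off a root of the polynomial moves the operator "shift minus \<open>a\<close>"
  onto the sequence; this drives the inductions on the degree.\<close>

lemma pairing_linear_factor: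
  "pairing ([:- a, 1:] * m) x = pairing m (\<lambda>k. x (Suc k) - a * x k)"
proof -
  have *: "[:- a, 1:] * m = pCons 0 m - smult a m" by simp
  have "degree ([:- a, 1:] * m) \<le> Suc (degree m)"
    by (cases "m = 0") (simp_all add: degree_mult_eq del: mult_pCons_left)
  then have "pairing ([:- a, 1:] * m) x = (\<Sum>k\<le>Suc (degree m). coeff (pCons 0 m) k * x k - a * coeff m k * x k)"
    by (subst pairing_bound) (auto simp: * algebra_simps)
  also have "\<dots> = (\<Sum>k\<le>Suc (degree m). coeff (pCons 0 m) k * x k) - a * (\<Sum>k\<le>Suc (degree m). coeff m k * x k)"
    by (simp only: sum_subtractf sum_distrib_left mult.assoc)
  also have "\<dots> = (\<Sum>k\<le>degree m. coeff m k * x (Suc k)) - a * (\<Sum>k\<le>degree m. coeff m k * x k)"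
    by (subst sum.atMost_Suc_shift) (simp add: coeff_eq_0)
  finally show ?thesis
    by (simp add: pairing_def sum_subtractf sum_distrib_left algebra_simps)
qed

text \<open>The condition says that the leading parts x (x^2 + L y^2) and y (y^2 - L x^2) share only
  the zero at the origin, so the cubics do not meet at infinity: where x^2 = - L y^2, the second
  part equals (1 + L^2) y^3.\<close>

locale cubic_pair =
  fixes L :: complex and p q :: "nat \<Rightarrow> nat \<Rightarrow> complex"
  assumes L: "1 + L\<^sup>2 \<noteq> 0"
begin

definition P where "P x y = x ^ 3 + L * x * y\<^sup>2 + quad p x y"
definition Q where "Q x y = y ^ 3 - L * x\<^sup>2 * y + quad q x y"
definition Px where "Px x y = 3 * x\<^sup>2 + L * y\<^sup>2 + 2 * p 2 0 * x + p 1 1 * y + p 1 0"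
definition Py where "Py x y = 2 * L * x * y + p 1 1 * x + 2 * p 0 2 * y + p 0 1"
definition Qx where "Qx x y = - 2 * L * x * y + 2 * q 2 0 * x + q 1 1 * y + q 1 0"
definition Qy where "Qy x y = 3 * y\<^sup>2 - L * x\<^sup>2 + q 1 1 * x + 2 * q 0 2 * y + q 0 1"
definition J where "J x y = Px x y * Qy x y - Py x y * Qx x y"
definition Z where "Z = {(x, y). P x y = 0 \<and> Q x y = 0}"

text \<open>The moment sequences \<^term>\<open>u i j\<close> of the linear functionals that vanish on the ideal of
  the pair.\<close>
definition sol :: "(nat \<Rightarrow> nat \<Rightarrow> complex) \<Rightarrow> bool" where
  "sol u \<longleftrightarrow> (\<forall>i j. u (i + 3) j + L * u (i + 1) (j + 2) + quad_shift p u i j = 0) \<and>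
             (\<forall>i j. u i (j + 3) - L * u (i + 2) (j + 1) + quad_shift q u i j = 0)"

definition \<nu> where "\<nu> = 1 / (1 + L\<^sup>2)"

lemma \<nu>: "\<nu> + L\<^sup>2 * \<nu> = 1" "\<nu> \<noteq> 0"
  using L by (auto simp: \<nu>_def field_simps)

text \<open>For the leading parts \<open>P\<^sub>3\<close> and \<open>Q\<^sub>3\<close> one has \<open>x\<^sup>5 = (x\<^sup>2 - L \<nu> y\<^sup>2) P\<^sub>3 + L\<^sup>2 \<nu> x y Q\<^sub>3\<close> and
  \<open>y\<^sup>5 = L\<^sup>2 \<nu> x y P\<^sub>3 + (y\<^sup>2 + L \<nu> x\<^sup>2) Q\<^sub>3\<close>; the sequences below are the contributions of the
  lower-order parts to the same combinations of \<open>P\<close> and \<open>Q\<close>.\<close>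
definition F_low where
  "F_low u i j = quad_shift p u (i + 2) j - L * \<nu> * quad_shift p u i (j + 2)
     + L\<^sup>2 * \<nu> * quad_shift q u (i + 1) (j + 1)"
definition G_low where
  "G_low u i j = L\<^sup>2 * \<nu> * quad_shift p u (i + 1) (j + 1) + quad_shift q u i (j + 2)
     + L * \<nu> * quad_shift q u (i + 2) j"

lemma sol_fst5: assumes "sol u" shows "u (i + 5) j = - F_low u i j"
proof -
  have P: "u (i + 3) j + L * u (i + 1) (j + 2) + quad_shift p u i j = 0"
    and Q: "u i (j + 3) - L * u (i + 2) (j + 1) + quad_shift q u i j = 0" for i j
    using assms unfolding sol_def by auto
  have e1: "u (i + 5) j + L * u (i + 3) (j + 2) + quad_shift p u (i + 2) j = 0"
    using P[of "i + 2" j] by (simp add: numeral_eq_Suc)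
  have e2: "u (i + 3) (j + 2) + L * u (i + 1) (j + 4) + quad_shift p u i (j + 2) = 0"
    using P[of i "j + 2"] by (simp add: numeral_eq_Suc)
  have e3: "u (i + 1) (j + 4) - L * u (i + 3) (j + 2) + quad_shift q u (i + 1) (j + 1) = 0"
    using Q[of "i + 1" "j + 1"] by (simp add: numeral_eq_Suc)
  \<comment> \<open>The identity holds with \<nu> as an indeterminate; the relation that defines
    \<nu> enters only through the last summand.\<close>
  have id: "u50 + (p20 - L * \<nu> * p02 + L\<^sup>2 * \<nu> * q11) = (u50 + L * u32 + p20)
      - L * \<nu> * (u32 + L * u14 + p02) + L\<^sup>2 * \<nu> * (u14 - L * u32 + q11)
      + (\<nu> + L\<^sup>2 * \<nu> - 1) * (L * u32)" for u50 u32 u14 p20 p02 q11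
    by (simp add: algebra_simps power2_eq_square)
  have "u (i + 5) j + F_low u i j = 0"
    unfolding F_low_def id[where ?u32.0 = "u (i + 3) (j + 2)" and ?u14.0 = "u (i + 1) (j + 4)"] e1 e2 e3
    using \<nu>(1) by simp
  then show ?thesis by (simp add: eq_neg_iff_add_eq_0)
qed

lemma sol_snd5: assumes "sol u" shows "u i (j + 5) = - G_low u i j"
proof -
  have P: "u (i + 3) j + L * u (i + 1) (j + 2) + quad_shift p u i j = 0"
    and Q: "u i (j + 3) - L * u (i + 2) (j + 1) + quad_shift q u i j = 0" for i j
    using assms unfolding sol_def by auto
  have e1: "u i (j + 5) - L * u (i + 2) (j + 3) + quad_shift q u i (j + 2) = 0"
    using Q[of i "j + 2"] by (simp add: numeral_eq_Suc)
  have e2: "u (i + 2) (j + 3) - L * u (i + 4) (j + 1) + quad_shift q u (i + 2) j = 0"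
    using Q[of "i + 2" j] by (simp add: numeral_eq_Suc)
  have e3: "u (i + 4) (j + 1) + L * u (i + 2) (j + 3) + quad_shift p u (i + 1) (j + 1) = 0"
    using P[of "i + 1" "j + 1"] by (simp add: numeral_eq_Suc)
  have id: "u05 + (L\<^sup>2 * \<nu> * p11 + q02 + L * \<nu> * q20) = (u05 - L * u23 + q02)
      + L * \<nu> * (u23 - L * u41 + q20) + L\<^sup>2 * \<nu> * (u41 + L * u23 + p11)
      - (\<nu> + L\<^sup>2 * \<nu> - 1) * (L * u23)" for u05 u23 u41 p11 q02 q20
    by (simp add: algebra_simps power2_eq_square)
  have "u i (j + 5) + G_low u i j = 0"
    unfolding G_low_def id[where ?u23.0 = "u (i + 2) (j + 3)" and ?u41.0 = "u (i + 4) (j + 1)"] e1 e2 e3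
    using \<nu>(1) by simp
  then show ?thesis by (simp add: eq_neg_iff_add_eq_0)
qed

text \<open>The solution is obtained by applying the determinant
  \<open>L \<nu> x\<^sup>4 + \<nu> x\<^sup>2 y\<^sup>2 - L \<nu> y\<^sup>4\<close> of the above multipliers to a solution for \<open>x\<^sup>5 + \<dots>\<close> and \<open>y\<^sup>5 + \<dots>\<close>
  (the transformation law for residues).\<close>
lemma ex_residue_sol:
  "\<exists>u. sol u \<and> (\<forall>i j. i + j < 4 \<longrightarrow> u i j = 0) \<and> u 4 0 = - (L * \<nu>) \<and> u 3 1 = 0 \<and> u 2 2 = \<nu> \<and>
     u 1 3 = 0 \<and> u 0 4 = L * \<nu>"
proof -
  \<comment> \<open>\<open>r\<close> and \<open>s\<close> are the coefficients of the lower-order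
    parts \<open>F_low\<close> and \<open>G_low\<close>. \<open>p'\<close> and \<open>q'\<close>
    drop the indices above degree 2, which \<open>quad_shift\<close> never reads, and the conditions
    guard the truncated subtractions.\<close>
  define p' where "p' = (\<lambda>k l. if k + l \<le> 2 then p k l else 0)"
  define q' where "q' = (\<lambda>k l. if k + l \<le> 2 then q k l else 0)"
  define r where "r = (\<lambda>(k, l). (if 2 \<le> k then p' (k - 2) l else 0) -
     (if 2 \<le> l then L * \<nu> * p' k (l - 2) else 0) +
     (if 1 \<le> k \<and> 1 \<le> l then L\<^sup>2 * \<nu> * q' (k - 1) (l - 1) else 0))"
  define s where "s = (\<lambda>(k, l). (if 1 \<le> k \<and> 1 \<le> l then L\<^sup>2 * \<nu> * p' (k - 1) (l - 1) else 0) +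
     (if 2 \<le> l then q' k (l - 2) else 0) +
     (if 2 \<le> k then L * \<nu> * q' (k - 2) l else 0))"
  define w where "w = rec_seq r s"
  have Fw: "w (i + 5) j + F_low w i j = 0" for i j
    unfolding w_def rec_seq_fst unfolding w_def[symmetric] shifts4_def
    by (simp add: r_def p'_def q'_def F_low_def quad_shift_def numeral_eq_Suc algebra_simps)
  have Gw: "w i (j + 5) + G_low w i j = 0" for i j
    unfolding w_def rec_seq_snd unfolding w_def[symmetric] shifts4_def
    by (simp add: s_def p'_def q'_def G_low_def quad_shift_def numeral_eq_Suc algebra_simps)
  define u where "u = (\<lambda>i j. L * \<nu> * w (i + 4) j + \<nu> * w (i + 2) (j + 2) - L * \<nu> * w i (j + 4))"
  have lin: "quad_shift c u i j = L * \<nu> * quad_shift c w (i + 4) j + \<nu> * quad_shift c w (i + 2) (j + 2)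
      - L * \<nu> * quad_shift c w i (j + 4)" for c i j
    by (simp add: quad_shift_def u_def numeral_eq_Suc algebra_simps)
  let ?p = "quad_shift p w" and ?q = "quad_shift q w"
  have "u (i + 3) j + L * u (i + 1) (j + 2) + quad_shift p u i j = 0" for i j
  proof -
    \<comment> \<open>Cramer's rule: for the quintics F = x^5 + ... and G = y^5 + ..., the
      determinant times P is (y^2 + L \<nu> x^2) F - L^2 \<nu> x y G. \<open>e1\<close> to
      \<open>e3\<close> are the relations for \<open>w\<close> at y^2 F, x^2 F and x y G.\<close>
    have e1: "w (i + 5) (j + 2) + (?p (i + 2) (j + 2) - L * \<nu> * ?p i (j + 4)
        + L\<^sup>2 * \<nu> * ?q (i + 1) (j + 3)) = 0"
      using Fw[of i "j + 2"] by (simp add: F_low_def numeral_eq_Suc)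
    have e2: "w (i + 7) j + (?p (i + 4) j - L * \<nu> * ?p (i + 2) (j + 2)
        + L\<^sup>2 * \<nu> * ?q (i + 3) (j + 1)) = 0"
      using Fw[of "i + 2" j] by (simp add: F_low_def numeral_eq_Suc)
    have e3: "w (i + 1) (j + 6) + (L\<^sup>2 * \<nu> * ?p (i + 2) (j + 2) + ?q (i + 1) (j + 3)
        + L * \<nu> * ?q (i + 3) (j + 1)) = 0"
      using Gw[of "i + 1" "j + 1"] by (simp add: G_low_def numeral_eq_Suc)
    have us: "u (i + 3) j = L * \<nu> * w (i + 7) j + \<nu> * w (i + 5) (j + 2) - L * \<nu> * w (i + 3) (j + 4)"
      "u (i + 1) (j + 2) = L * \<nu> * w (i + 5) (j + 2) + \<nu> * w (i + 3) (j + 4) - L * \<nu> * w (i + 1) (j + 6)"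
      by (simp_all add: u_def numeral_eq_Suc)
    have id: "(L * \<nu> * w70 + \<nu> * w52 - L * \<nu> * w34) + L * (L * \<nu> * w52 + \<nu> * w34 - L * \<nu> * w16)
        + (L * \<nu> * p40 + \<nu> * p22 - L * \<nu> * p04)
      = (w52 + (p22 - L * \<nu> * p04 + L\<^sup>2 * \<nu> * q13)) + L * \<nu> * (w70 + (p40 - L * \<nu> * p22 + L\<^sup>2 * \<nu> * q31))
        - L\<^sup>2 * \<nu> * (w16 + (L\<^sup>2 * \<nu> * p22 + q13 + L * \<nu> * q31))
        + (\<nu> + L\<^sup>2 * \<nu> - 1) * (w52 + (1 + L\<^sup>2 * \<nu>) * p22)"
      for w70 w52 w34 w16 p40 p22 p04 q13 q31
      by (simp add: algebra_simps power2_eq_square)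
    show ?thesis unfolding lin us id[where ?q13.0 = "?q (i + 1) (j + 3)" and ?q31.0 = "?q (i + 3) (j + 1)"] e1 e2 e3 using \<nu>(1) by simp
  qed
  moreover have "u i (j + 3) - L * u (i + 2) (j + 1) + quad_shift q u i j = 0" for i j
  proof -
    \<comment> \<open>Likewise the determinant times Q is (x^2 - L \<nu> y^2) G - L^2 \<nu> x y
      F.\<close>
    have e1: "w (i + 6) (j + 1) + (?p (i + 3) (j + 1) - L * \<nu> * ?p (i + 1) (j + 3)
        + L\<^sup>2 * \<nu> * ?q (i + 2) (j + 2)) = 0"
      using Fw[of "i + 1" "j + 1"] by (simp add: F_low_def numeral_eq_Suc)
    have e2: "w (i + 2) (j + 5) + (L\<^sup>2 * \<nu> * ?p (i + 3) (j + 1) + ?q (i + 2) (j + 2)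
        + L * \<nu> * ?q (i + 4) j) = 0"
      using Gw[of "i + 2" j] by (simp add: G_low_def numeral_eq_Suc)
    have e3: "w i (j + 7) + (L\<^sup>2 * \<nu> * ?p (i + 1) (j + 3) + ?q i (j + 4)
        + L * \<nu> * ?q (i + 2) (j + 2)) = 0"
      using Gw[of i "j + 2"] by (simp add: G_low_def numeral_eq_Suc)
    have us: "u i (j + 3) = L * \<nu> * w (i + 4) (j + 3) + \<nu> * w (i + 2) (j + 5) - L * \<nu> * w i (j + 7)"
      "u (i + 2) (j + 1) = L * \<nu> * w (i + 6) (j + 1) + \<nu> * w (i + 4) (j + 3) - L * \<nu> * w (i + 2) (j + 5)"
      by (simp_all add: u_def numeral_eq_Suc)
    have id: "(L * \<nu> * w43 + \<nu> * w25 - L * \<nu> * w07) - L * (L * \<nu> * w61 + \<nu> * w43 - L * \<nu> * w25)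
        + (L * \<nu> * q40 + \<nu> * q22 - L * \<nu> * q04)
      = (w25 + (L\<^sup>2 * \<nu> * p31 + q22 + L * \<nu> * q40)) - L * \<nu> * (w07 + (L\<^sup>2 * \<nu> * p13 + q04 + L * \<nu> * q22))
        - L\<^sup>2 * \<nu> * (w61 + (p31 - L * \<nu> * p13 + L\<^sup>2 * \<nu> * q22))
        + (\<nu> + L\<^sup>2 * \<nu> - 1) * (w25 + (1 + L\<^sup>2 * \<nu>) * q22)"
      for w43 w25 w07 w61 q40 q22 q04 p31 p13
      by (simp add: algebra_simps power2_eq_square)
    show ?thesis unfolding lin us id[where ?p31.0 = "?p (i + 3) (j + 1)" and ?p13.0 = "?p (i + 1) (j + 3)"] e1 e2 e3 using \<nu>(1) by simp
  qed
  ultimately have "sol u" by (simp add: sol_def)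
  moreover have "u i j = 0" if "i + j < 4" for i j
    using that by (simp add: u_def w_def rec_seq_low_degree)
  \<comment> \<open>In degree 8 only \<open>w 4 4\<close> is nonzero, so for i + j = 4 the value
    \<open>u i j\<close> is the coefficient of x^(4-i) y^(4-j) in the determinant.\<close>
  moreover have "u 4 0 = - (L * \<nu>)" "u 3 1 = 0" "u 2 2 = \<nu>" "u 1 3 = 0" "u 0 4 = L * \<nu>"
    by (simp_all add: u_def w_def rec_seq_degree_8)
  ultimately show ?thesis by blast
qed

end

section \<open>Finite dimension of the space of solutions\<close>

context cubic_pair
begin

lemma sol_lincomb:
  fixes c :: "'k \<Rightarrow> complex"
  assumes "\<And>k. k \<in> K \<Longrightarrow> sol (U k)"
  shows "sol (\<lambda>i j. \<Sum>k\<in>K. c k * U k i j)"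
  unfolding sol_def
proof (intro conjI allI)
  fix i j
  have lin: "quad_shift r (\<lambda>i j. \<Sum>k\<in>K. c k * U k i j) i j = (\<Sum>k\<in>K. c k * quad_shift r (U k) i j)" for r
    by (simp add: quad_shift_def sum_distrib_left sum.distrib distrib_left ac_simps)
  have "(\<Sum>k\<in>K. c k * U k (i + 3) j) + L * (\<Sum>k\<in>K. c k * U k (i + 1) (j + 2))
      + quad_shift p (\<lambda>i j. \<Sum>k\<in>K. c k * U k i j) i j
    = (\<Sum>k\<in>K. c k * (U k (i + 3) j + L * U k (i + 1) (j + 2) + quad_shift p (U k) i j))"
    unfolding lin by (simp add: sum_distrib_left sum.distrib distrib_left ac_simps)
  also have "\<dots> = 0" using assms by (intro sum.neutral) (simp add: sol_def)
  finally show "(\<Sum>k\<in>K. c k * U k (i + 3) j) + L * (\<Sum>k\<in>K. c k * U k (i + 1) (j + 2))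
      + quad_shift p (\<lambda>i j. \<Sum>k\<in>K. c k * U k i j) i j = 0" .
  have "(\<Sum>k\<in>K. c k * U k i (j + 3)) - L * (\<Sum>k\<in>K. c k * U k (i + 2) (j + 1))
      + quad_shift q (\<lambda>i j. \<Sum>k\<in>K. c k * U k i j) i j
    = (\<Sum>k\<in>K. c k * (U k i (j + 3) - L * U k (i + 2) (j + 1) + quad_shift q (U k) i j))"
    unfolding lin by (simp add: sum_distrib_left sum.distrib sum_subtractf distrib_left right_diff_distrib ac_simps)
  also have "\<dots> = 0" using assms by (intro sum.neutral) (simp add: sol_def)
  finally show "(\<Sum>k\<in>K. c k * U k i (j + 3)) - L * (\<Sum>k\<in>K. c k * U k (i + 2) (j + 1))
      + quad_shift q (\<lambda>i j. \<Sum>k\<in>K. c k * U k i j) i j = 0" .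
qed

lemma sol_diff: "sol u \<Longrightarrow> sol v \<Longrightarrow> sol (\<lambda>i j. u i j - c * v i j)"
  using sol_lincomb[of "{True, False}" "\<lambda>b. if b then u else v" "\<lambda>b. if b then 1 else - c"] by simp

lemma sol_shift_fst: "sol u \<Longrightarrow> sol (\<lambda>i j. u (Suc i) j)"
  unfolding sol_def
proof (elim conjE, intro conjI allI)
  fix i j
  assume P: "\<forall>i j. u (i + 3) j + L * u (i + 1) (j + 2) + quad_shift p u i j = 0"
    and Q: "\<forall>i j. u i (j + 3) - L * u (i + 2) (j + 1) + quad_shift q u i j = 0"
  let ?v = "\<lambda>i j. u (Suc i) j"
  show "?v (i + 3) j + L * ?v (i + 1) (j + 2) + quad_shift p ?v i j = 0"
    using P[rule_format, of "Suc i" j] by (simp add: quad_shift_def)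
  show "?v i (j + 3) - L * ?v (i + 2) (j + 1) + quad_shift q ?v i j = 0"
    using Q[rule_format, of "Suc i" j] by (simp add: quad_shift_def)
qed

lemma sol_shift_snd: "sol u \<Longrightarrow> sol (\<lambda>i j. u i (Suc j))"
  unfolding sol_def
proof (elim conjE, intro conjI allI)
  fix i j
  assume P: "\<forall>i j. u (i + 3) j + L * u (i + 1) (j + 2) + quad_shift p u i j = 0"
    and Q: "\<forall>i j. u i (j + 3) - L * u (i + 2) (j + 1) + quad_shift q u i j = 0"
  let ?v = "\<lambda>i j. u i (Suc j)"
  show "?v (i + 3) j + L * ?v (i + 1) (j + 2) + quad_shift p ?v i j = 0"
    using P[rule_format, of i "Suc j"] by (simp add: quad_shift_def)
  show "?v i (j + 3) - L * ?v (i + 2) (j + 1) + quad_shift q ?v i j = 0"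
    using Q[rule_format, of i "Suc j"] by (simp add: quad_shift_def)
qed

lemma sol_shift_fst_n: "sol u \<Longrightarrow> sol (\<lambda>i j. u (i + k) j)"
  by (induction k) (auto dest: sol_shift_fst)

lemma sol_shift_snd_n: "sol u \<Longrightarrow> sol (\<lambda>i j. u i (j + k))"
  by (induction k) (auto dest: sol_shift_snd)

lemma sol_character: "z \<in> Z \<Longrightarrow> sol (\<lambda>i j. fst z ^ i * snd z ^ j)"
proof -
  assume "z \<in> Z"
  then have z: "P (fst z) (snd z) = 0" "Q (fst z) (snd z) = 0" by (auto simp: Z_def)
  define x where "x = fst z" define y where "y = snd z"
  note z = z[folded x_def y_def]
  have "x ^ (i + 3) * y ^ j + L * (x ^ (i + 1) * y ^ (j + 2)) + quad_shift p (\<lambda>i j. x ^ i * y ^ j) i j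
      = x ^ i * y ^ j * P x y"
    "x ^ i * y ^ (j + 3) - L * (x ^ (i + 2) * y ^ (j + 1)) + quad_shift q (\<lambda>i j. x ^ i * y ^ j) i j
      = x ^ i * y ^ j * Q x y" for i j
    by (simp_all add: quad_shift_def P_def Q_def quad_def power_add numeral_eq_Suc algebra_simps)
  with z show ?thesis unfolding x_def[symmetric] y_def[symmetric] by (simp add: sol_def)
qed

text \<open>The quintic recurrences reduce every moment to the 25 moments with both indices at most
  4. This crude bound on the dimension suffices for finiteness of \<open>Z\<close> and for
  annihilating polynomials of the shifts.\<close>

lemma sol_determined:
  assumes "sol u" "\<And>i j. i \<le> 4 \<Longrightarrow> j \<le> 4 \<Longrightarrow> u i j = 0"
  shows "u i j = 0"
proof (induction "i + j" arbitrary: i j rule: less_induct)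
  case less
  consider "i \<le> 4" "j \<le> 4" | k where "i = k + 5" | k where "j = k + 5"
  proof -
    have "(i \<le> 4 \<and> j \<le> 4) \<or> i = i - 5 + 5 \<or> j = j - 5 + 5" by linarith
    then show thesis using that by blast
  qed
  then show ?case
  proof cases
    case 1
    then show ?thesis by (rule assms(2))
  next
    case (2 k)
    have "F_low u k j = 0"
      using less by (simp add: F_low_def quad_shift_def 2)
    then show ?thesis using sol_fst5[OF assms(1)] by (simp add: 2)
  next
    case (3 k)
    have "G_low u i k = 0"
      using less by (simp add: G_low_def quad_shift_def 3)
    then show ?thesis using sol_snd5[OF assms(1)] by (simp add: 3)
  qed
qed

lemma sol_family_dependent:
  assumes "\<And>k. k \<in> K \<Longrightarrow> sol (U k)" "finite K" "25 < card K"
  shows "\<exists>c. (\<exists>k\<in>K. c k \<noteq> 0) \<and> (\<forall>i j. (\<Sum>k\<in>K. c k * U k i j) = 0)"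
proof -
  have "card ({..4::nat} \<times> {..4::nat}) < card K" using assms(3) by simp
  from underdetermined_system[OF _ assms(2) this, of "\<lambda>h k. U k (fst h) (snd h)"] obtain c
    where c: "\<exists>k\<in>K. c k \<noteq> 0" "\<And>i j. i \<le> 4 \<Longrightarrow> j \<le> 4 \<Longrightarrow> (\<Sum>k\<in>K. U k i j * c k) = 0"
    by auto
  have "(\<Sum>k\<in>K. c k * U k i j) = 0" for i j
    using sol_determined[OF sol_lincomb[OF assms(1), where c = c]] c(2) by (simp add: mult.commute)
  with c(1) show ?thesis by blast
qed

text \<open>Evaluations at 26 zeros would be 26 solutions, hence dependent, contrary to the
  independence of characters.\<close>

lemma finite_Z: "finite Z"
proof (rule ccontr)
  assume "infinite Z"
  then obtain S where S: "S \<subseteq> Z" "finite S" "card S = 26"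
    by (meson infinite_arbitrarily_large)
  have char: "sol (\<lambda>i j. fst z ^ i * snd z ^ j)" if "z \<in> S" for z
    using that S(1) sol_character by blast
  have "25 < card S" using S(3) by simp
  from sol_family_dependent[where U = "\<lambda>z i j. fst z ^ i * snd z ^ j", OF char S(2) this] obtain c
    where c: "\<exists>z\<in>S. c z \<noteq> 0" "\<forall>i j. (\<Sum>z\<in>S. c z * (fst z ^ i * snd z ^ j)) = 0"
    by auto
  then show False using characters_independent[OF S(2), of c] by (auto simp: mult.assoc)
qed

text \<open>Replaces Cayley--Hamilton: if \<open>U k\<close> is the k-th iterate of a shift, the
  relation among the 26 solutions \<open>U 0\<close>, ..., \<open>U 25\<close> is a nonzero
  polynomial in the shift that annihilates the sequence.\<close>

lemma sol_annihilated:
  assumes "\<And>k. sol (U k)"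
  shows "\<exists>m. m \<noteq> 0 \<and> (\<forall>i j. pairing m (\<lambda>k. U k i j) = 0)"
proof -
  from sol_family_dependent[of "{..25::nat}" U] assms obtain c
    where c: "\<exists>k\<in>{..25::nat}. c k \<noteq> 0" "\<And>i j. (\<Sum>k\<le>25. c k * U k i j) = 0" by auto
  define m where "m = (\<Sum>k\<le>25. monom (c k) k)"
  have coeff: "coeff m k = (if k \<le> 25 then c k else 0)" for k
    unfolding m_def by (simp add: coeff_sum)
  have "m \<noteq> 0" using c(1) coeff by (metis atMost_iff coeff_0)
  moreover have "degree m \<le> 25" by (rule degree_le) (simp add: coeff)
  then have "pairing m (\<lambda>k. U k i j) = 0" for i j
    using c(2)[of i j] by (simp add: pairing_bound[of m 25] coeff)
  ultimately show ?thesis by blast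
qed

definition char_span :: "(nat \<Rightarrow> nat \<Rightarrow> complex) set" where
  "char_span = {u. \<exists>w. \<forall>i j. u i j = (\<Sum>z\<in>Z. w z * (fst z ^ i * snd z ^ j))}"

lemma char_span_shifts:
  assumes "u \<in> char_span"
  shows "(\<lambda>i j. u (Suc i) j - a * u i j) \<in> char_span" "(\<lambda>i j. u i (Suc j) - a * u i j) \<in> char_span"
proof -
  obtain w where w: "\<And>i j. u i j = (\<Sum>z\<in>Z. w z * (fst z ^ i * snd z ^ j))"
    using assms by (auto simp: char_span_def)
  have "u (Suc i) j - a * u i j = (\<Sum>z\<in>Z. w z * (fst z - a) * (fst z ^ i * snd z ^ j))" for i j
    by (simp add: w sum_distrib_left sum_subtractf[symmetric] algebra_simps)
  then show "(\<lambda>i j. u (Suc i) j - a * u i j) \<in> char_span"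
    unfolding char_span_def by (intro CollectI exI[of _ "\<lambda>z. w z * (fst z - a)"]) simp
  have "u i (Suc j) - a * u i j = (\<Sum>z\<in>Z. w z * (snd z - a) * (fst z ^ i * snd z ^ j))" for i j
    by (simp add: w sum_distrib_left sum_subtractf[symmetric] algebra_simps)
  then show "(\<lambda>i j. u i (Suc j) - a * u i j) \<in> char_span"
    unfolding char_span_def by (intro CollectI exI[of _ "\<lambda>z. w z * (snd z - a)"]) simp
qed

end

section \<open>Simple zeros: solutions are combinations of point evaluations\<close>

locale nondegenerate_cubic_pair = cubic_pair +
  assumes nondegenerate: "z \<in> Z \<Longrightarrow> J (fst z) (snd z) \<noteq> 0"
begin

text \<open>A joint generalised eigenvector of the two shifts modulo a single character would be a
  first-order differential operator at a point, which annihilates the ideal only if the Jacobian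
  vanishes there.\<close>
lemma joint_eigen:
  assumes "sol u"
    and fst_step: "\<And>i j. u (Suc i) j = a * u i j + w * (a ^ i * b ^ j)"
    and snd_step: "\<And>i j. u i (Suc j) = b * u i j + v * (a ^ i * b ^ j)"
    and notin: "(a, b) \<notin> Z \<Longrightarrow> w = 0 \<and> v = 0"
  shows "u i j = u 0 0 * (a ^ i * b ^ j)" "(a, b) \<notin> Z \<Longrightarrow> u 0 0 = 0"
proof -
  let ?g = "u 0 0"
  \<comment> \<open>The step rules make \<open>u\<close> the functional that sends f to g f + w f_x
    + v f_y at (a, b); the relations at index (0, 0) evaluate it at P and Q.\<close>
  have eqs: "?g * P a b + w * Px a b + v * Py a b = 0" "?g * Q a b + w * Qx a b + v * Qy a b = 0"
  proof -
    have "u 3 0 + L * u 1 2 + quad_shift p u 0 0 = 0" "u 0 3 - L * u 2 1 + quad_shift q u 0 0 = 0"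
      using assms(1)[unfolded sol_def, THEN conjunct1, rule_format, of 0 0]
        assms(1)[unfolded sol_def, THEN conjunct2, rule_format, of 0 0] by (simp_all only: add_0)
    then show "?g * P a b + w * Px a b + v * Py a b = 0" "?g * Q a b + w * Qx a b + v * Qy a b = 0"
      by (simp_all add: P_def Px_def Py_def Q_def Qx_def Qy_def quad_def quad_shift_def numeral_eq_Suc
          fst_step snd_step algebra_simps)
  qed
  have wv: "w = 0 \<and> v = 0"
  proof (cases "(a, b) \<in> Z")
    case True
    then have "w * Px a b + v * Py a b = 0" "w * Qx a b + v * Qy a b = 0"
      using eqs by (auto simp: Z_def)
    moreover have "J a b \<noteq> 0" using nondegenerate[OF True] by simp
    moreover have "w * J a b = Qy a b * (w * Px a b + v * Py a b) - Py a b * (w * Qx a b + v * Qy a b)"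
      "v * J a b = Px a b * (w * Qx a b + v * Qy a b) - Qx a b * (w * Px a b + v * Py a b)"
      by (simp_all add: J_def algebra_simps)
    ultimately have "w * J a b = 0" "v * J a b = 0" by (simp_all only:) simp_all
    with \<open>J a b \<noteq> 0\<close> show ?thesis by simp
  qed (use notin in blast)
  show "u i j = u 0 0 * (a ^ i * b ^ j)"
  proof (induction i)
    case 0
    show ?case by (induction j) (use snd_step wv in \<open>auto simp: algebra_simps\<close>)
  next
    case (Suc i)
    then show ?case using fst_step wv by (simp add: algebra_simps)
  qed
  show "?g = 0" if "(a, b) \<notin> Z"
    using that eqs wv by (auto simp: Z_def)
qed

text \<open>Applying the two shifts in either order gives w (snd z - b) = v (fst z - a) at every
  zero z. Away from (a, b) both weights can therefore be divided consistently, by whichever factor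
  is nonzero. Subtracting the resulting combination \<open>t\<close> leaves a sequence concentrated
  at (a, b), to which \<open>joint_eigen\<close> applies.\<close>

lemma char_span_socle:
  assumes u: "sol u"
    and "(\<lambda>i j. u (Suc i) j - a * u i j) \<in> char_span" "(\<lambda>i j. u i (Suc j) - b * u i j) \<in> char_span"
  shows "u \<in> char_span"
proof -
  obtain w v where w: "\<And>i j. u (Suc i) j - a * u i j = (\<Sum>z\<in>Z. w z * (fst z ^ i * snd z ^ j))"
    and v: "\<And>i j. u i (Suc j) - b * u i j = (\<Sum>z\<in>Z. v z * (fst z ^ i * snd z ^ j))"
    using assms(2,3) by (auto simp: char_span_def)
  have comm: "w z * (snd z - b) = v z * (fst z - a)" if "z \<in> Z" for z
  proof -
    have "(\<Sum>z\<in>Z. (w z * (snd z - b) - v z * (fst z - a)) * fst z ^ i * snd z ^ j) = 0" for i j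
    proof -
      have "(\<Sum>z\<in>Z. (w z * (snd z - b) - v z * (fst z - a)) * fst z ^ i * snd z ^ j) =
        (\<Sum>z\<in>Z. w z * (fst z ^ i * snd z ^ Suc j)) - b * (\<Sum>z\<in>Z. w z * (fst z ^ i * snd z ^ j))
        - ((\<Sum>z\<in>Z. v z * (fst z ^ Suc i * snd z ^ j)) - a * (\<Sum>z\<in>Z. v z * (fst z ^ i * snd z ^ j)))"
        by (simp add: sum_distrib_left sum_subtractf[symmetric] algebra_simps)
      also have "\<dots> = 0"
        unfolding w[symmetric] v[symmetric] by (simp add: algebra_simps)
      finally show ?thesis .
    qed
    from characters_independent[OF finite_Z this that] show ?thesis by simp
  qed
  define t where "t z = (if fst z \<noteq> a then w z / (fst z - a) else if snd z \<noteq> b then v z / (snd z - b) else 0)" for z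
  have t: "w z - t z * (fst z - a) = (if z = (a, b) then w z else 0)"
    "v z - t z * (snd z - b) = (if z = (a, b) then v z else 0)" if "z \<in> Z" for z
    using comm[OF that] by (cases z; auto simp: t_def field_simps)+
  define u0 where "u0 i j = u i j - (\<Sum>z\<in>Z. t z * (fst z ^ i * snd z ^ j))" for i j
  have sol0: "sol u0"
    using sol_diff[OF u sol_lincomb[of Z "\<lambda>z i j. fst z ^ i * snd z ^ j" t], of 1] sol_character
    by (simp add: u0_def[abs_def])
  define w0 where "w0 = (if (a, b) \<in> Z then w (a, b) else 0)"
  define v0 where "v0 = (if (a, b) \<in> Z then v (a, b) else 0)"
  have step_fst: "u0 (Suc i) j = a * u0 i j + w0 * (a ^ i * b ^ j)" for i j
  proof -
    have "u0 (Suc i) j - a * u0 i j = (\<Sum>z\<in>Z. (w z - t z * (fst z - a)) * (fst z ^ i * snd z ^ j))"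
      using w[of i j] by (simp add: u0_def sum_distrib_left sum_subtractf sum.distrib algebra_simps)
    also have "\<dots> = (\<Sum>z\<in>Z. if z = (a, b) then w z * (a ^ i * b ^ j) else 0)"
      by (rule sum.cong) (auto simp: t)
    also have "\<dots> = w0 * (a ^ i * b ^ j)" using finite_Z by (simp add: w0_def)
    finally show ?thesis by (simp add: algebra_simps)
  qed
  have step_snd: "u0 i (Suc j) = b * u0 i j + v0 * (a ^ i * b ^ j)" for i j
  proof -
    have "u0 i (Suc j) - b * u0 i j = (\<Sum>z\<in>Z. (v z - t z * (snd z - b)) * (fst z ^ i * snd z ^ j))"
      using v[of i j] by (simp add: u0_def sum_distrib_left sum_subtractf sum.distrib algebra_simps)
    also have "\<dots> = (\<Sum>z\<in>Z. if z = (a, b) then v z * (a ^ i * b ^ j) else 0)"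
      by (rule sum.cong) (auto simp: t)
    also have "\<dots> = v0 * (a ^ i * b ^ j)" using finite_Z by (simp add: v0_def)
    finally show ?thesis by (simp add: algebra_simps)
  qed
  have notin: "w0 = 0 \<and> v0 = 0" if "(a, b) \<notin> Z" using that by (simp add: w0_def v0_def)
  note eig = joint_eigen[OF sol0 step_fst step_snd notin]
  have "u i j = (\<Sum>z\<in>Z. (t z + (if z = (a, b) then u0 0 0 else 0)) * (fst z ^ i * snd z ^ j))" for i j
  proof -
    have "(\<Sum>z\<in>Z. (if z = (a, b) then u0 0 0 else 0) * (fst z ^ i * snd z ^ j)) =
      (\<Sum>z\<in>Z. if z = (a, b) then u0 0 0 * (a ^ i * b ^ j) else 0)" by (rule sum.cong) auto
    also have "\<dots> = u0 i j"
    proof (cases "(a, b) \<in> Z")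
      case True
      then show ?thesis using finite_Z eig(1)[of i j] by simp
    next
      case False
      then show ?thesis using finite_Z eig(1)[of i j] eig(2)[OF False] by simp
    qed
    finally show ?thesis by (simp add: u0_def sum.distrib distrib_right)
  qed
  then show ?thesis unfolding char_span_def
    by (intro CollectI exI[of _ "\<lambda>z. t z + (if z = (a, b) then u0 0 0 else 0)"]) simp
qed

text \<open>Peels the roots \<open>b\<close> off \<open>n\<close>. The assumption on the first shift
  passes to \<open>u i (Suc j) - b * u i j\<close>, so the induction hypothesis puts that sequence
  into the span and the socle lemma brings back \<open>u\<close>.\<close>

lemma char_span_if_fst:
  assumes "sol u" "(\<lambda>i j. u (Suc i) j - a * u i j) \<in> char_span"
    and "n \<noteq> 0" "(\<lambda>i j. pairing n (\<lambda>k. u i (j + k))) \<in> char_span"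
  shows "u \<in> char_span"
  using assms
proof (induction "degree n" arbitrary: n u)
  case 0
  then obtain c where c: "n = [:c:]" "c \<noteq> 0" by (metis degree_eq_zeroE pCons_0_0)
  obtain w where "\<And>i j. c * u i j = (\<Sum>z\<in>Z. w z * (fst z ^ i * snd z ^ j))"
    using 0(5) by (auto simp: char_span_def c pairing_def)
  then have "u i j = (\<Sum>z\<in>Z. w z / c * (fst z ^ i * snd z ^ j))" for i j
    using c(2) by (simp add: sum_divide_distrib[symmetric] field_simps)
  then show ?case unfolding char_span_def by (intro CollectI exI[of _ "\<lambda>z. w z / c"]) simp
next
  case (Suc d)
  have "\<not> constant (poly n)" using Suc(2) by (simp add: constant_degree)
  then obtain b where "poly n b = 0" using fundamental_theorem_of_algebra by blast
  then obtain n' where n': "n = [:- b, 1:] * n'" by (auto simp: poly_eq_0_iff_dvd)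
  have "n' \<noteq> 0" using Suc.prems(3) n' by auto
  have deg: "d = degree n'" using Suc(2) \<open>n' \<noteq> 0\<close> unfolding n' by (subst (asm) degree_mult_eq) auto
  let ?v = "\<lambda>i j. u i (Suc j) - b * u i j"
  have "sol ?v" by (intro sol_diff sol_shift_snd Suc.prems)
  moreover have "(\<lambda>i j. ?v (Suc i) j - a * ?v i j) \<in> char_span"
    using char_span_shifts(2)[OF Suc.prems(2), of b] by (simp add: algebra_simps)
  moreover have "(\<lambda>i j. pairing n' (\<lambda>k. ?v i (j + k))) \<in> char_span"
    using Suc.prems(4) unfolding n' pairing_linear_factor by simp
  ultimately have "?v \<in> char_span" using Suc.hyps(1)[OF deg] \<open>n' \<noteq> 0\<close> by blast
  then show ?case using char_span_socle Suc.prems by blast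
qed

text \<open>Peels the roots off a polynomial in the first shift; at each root the second index is
  handled by \<open>char_span_if_fst\<close> with an annihilating polynomial of the second
  shift.\<close>

lemma sol_in_char_span_aux:
  assumes "sol u" "m \<noteq> 0" "(\<lambda>i j. pairing m (\<lambda>k. u (i + k) j)) \<in> char_span"
  shows "u \<in> char_span"
  using assms
proof (induction "degree m" arbitrary: m u)
  case 0
  then obtain c where c: "m = [:c:]" "c \<noteq> 0" by (metis degree_eq_zeroE pCons_0_0)
  obtain w where "\<And>i j. c * u i j = (\<Sum>z\<in>Z. w z * (fst z ^ i * snd z ^ j))"
    using 0(4) by (auto simp: char_span_def c pairing_def)
  then have "u i j = (\<Sum>z\<in>Z. w z / c * (fst z ^ i * snd z ^ j))" for i j
    using c(2) by (simp add: sum_divide_distrib[symmetric] field_simps)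
  then show ?case unfolding char_span_def by (intro CollectI exI[of _ "\<lambda>z. w z / c"]) simp
next
  case (Suc d)
  have "\<not> constant (poly m)" using Suc(2) by (simp add: constant_degree)
  then obtain a where "poly m a = 0" using fundamental_theorem_of_algebra by blast
  then obtain m' where m': "m = [:- a, 1:] * m'" by (auto simp: poly_eq_0_iff_dvd)
  have "m' \<noteq> 0" using Suc.prems(2) m' by auto
  have deg: "d = degree m'" using Suc(2) \<open>m' \<noteq> 0\<close> unfolding m' by (subst (asm) degree_mult_eq) auto
  let ?v = "\<lambda>i j. u (Suc i) j - a * u i j"
  have "sol ?v" by (intro sol_diff sol_shift_fst Suc.prems)
  moreover have "(\<lambda>i j. pairing m' (\<lambda>k. ?v (i + k) j)) \<in> char_span"
    using Suc.prems(3) unfolding m' pairing_linear_factor by simp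
  ultimately have v: "?v \<in> char_span" using Suc.hyps(1)[OF deg] \<open>m' \<noteq> 0\<close> by blast
  obtain n where "n \<noteq> 0" "\<forall>i j. pairing n (\<lambda>k. u i (j + k)) = 0"
    using sol_annihilated[of "\<lambda>k i j. u i (j + k)"] sol_shift_snd_n[OF Suc.prems(1)] by blast
  moreover from this have "(\<lambda>i j. pairing n (\<lambda>k. u i (j + k))) \<in> char_span"
    by (auto simp: char_span_def intro!: exI[of _ "\<lambda>_. 0"])
  ultimately show ?case using char_span_if_fst[OF Suc.prems(1) v] by blast
qed

text \<open>In ideal terms: simple zeros make the ideal (P, Q) radical, so that functionals
  vanishing on it see only the values at the zeros.\<close>

lemma sol_in_char_span:
  assumes "sol u"
  shows "u \<in> char_span"
proof -
  obtain n where n: "n \<noteq> 0" "\<forall>i j. pairing n (\<lambda>k. u (i + k) j) = 0"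
    using sol_annihilated[of "\<lambda>k i j. u (i + k) j"] sol_shift_fst_n[OF assms(1)] by blast
  moreover from this have "(\<lambda>i j. pairing n (\<lambda>k. u (i + k) j)) \<in> char_span"
    by (auto simp: char_span_def intro!: exI[of _ "\<lambda>_. 0"])
  ultimately show ?thesis using sol_in_char_span_aux assms by blast
qed

end

section \<open>The Euler--Jacobi formula\<close>

definition quad_coeffs :: "'a::zero \<Rightarrow> 'a \<Rightarrow> 'a \<Rightarrow> 'a \<Rightarrow> 'a \<Rightarrow> 'a \<Rightarrow> nat \<Rightarrow> nat \<Rightarrow> 'a" where
  "quad_coeffs a20 a11 a02 a10 a01 a00 i j =
    (if i = 2 \<and> j = 0 then a20 else if i = 1 \<and> j = 1 then a11 else if i = 0 \<and> j = 2 then a02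
     else if i = 1 \<and> j = 0 then a10 else if i = 0 \<and> j = 1 then a01 else if i = 0 \<and> j = 0 then a00 else 0)"

lemma quad_quad_coeffs [simp]:
  "quad (quad_coeffs a20 a11 a02 a10 a01 a00) x y =
    a20 * x\<^sup>2 + a11 * x * y + a02 * y\<^sup>2 + a10 * x + a01 * y + a00"
  by (simp add: quad_def quad_coeffs_def)

context nondegenerate_cubic_pair
begin

definition residue_weights :: "(complex \<times> complex \<Rightarrow> complex) \<Rightarrow> bool" where
  "residue_weights w \<longleftrightarrow> (\<forall>i j. i + j < 4 \<longrightarrow> (\<Sum>z\<in>Z. w z * (fst z ^ i * snd z ^ j)) = 0) \<and>
    (\<Sum>z\<in>Z. w z * fst z ^ 4) = - (L * \<nu>) \<and> (\<Sum>z\<in>Z. w z * (fst z ^ 3 * snd z)) = 0 \<and>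
    (\<Sum>z\<in>Z. w z * (fst z ^ 2 * snd z ^ 2)) = \<nu> \<and> (\<Sum>z\<in>Z. w z * (fst z * snd z ^ 3)) = 0 \<and>
    (\<Sum>z\<in>Z. w z * snd z ^ 4) = L * \<nu>"

lemma ex_residue_weights: "\<exists>w. residue_weights w"
proof -
  obtain u where u: "sol u" "\<forall>i j. i + j < 4 \<longrightarrow> u i j = 0" "u 4 0 = - (L * \<nu>)" "u 3 1 = 0"
    "u 2 2 = \<nu>" "u 1 3 = 0" "u 0 4 = L * \<nu>"
    using ex_residue_sol by blast
  obtain w where w: "\<And>i j. u i j = (\<Sum>z\<in>Z. w z * (fst z ^ i * snd z ^ j))"
    using sol_in_char_span[OF u(1)] by (auto simp: char_span_def)
  show ?thesis
    using u(2-) w[of 4 0] w[of 3 1] w[of 2 2] w[of 1 3] w[of 0 4]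
    by (intro exI[of _ w]) (auto simp: residue_weights_def w)
qed

text \<open>The moments below degree 4 vanish, so only the degree-4 part of the product
  contributes.\<close>

lemma residue_quad_mult:
  assumes "residue_weights w"
  shows "(\<Sum>z\<in>Z. w z * (quad a (fst z) (snd z) * quad b (fst z) (snd z))) =
    \<nu> * (a 2 0 * b 0 2 + a 0 2 * b 2 0 + a 1 1 * b 1 1 - L * a 2 0 * b 2 0 + L * a 0 2 * b 0 2)"
proof -
  define S where "S i j = (\<Sum>z\<in>Z. w z * (fst z ^ i * snd z ^ j))" for i j
  have low: "S i j = 0" if "i + j < 4" for i j
    using assms that unfolding residue_weights_def S_def by blast
  have S4: "S 4 0 = - (L * \<nu>)" "S 3 1 = 0" "S 2 2 = \<nu>" "S 1 3 = 0" "S 0 4 = L * \<nu>"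
    using assms unfolding residue_weights_def S_def by auto
  have "(\<Sum>z\<in>Z. w z * (quad a (fst z) (snd z) * quad b (fst z) (snd z))) =
      a 2 0 * b 2 0 * S 4 0 + (a 2 0 * b 1 1 + a 1 1 * b 2 0) * S 3 1
    + (a 2 0 * b 0 2 + a 0 2 * b 2 0 + a 1 1 * b 1 1) * S 2 2
    + (a 0 2 * b 1 1 + a 1 1 * b 0 2) * S 1 3 + a 0 2 * b 0 2 * S 0 4
    + (a 2 0 * b 1 0 + a 1 0 * b 2 0) * S 3 0
    + (a 2 0 * b 0 1 + a 0 1 * b 2 0 + a 1 1 * b 1 0 + a 1 0 * b 1 1) * S 2 1
    + (a 0 2 * b 1 0 + a 1 0 * b 0 2 + a 1 1 * b 0 1 + a 0 1 * b 1 1) * S 1 2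
    + (a 0 2 * b 0 1 + a 0 1 * b 0 2) * S 0 3
    + (a 2 0 * b 0 0 + a 0 0 * b 2 0 + a 1 0 * b 1 0) * S 2 0
    + (a 1 1 * b 0 0 + a 0 0 * b 1 1 + a 1 0 * b 0 1 + a 0 1 * b 1 0) * S 1 1
    + (a 0 2 * b 0 0 + a 0 0 * b 0 2 + a 0 1 * b 0 1) * S 0 2
    + (a 1 0 * b 0 0 + a 0 0 * b 1 0) * S 1 0 + (a 0 1 * b 0 0 + a 0 0 * b 0 1) * S 0 1
    + a 0 0 * b 0 0 * S 0 0"
    unfolding S_def sum_distrib_left sum.distrib[symmetric]
    by (rule sum.cong[OF refl]) (simp add: quad_def algebra_simps power2_eq_square power3_eq_cube power4_eq_xxxx)
  then show ?thesis unfolding S4 by (simp add: low algebra_simps)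
qed

text \<open>The determinant of divided differences (the Bezoutian) of the pair vanishes at two distinct
  common zeros and is the Jacobian on the diagonal.\<close>
lemma residue_weight_eq:
  assumes w: "residue_weights w" and z0: "z0 \<in> Z"
  shows "w z0 * J (fst z0) (snd z0) = 1"
proof -
  obtain x y where xy: "z0 = (x, y)" by (cases z0)
  \<comment> \<open>Divided differences along the path (x, y), (u, y), (u, v): \<open>a\<close> is
    (P(x, y) - P(u, y)) / (x - u) and \<open>b\<close> is (P(u, y) - P(u, v)) / (y - v), as
    polynomials in (u, v); \<open>c\<close> and \<open>d\<close> do the same for Q.\<close>
  define a where "a = quad_coeffs 1 0 0 (x + p 2 0) 0 (x\<^sup>2 + L * y\<^sup>2 + p 2 0 * x + p 1 1 * y + p 1 0)"
  define b where "b = quad_coeffs 0 L 0 (L * y + p 1 1) (p 0 2) (p 0 2 * y + p 0 1)"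
  define c where "c = quad_coeffs 0 0 0 (- L * y + q 2 0) 0 (- L * x * y + q 2 0 * x + q 1 1 * y + q 1 0)"
  define d where "d = quad_coeffs (- L) 0 1 (q 1 1) (y + q 0 2) (y\<^sup>2 + q 0 2 * y + q 0 1)"
  define \<Delta> where "\<Delta> u v = quad a u v * quad d u v - quad b u v * quad c u v" for u v
  have P: "quad a u v * (x - u) + quad b u v * (y - v) = P x y - P u v" for u v
    unfolding a_def b_def P_def quad_def
    by (simp add: quad_coeffs_def algebra_simps power2_eq_square power3_eq_cube)
  have Q: "quad c u v * (x - u) + quad d u v * (y - v) = Q x y - Q u v" for u v
    unfolding c_def d_def Q_def quad_def
    by (simp add: quad_coeffs_def algebra_simps power2_eq_square power3_eq_cube)
  have off_diag: "\<Delta> u v = 0" if "(u, v) \<in> Z" "(u, v) \<noteq> (x, y)" for u v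
  proof -
    have e: "quad a u v * (x - u) + quad b u v * (y - v) = 0" "quad c u v * (x - u) + quad d u v * (y - v) = 0"
      using P[of u v] Q[of u v] that(1) z0 by (auto simp: Z_def xy)
    have "\<Delta> u v * (x - u) = quad d u v * (quad a u v * (x - u) + quad b u v * (y - v))
        - quad b u v * (quad c u v * (x - u) + quad d u v * (y - v))"
      "\<Delta> u v * (y - v) = quad a u v * (quad c u v * (x - u) + quad d u v * (y - v))
        - quad c u v * (quad a u v * (x - u) + quad b u v * (y - v))"
      by (simp_all add: \<Delta>_def algebra_simps)
    then have "\<Delta> u v * (x - u) = 0" "\<Delta> u v * (y - v) = 0" unfolding e by simp_all
    with that(2) show ?thesis by auto
  qed
  have "(\<Sum>z\<in>Z. w z * \<Delta> (fst z) (snd z)) = (\<Sum>z\<in>Z. if z = z0 then w z0 * \<Delta> x y else 0)"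
  proof (rule sum.cong[OF refl])
    fix z assume "z \<in> Z"
    then show "w z * \<Delta> (fst z) (snd z) = (if z = z0 then w z0 * \<Delta> x y else 0)"
      using off_diag[of "fst z" "snd z"] by (cases "z = z0") (auto simp: xy prod_eq_iff)
  qed
  also have "\<dots> = w z0 * \<Delta> x y" using z0 finite_Z by simp
  also have "\<Delta> x y = J x y"
    by (simp add: \<Delta>_def a_def b_def c_def d_def J_def Px_def Py_def Qx_def Qy_def algebra_simps power2_eq_square)
  also have "(\<Sum>z\<in>Z. w z * \<Delta> (fst z) (snd z)) =
      (\<Sum>z\<in>Z. w z * (quad a (fst z) (snd z) * quad d (fst z) (snd z)))
    - (\<Sum>z\<in>Z. w z * (quad b (fst z) (snd z) * quad c (fst z) (snd z)))"
    by (simp add: \<Delta>_def right_diff_distrib sum_subtractf)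
  also have "\<dots> = \<nu> + L\<^sup>2 * \<nu>"
    unfolding residue_quad_mult[OF w]
    by (simp add: a_def b_def c_def d_def quad_coeffs_def algebra_simps power2_eq_square)
  finally show ?thesis using \<nu>(1) xy by simp
qed

lemma residue_weights_inverse_J: "residue_weights (\<lambda>z. 1 / J (fst z) (snd z))"
proof -
  obtain w where w: "residue_weights w" using ex_residue_weights by blast
  have "w z = 1 / J (fst z) (snd z)" if "z \<in> Z" for z
    using residue_weight_eq[OF w that] nondegenerate[OF that] by (simp add: field_simps)
  then have "(\<Sum>z\<in>Z. w z * g z) = (\<Sum>z\<in>Z. 1 / J (fst z) (snd z) * g z)" for g
    by (intro sum.cong) auto
  then show ?thesis using w unfolding residue_weights_def by simp
qed

lemma card_Z: "card Z = 9"
proof -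
  define a where "a = quad_coeffs 3 0 L (2 * p 2 0) (p 1 1) (p 1 0)"
  define b where "b = quad_coeffs 0 (2 * L) 0 (p 1 1) (2 * p 0 2) (p 0 1)"
  define c where "c = quad_coeffs 0 (- 2 * L) 0 (2 * q 2 0) (q 1 1) (q 1 0)"
  define d where "d = quad_coeffs (- L) 0 3 (q 1 1) (2 * q 0 2) (q 0 1)"
  have J: "J x y = quad a x y * quad d x y - quad b x y * quad c x y" for x y
    by (simp add: J_def Px_def Py_def Qx_def Qy_def a_def b_def c_def d_def)
  let ?w = "\<lambda>z. 1 / J (fst z) (snd z)"
  have "of_nat (card Z) = (\<Sum>z\<in>Z. ?w z * J (fst z) (snd z))"
    using nondegenerate by simp
  also have "\<dots> = (\<Sum>z\<in>Z. ?w z * (quad a (fst z) (snd z) * quad d (fst z) (snd z)))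
    - (\<Sum>z\<in>Z. ?w z * (quad b (fst z) (snd z) * quad c (fst z) (snd z)))"
    unfolding sum_subtractf[symmetric] right_diff_distrib[symmetric] by (simp only: J)
  also have "\<dots> = 9 * (\<nu> + L\<^sup>2 * \<nu>)"
    unfolding residue_quad_mult[OF residue_weights_inverse_J]
    by (simp add: a_def b_def c_def d_def quad_coeffs_def algebra_simps power2_eq_square)
  finally have "of_nat (card Z) = (of_nat 9 :: complex)" using \<nu>(1) by simp
  then show ?thesis by (simp only: of_nat_eq_iff)
qed

end

section \<open>The residue form over the reals\<close>

context nondegenerate_cubic_pair
begin

text \<open>The residue form pairs the leading parts nondegenerately, because 1 + L^2 is nonzero, so
  the leading part vanishes. Multiplying the affine rest by x y^2, x^2 y and x^2 y^2 reads off its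
  coefficients against the moment \<nu> of x^2 y^2.\<close>

lemma quad_vanishing_on_Z:
  assumes van: "\<And>z. z \<in> Z \<Longrightarrow> quad a (fst z) (snd z) = 0"
  shows "a 2 0 = 0" "a 1 1 = 0" "a 0 2 = 0" "a 1 0 = 0" "a 0 1 = 0" "a 0 0 = 0"
proof -
  let ?w = "\<lambda>z. 1 / J (fst z) (snd z)"
  note W = residue_weights_inverse_J
  have "\<nu> * (a 2 0 * b 0 2 + a 0 2 * b 2 0 + a 1 1 * b 1 1 - L * a 2 0 * b 2 0 + L * a 0 2 * b 0 2) = 0" for b :: "nat \<Rightarrow> nat \<Rightarrow> complex"
    unfolding residue_quad_mult[OF W, symmetric] using van by (intro sum.neutral) auto
  then have top: "a 2 0 * b 0 2 + a 0 2 * b 2 0 + a 1 1 * b 1 1 - L * a 2 0 * b 2 0 + L * a 0 2 * b 0 2 = 0" for b :: "nat \<Rightarrow> nat \<Rightarrow> complex"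
    using \<nu>(2) by simp
  show a11: "a 1 1 = 0" using top[of "quad_coeffs 0 1 0 0 0 0"] by (simp add: quad_coeffs_def)
  have a02: "a 0 2 = L * a 2 0" using top[of "quad_coeffs 1 0 0 0 0 0"] by (simp add: quad_coeffs_def)
  have "a 2 0 + L * a 0 2 = 0" using top[of "quad_coeffs 0 0 1 0 0 0"] by (simp add: quad_coeffs_def)
  then have "(1 + L\<^sup>2) * a 2 0 = 0" by (simp add: a02 algebra_simps power2_eq_square)
  then show a20: "a 2 0 = 0" using L by simp
  then show a02': "a 0 2 = 0" using a02 by simp
  have lin: "quad a x y = a 1 0 * x + a 0 1 * y + a 0 0" for x y
    using a11 a20 a02' by (simp add: quad_def)
  define M where "M i j = (\<Sum>z\<in>Z. ?w z * (fst z ^ i * snd z ^ j))" for i j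
  have S: "a 1 0 * M (Suc i) j + a 0 1 * M i (Suc j) + a 0 0 * M i j = 0" for i j
  proof -
    have "a 1 0 * M (Suc i) j + a 0 1 * M i (Suc j) + a 0 0 * M i j
        = (\<Sum>z\<in>Z. ?w z * (fst z ^ i * snd z ^ j) * quad a (fst z) (snd z))"
      unfolding M_def sum_distrib_left sum.distrib[symmetric] lin
      by (intro sum.cong) (auto simp: algebra_simps add_divide_distrib)
    then show ?thesis using van by (simp add: sum.neutral)
  qed
  have low: "M i j = 0" if "i + j < 4" for i j
    using W that unfolding residue_weights_def M_def by blast
  have M4: "M 3 1 = 0" "M 2 2 = \<nu>" "M 1 3 = 0"
    using W unfolding residue_weights_def M_def by simp_all
  show a10: "a 1 0 = 0"
    using S[of 1 2] \<nu>(2) M4 by (simp add: low numeral_eq_Suc)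
  show a01: "a 0 1 = 0"
    using S[of 2 1] \<nu>(2) M4 by (simp add: low numeral_eq_Suc)
  show "a 0 0 = 0"
    using S[of 2 2] \<nu>(2) a10 a01 M4 by simp
qed

end

locale real_cubic_pair =
  fixes l :: real and pr qr :: "nat \<Rightarrow> nat \<Rightarrow> real"
  assumes nondegenerate_complex:
    "\<And>z. z \<in> cubic_pair.Z (complex_of_real l) (\<lambda>i j. complex_of_real (pr i j)) (\<lambda>i j. complex_of_real (qr i j)) \<Longrightarrow>
      cubic_pair.J (complex_of_real l) (\<lambda>i j. complex_of_real (pr i j)) (\<lambda>i j. complex_of_real (qr i j)) (fst z) (snd z) \<noteq> 0"
begin

lemma one_plus_sq: "1 + (complex_of_real l)\<^sup>2 \<noteq> 0"
proof -
  have "1 + l\<^sup>2 > 0" by (simp add: add_pos_nonneg)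
  then have "complex_of_real (1 + l\<^sup>2) \<noteq> 0" by (simp only: of_real_eq_0_iff)
  then show ?thesis by simp
qed

sublocale nondegenerate_cubic_pair "complex_of_real l" "\<lambda>i j. complex_of_real (pr i j)" "\<lambda>i j. complex_of_real (qr i j)"
proof -
  interpret cubic_pair "complex_of_real l" "\<lambda>i j. complex_of_real (pr i j)" "\<lambda>i j. complex_of_real (qr i j)"
    by unfold_locales (rule one_plus_sq)
  show "nondegenerate_cubic_pair (complex_of_real l) (\<lambda>i j. complex_of_real (pr i j)) (\<lambda>i j. complex_of_real (qr i j))"
    by unfold_locales (use nondegenerate_complex in blast)
qed

definition cnj2 :: "complex \<times> complex \<Rightarrow> complex \<times> complex" where
  "cnj2 z = (cnj (fst z), cnj (snd z))"

lemma fst_cnj2 [simp]: "fst (cnj2 z) = cnj (fst z)" and snd_cnj2 [simp]: "snd (cnj2 z) = cnj (snd z)"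
  and cnj2_cnj2 [simp]: "cnj2 (cnj2 z) = z"
  by (simp_all add: cnj2_def)

lemma cnj2_Z [simp]: "cnj2 z \<in> Z \<longleftrightarrow> z \<in> Z"
proof -
  have "P (cnj x) (cnj y) = cnj (P x y)" "Q (cnj x) (cnj y) = cnj (Q x y)" for x y
    by (simp_all add: P_def Q_def quad_def)
  then show ?thesis by (cases z) (simp add: Z_def cnj2_def)
qed

lemma cnj_J [simp]: "J (cnj x) (cnj y) = cnj (J x y)"
  by (simp add: J_def Px_def Py_def Qx_def Qy_def)

abbreviation rquad :: "(nat \<Rightarrow> nat \<Rightarrow> real) \<Rightarrow> complex \<times> complex \<Rightarrow> complex" where
  "rquad a z \<equiv> quad (\<lambda>i j. complex_of_real (a i j)) (fst z) (snd z)"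

lemma cnj_rquad [simp]: "rquad a (cnj2 z) = cnj (rquad a z)"
  by (simp add: quad_def)

definition R where "R = {z \<in> Z. cnj2 z = z}"
text \<open>One representative of each pair of conjugate nonreal zeros.\<close>

definition K where "K = {z \<in> Z. Im (fst z) > 0 \<or> (Im (fst z) = 0 \<and> Im (snd z) > 0)}"

lemma finite_R: "finite R" and finite_K: "finite K"
  using finite_Z by (auto simp: R_def K_def)

lemma R_iff: "cnj2 z = z \<longleftrightarrow> Im (fst z) = 0 \<and> Im (snd z) = 0"
  by (auto simp: cnj2_def prod_eq_iff complex_eq_iff)

lemma Z_cases:
  assumes "z \<in> Z"
  obtains "z \<in> R" | "z \<in> K" | "cnj2 z \<in> K"
  using assms unfolding R_def K_def R_iff by fastforce

lemma card_R_K: "card R + 2 * card K = 9"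
proof -
  have Z: "Z = R \<union> (K \<union> cnj2 ` K)"
  proof
    show "Z \<subseteq> R \<union> (K \<union> cnj2 ` K)"
    proof
      fix z assume "z \<in> Z"
      then show "z \<in> R \<union> (K \<union> cnj2 ` K)"
        by (cases rule: Z_cases) (auto intro: image_eqI[of _ cnj2 "cnj2 z"])
    qed
  qed (auto simp: R_def K_def)
  have "inj_on cnj2 K" by (metis cnj2_cnj2 inj_onI)
  then have "card (cnj2 ` K) = card K" by (rule card_image)
  moreover have "K \<inter> cnj2 ` K = {}" "R \<inter> (K \<union> cnj2 ` K) = {}"
    by (auto simp: R_def K_def R_iff)
  ultimately show ?thesis
    using card_Z finite_R finite_K unfolding Z by (simp add: card_Un_disjoint)
qed

lemma Re_of_real_mult: "Re (of_real s * c) = s * Re c" and Im_of_real_mult: "Im (of_real s * c) = s * Im c"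
  by simp_all

text \<open>\<open>s\<close> times the residue form is the sum of the terms \<open>t z\<close>. A
  conjugate pair contributes 2 Re (h^2) = 2 (Re h)^2 - 2 (Im h)^2, where h is sqrt (s / J) times the
  value of the quadratic polynomial. With all negative squares killed, the terms are nonnegative and
  their sum is not positive, so each of them is zero.\<close>

lemma definite_vanishing:
  assumes s: "s \<noteq> 0"
    and real_pts: "\<And>z. z \<in> R \<Longrightarrow> s * Re (J (fst z) (snd z)) < 0 \<Longrightarrow> rquad a z = 0"
    and nonreal_pts: "\<And>z. z \<in> K \<Longrightarrow> Im (csqrt (of_real s / J (fst z) (snd z)) * rquad a z) = 0"
    and le: "s * Re (\<Sum>z\<in>Z. 1 / J (fst z) (snd z) * (rquad a z * rquad a z)) \<le> 0"
    and z: "z \<in> Z"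
  shows "rquad a z = 0"
proof -
  define t where "t z = Re (of_real s / J (fst z) (snd z) * (rquad a z)\<^sup>2)" for z
  have t_cnj: "t (cnj2 z) = t z" for z
  proof -
    have "of_real s / J (fst (cnj2 z)) (snd (cnj2 z)) * (rquad a (cnj2 z))\<^sup>2
        = cnj (of_real s / J (fst z) (snd z) * (rquad a z)\<^sup>2)"
      unfolding cnj_rquad by simp
    then show ?thesis unfolding t_def by (simp only: complex_cnj cnj.sel)
  qed
  have K: "t z = (Re (csqrt (of_real s / J (fst z) (snd z)) * rquad a z))\<^sup>2" if "z \<in> K" for z
  proof -
    define h where "h = csqrt (of_real s / J (fst z) (snd z)) * rquad a z"
    have "of_real s / J (fst z) (snd z) * (rquad a z)\<^sup>2 = h\<^sup>2"
      by (simp add: h_def power_mult_distrib)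
    then have "t z = Re (h\<^sup>2)" by (simp add: t_def)
    also have "\<dots> = (Re h)\<^sup>2 - (Im h)\<^sup>2" by (simp add: power2_eq_square)
    finally show ?thesis using nonreal_pts[OF that] by (simp add: h_def)
  qed
  have R: "t z = (Re (rquad a z))\<^sup>2 * (s / Re (J (fst z) (snd z)))" "Im (rquad a z) = 0"
    "Re (J (fst z) (snd z)) \<noteq> 0" if "z \<in> R" for z
  proof -
    have zZ: "z \<in> Z" "cnj2 z = z" using that by (auto simp: R_def)
    have *: "cnj (rquad a z) = rquad a z" using cnj_rquad[of a z] zZ(2) by simp
    have **: "cnj (J (fst z) (snd z)) = J (fst z) (snd z)"
      using cnj_J[of "fst z" "snd z"] zZ(2) by (metis fst_cnj2 snd_cnj2)
    obtain g where g: "rquad a z = of_real g" using * by (metis Reals_cnj_iff Reals_cases)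
    obtain j where j: "J (fst z) (snd z) = of_real j" using ** by (metis Reals_cnj_iff Reals_cases)
    show "t z = (Re (rquad a z))\<^sup>2 * (s / Re (J (fst z) (snd z)))"
      unfolding t_def g j by (simp flip: of_real_power of_real_divide of_real_mult)
    show "Im (rquad a z) = 0" by (simp add: g)
    show "Re (J (fst z) (snd z)) \<noteq> 0" using nondegenerate[OF zZ(1)] j by auto
  qed
  have nonneg: "t z \<ge> 0" if "z \<in> Z" for z
    using that
  proof (cases rule: Z_cases)
    case 1
    show ?thesis
    proof (cases "s * Re (J (fst z) (snd z)) < 0")
      case True
      then show ?thesis using real_pts[OF 1] by (simp add: t_def)
    next
      case False
      then have "s / Re (J (fst z) (snd z)) \<ge> 0"
        by (simp add: zero_le_divide_iff not_less zero_le_mult_iff)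
      then show ?thesis unfolding R(1)[OF 1] by (intro mult_nonneg_nonneg) auto
    qed
  next
    case 3
    then show ?thesis using K[OF 3] t_cnj[of z] by simp
  qed (simp add: K)
  have "sum t Z = s * Re (\<Sum>z\<in>Z. 1 / J (fst z) (snd z) * (rquad a z * rquad a z))"
  proof -
    have "t z = s * Re (1 / J (fst z) (snd z) * (rquad a z * rquad a z))" for z
    proof -
      have "of_real s / J (fst z) (snd z) * (rquad a z)\<^sup>2 =
        of_real s * (1 / J (fst z) (snd z) * (rquad a z * rquad a z))" by (simp add: power2_eq_square)
      then show ?thesis unfolding t_def by (simp only: Re_of_real_mult)
    qed
    then show ?thesis unfolding Re_sum sum_distrib_left by (intro sum.cong refl)
  qed
  then have "sum t Z = 0" using le sum_nonneg[of Z t] nonneg by force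
  then have t0: "t z = 0" if "z \<in> Z" for z
    using that sum_nonneg_eq_0_iff[OF finite_Z, of t] nonneg by blast
  have K0: "rquad a z = 0" if "z \<in> K" for z
  proof -
    have zZ: "z \<in> Z" using that by (simp add: K_def)
    have "Re (csqrt (of_real s / J (fst z) (snd z)) * rquad a z) = 0"
      using t0[OF zZ] K[OF that] by simp
    then have "csqrt (of_real s / J (fst z) (snd z)) * rquad a z = 0"
      using nonreal_pts[OF that] by (simp only: complex_eq_iff) simp
    then show ?thesis using s nondegenerate[OF zZ] by simp
  qed
  show ?thesis using z
  proof (cases rule: Z_cases)
    case 1
    then show ?thesis using R[OF 1] t0[OF z] s by (simp add: complex_eq_iff)
  next
    case 2
    then show ?thesis by (rule K0)
  next
    case 3
    from K0[OF 3] show ?thesis unfolding cnj_rquad by (simp only: complex_cnj_zero_iff)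
  qed
qed

text \<open>Otherwise some nonzero combination of the \<open>b k\<close> makes all negative squares of the residue form
  vanish, hence by semidefiniteness also the positive ones.\<close>
lemma signature_bound:
  fixes b :: "nat \<Rightarrow> nat \<Rightarrow> nat \<Rightarrow> real"
  assumes s: "s \<noteq> 0"
    and semidefinite: "\<And>x a. (\<And>i j. a i j = (\<Sum>k<n. x k * b k i j)) \<Longrightarrow>
      s * Re (\<Sum>z\<in>Z. 1 / J (fst z) (snd z) * (rquad a z * rquad a z)) \<le> 0"
    and indep: "\<And>x a. (\<And>i j. a i j = (\<Sum>k<n. x k * b k i j)) \<Longrightarrow> a 2 0 = 0 \<Longrightarrow> a 1 1 = 0 \<Longrightarrow> a 0 2 = 0 \<Longrightarrow>
      a 1 0 = 0 \<Longrightarrow> a 0 1 = 0 \<Longrightarrow> a 0 0 = 0 \<Longrightarrow> (\<forall>k<n. x k = 0)"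
  shows "n \<le> card {z \<in> R. s * Re (J (fst z) (snd z)) < 0} + card K"
proof (rule ccontr)
  assume less: "\<not> ?thesis"
  define N where "N = {z \<in> R. s * Re (J (fst z) (snd z)) < 0}"
  have fin: "finite N" "finite K" using finite_R finite_K by (auto simp: N_def)
  have disj: "N \<inter> K = {}" by (auto simp: N_def R_def K_def R_iff)
  \<comment> \<open>One real linear condition per negative square: the value at a real zero with s J
    < 0, and the imaginary part of h for a conjugate pair.\<close>
  define e where "e z k = (if z \<in> N then Re (rquad (b k) z)
    else Im (csqrt (of_real s / J (fst z) (snd z)) * rquad (b k) z))" for z k
  have "card (N \<union> K) < card {..<n}"
    using less fin disj by (simp add: card_Un_disjoint N_def)
  from underdetermined_system[OF _ _ this, of e] fin obtain x
    where x: "\<exists>k<n. x k \<noteq> 0" "\<And>z. z \<in> N \<union> K \<Longrightarrow> (\<Sum>k<n. e z k * x k) = 0" by auto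
  define a where "a i j = (\<Sum>k<n. x k * b k i j)" for i j
  have a: "rquad a z = (\<Sum>k<n. of_real (x k) * rquad (b k) z)" for z
    by (simp add: quad_def a_def sum_distrib_left sum_distrib_right sum.distrib algebra_simps)
  have "rquad a z = 0" if "z \<in> Z" for z
  proof (rule definite_vanishing[OF s _ _ _ that])
    fix z assume "z \<in> R" "s * Re (J (fst z) (snd z)) < 0"
    then have "z \<in> N" by (simp add: N_def)
    then have "Re (rquad a z) = 0"
      using x(2)[of z] by (simp add: a e_def mult.commute)
    moreover have "Im (rquad a z) = 0"
    proof -
      have "cnj (rquad a z) = rquad a z"
        using cnj_rquad[of a z] \<open>z \<in> R\<close> by (simp only: R_def mem_Collect_eq)
      then show ?thesis by (simp add: complex_eq_iff)
    qed
    ultimately show "rquad a z = 0" by (simp only: complex_eq_iff zero_complex.sel)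
  next
    fix z assume "z \<in> K"
    then have "z \<notin> N" using disj by auto
    have "Im (csqrt (of_real s / J (fst z) (snd z)) * rquad a z) =
      Im (\<Sum>k<n. of_real (x k) * (csqrt (of_real s / J (fst z) (snd z)) * rquad (b k) z))"
      by (simp add: a sum_distrib_left mult.left_commute)
    also have "\<dots> = (\<Sum>k<n. e z k * x k)"
      unfolding Im_sum Im_of_real_mult using \<open>z \<notin> N\<close> by (simp add: e_def mult.commute)
    finally show "Im (csqrt (of_real s / J (fst z) (snd z)) * rquad a z) = 0"
      using x(2)[of z] \<open>z \<in> K\<close> by simp
  next
    show "s * Re (\<Sum>z\<in>Z. 1 / J (fst z) (snd z) * (rquad a z * rquad a z)) \<le> 0"
      by (rule semidefinite) (rule a_def)
  qed
  from quad_vanishing_on_Z[OF this] have "a 2 0 = 0" "a 1 1 = 0" "a 0 2 = 0" "a 1 0 = 0" "a 0 1 = 0" "a 0 0 = 0"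
    by (simp_all only: of_real_eq_0_iff)
  then have "\<forall>k<n. x k = 0" by (rule indep[OF a_def])
  with x(1) show False by blast
qed

lemma residue_rquad_square:
  "Re (\<Sum>z\<in>Z. 1 / J (fst z) (snd z) * (rquad a z * rquad a z)) =
    (2 * a 2 0 * a 0 2 + (a 1 1)\<^sup>2 - l * (a 2 0)\<^sup>2 + l * (a 0 2)\<^sup>2) / (1 + l\<^sup>2)"
proof -
  have "(\<Sum>z\<in>Z. 1 / J (fst z) (snd z) * (rquad a z * rquad a z)) =
    of_real ((2 * a 2 0 * a 0 2 + (a 1 1)\<^sup>2 - l * (a 2 0)\<^sup>2 + l * (a 0 2)\<^sup>2) / (1 + l\<^sup>2))"
    unfolding residue_quad_mult[OF residue_weights_inverse_J]
    by (simp add: \<nu>_def power2_eq_square add_divide_distrib diff_divide_distrib distrib_left right_diff_distrib mult.assoc)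
  then show ?thesis by simp
qed

theorem real_zeros_count:
  "2 * card {z \<in> R. Re (J (fst z) (snd z)) < 0} + 1 = card R" "card {z \<in> R. Re (J (fst z) (snd z)) < 0} \<le> 4"
proof -
  have pos: "1 + l\<^sup>2 > 0" by (simp add: add_pos_nonneg)
  define b4 where "b4 k = (if k = 0 then quad_coeffs 1 0 (-1) 0 0 0 else if k = 1 then quad_coeffs 0 0 0 1 0 0
    else if k = 2 then quad_coeffs 0 0 0 0 1 0 else quad_coeffs 0 0 0 0 0 (1::real))" for k :: nat
  define b5 where "b5 k = (if k = 0 then quad_coeffs 1 0 1 0 0 0 else if k = 1 then quad_coeffs 0 0 0 1 0 0
    else if k = 2 then quad_coeffs 0 0 0 0 1 0 else if k = 3 then quad_coeffs 0 0 0 0 0 1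
    else quad_coeffs 0 1 0 0 0 (0::real))" for k :: nat
  have less4: "(\<forall>k<4. A k) \<longleftrightarrow> A 0 \<and> A 1 \<and> A 2 \<and> A (3::nat)" for A
    by (auto simp: less_Suc_eq numeral_eq_Suc)
  have less5: "(\<forall>k<5. A k) \<longleftrightarrow> A 0 \<and> A 1 \<and> A 2 \<and> A 3 \<and> A (4::nat)" for A
    by (auto simp: less_Suc_eq numeral_eq_Suc)
  have sum4: "(\<Sum>k<4. A k) = A 0 + A 1 + A 2 + A (3::nat)" for A :: "nat \<Rightarrow> real"
    by (simp add: numeral_eq_Suc)
  have sum5: "(\<Sum>k<5. A k) = A 0 + A 1 + A 2 + A 3 + A (4::nat)" for A :: "nat \<Rightarrow> real"
    by (simp add: numeral_eq_Suc)
  have "4 \<le> card {z \<in> R. 1 * Re (J (fst z) (snd z)) < 0} + card K"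
  proof (rule signature_bound[where b = b4])
    fix x a assume "\<And>i j. a i j = (\<Sum>k<4. x k * b4 k i j)"
    then have a: "a 2 0 = x 0" "a 0 2 = - x 0" "a 1 1 = 0" "a 1 0 = x 1" "a 0 1 = x 2" "a 0 0 = x 3"
      by (simp_all add: sum4 b4_def quad_coeffs_def)
    show "1 * Re (\<Sum>z\<in>Z. 1 / J (fst z) (snd z) * (rquad a z * rquad a z)) \<le> 0"
      unfolding residue_rquad_square a using pos
      by (simp add: divide_le_0_iff)
    show "\<forall>k<4. x k = 0" if "a 2 0 = 0" "a 1 1 = 0" "a 0 2 = 0" "a 1 0 = 0" "a 0 1 = 0" "a 0 0 = 0"
      using that a by (simp add: less4)
  qed simp
  moreover have "5 \<le> card {z \<in> R. - 1 * Re (J (fst z) (snd z)) < 0} + card K"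
  proof (rule signature_bound[where b = b5])
    fix x a assume "\<And>i j. a i j = (\<Sum>k<5. x k * b5 k i j)"
    then have a: "a 2 0 = x 0" "a 0 2 = x 0" "a 1 1 = x 4" "a 1 0 = x 1" "a 0 1 = x 2" "a 0 0 = x 3"
      by (simp_all add: sum5 b5_def quad_coeffs_def)
    show "- 1 * Re (\<Sum>z\<in>Z. 1 / J (fst z) (snd z) * (rquad a z * rquad a z)) \<le> 0"
    proof -
      have "0 \<le> (2 * (x 0)\<^sup>2 + (x 4)\<^sup>2) / (1 + l\<^sup>2)" using pos by simp
      also have "\<dots> = (2 * x 0 * x 0 + (x 4)\<^sup>2 - l * (x 0)\<^sup>2 + l * (x 0)\<^sup>2) / (1 + l\<^sup>2)"
        by (simp add: power2_eq_square)
      finally show ?thesis unfolding residue_rquad_square a by (simp only: mult_minus1 neg_le_0_iff_le)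
    qed
    show "\<forall>k<5. x k = 0" if "a 2 0 = 0" "a 1 1 = 0" "a 0 2 = 0" "a 1 0 = 0" "a 0 1 = 0" "a 0 0 = 0"
      using that a by (simp add: less5)
  qed simp
  moreover have "card {z \<in> R. Re (J (fst z) (snd z)) < 0} + card {z \<in> R. Re (J (fst z) (snd z)) > 0} = card R"
  proof -
    have "Re (J (fst z) (snd z)) \<noteq> 0" if "z \<in> R" for z
    proof -
      have zZ: "z \<in> Z" "cnj2 z = z" using that by (auto simp: R_def)
      then have "cnj (J (fst z) (snd z)) = J (fst z) (snd z)"
        using cnj_J[of "fst z" "snd z"] by (metis fst_cnj2 snd_cnj2)
      then show ?thesis using nondegenerate[OF zZ(1)] by (auto simp: complex_eq_iff)
    qed
    then have "R = {z \<in> R. Re (J (fst z) (snd z)) < 0} \<union> {z \<in> R. Re (J (fst z) (snd z)) > 0}" by force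
    then have "card R = card ({z \<in> R. Re (J (fst z) (snd z)) < 0} \<union> {z \<in> R. Re (J (fst z) (snd z)) > 0})" by simp
    also have "\<dots> = card {z \<in> R. Re (J (fst z) (snd z)) < 0} + card {z \<in> R. Re (J (fst z) (snd z)) > 0}"
      using finite_R by (intro card_Un_disjoint) auto
    finally show ?thesis by simp
  qed
  \<comment> \<open>With n negative and p positive real zeros and k conjugate pairs, 4 \<le> n + k,
    5 \<le> p + k and n + p + 2 k = 9 force equality in both bounds, so p = n + 1 and n = 4 -
    k.\<close>
  ultimately show "2 * card {z \<in> R. Re (J (fst z) (snd z)) < 0} + 1 = card R" "card {z \<in> R. Re (J (fst z) (snd z)) < 0} \<le> 4"
    using card_R_K by simp_all
qed

end

section \<open>Normal form of the leading part\<close>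

lemma sum_atMost_4: "(\<Sum>i\<le>4. g i) = g 0 + g 1 + g 2 + g 3 + g (4::nat)"
  by (simp add: eval_nat_numeral)

lemma pdx_expand:
  assumes "deg4_coeffs c"
  shows "pdx c x y = of_real (4 * c 4 0) * x ^ 3 + of_real (3 * c 3 1) * x\<^sup>2 * y + of_real (2 * c 2 2) * x * y\<^sup>2
    + of_real (c 1 3) * y ^ 3
    + quad (\<lambda>i j. of_real (quad_coeffs (3 * c 3 0) (2 * c 2 1) (c 1 2) (2 * c 2 0) (c 1 1) (c 1 0) i j)) x y"
proof -
  have [simp]: "c i j = 0" if "4 < i + j" for i j using assms that by (simp add: deg4_coeffs_def)
  show ?thesis unfolding pdx_def sum_atMost_4
    by (simp add: quad_def quad_coeffs_def eval_nat_numeral algebra_simps)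
qed

lemma pdy_expand:
  assumes "deg4_coeffs c"
  shows "pdy c x y = of_real (c 3 1) * x ^ 3 + of_real (2 * c 2 2) * x\<^sup>2 * y + of_real (3 * c 1 3) * x * y\<^sup>2
    + of_real (4 * c 0 4) * y ^ 3
    + quad (\<lambda>i j. of_real (quad_coeffs (c 2 1) (2 * c 1 2) (3 * c 0 3) (c 1 1) (2 * c 0 2) (c 0 1) i j)) x y"
proof -
  have [simp]: "c i j = 0" if "4 < i + j" for i j using assms that by (simp add: deg4_coeffs_def)
  show ?thesis unfolding pdy_def sum_atMost_4
    by (simp add: quad_def quad_coeffs_def eval_nat_numeral algebra_simps)
qed

lemma pdxx_expand:
  assumes "deg4_coeffs c"
  shows "pdxx c x y = of_real (12 * c 4 0) * x\<^sup>2 + of_real (6 * c 3 1) * x * y + of_real (2 * c 2 2) * y\<^sup>2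
    + of_real (6 * c 3 0) * x + of_real (2 * c 2 1) * y + of_real (2 * c 2 0)"
proof -
  have [simp]: "c i j = 0" if "4 < i + j" for i j using assms that by (simp add: deg4_coeffs_def)
  show ?thesis unfolding pdxx_def sum_atMost_4
    by (simp add: eval_nat_numeral algebra_simps)
qed

lemma pdyy_expand:
  assumes "deg4_coeffs c"
  shows "pdyy c x y = of_real (2 * c 2 2) * x\<^sup>2 + of_real (6 * c 1 3) * x * y + of_real (12 * c 0 4) * y\<^sup>2
    + of_real (2 * c 1 2) * x + of_real (6 * c 0 3) * y + of_real (2 * c 0 2)"
proof -
  have [simp]: "c i j = 0" if "4 < i + j" for i j using assms that by (simp add: deg4_coeffs_def)
  show ?thesis unfolding pdyy_def sum_atMost_4
    by (simp add: eval_nat_numeral algebra_simps)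
qed

lemma pdxy_expand:
  assumes "deg4_coeffs c"
  shows "pdxy c x y = of_real (3 * c 3 1) * x\<^sup>2 + of_real (4 * c 2 2) * x * y + of_real (3 * c 1 3) * y\<^sup>2
    + of_real (2 * c 2 1) * x + of_real (2 * c 1 2) * y + of_real (c 1 1)"
proof -
  have [simp]: "c i j = 0" if "4 < i + j" for i j using assms that by (simp add: deg4_coeffs_def)
  show ?thesis unfolding pdxy_def sum_atMost_4
    by (simp add: eval_nat_numeral algebra_simps)
qed

lemma peval_expand:
  assumes "deg4_coeffs c"
  shows "peval c x y = of_real (c 4 0) * x ^ 4 + of_real (c 3 1) * x ^ 3 * y + of_real (c 2 2) * x\<^sup>2 * y\<^sup>2
    + of_real (c 1 3) * x * y ^ 3 + of_real (c 0 4) * y ^ 4 + of_real (c 3 0) * x ^ 3 + of_real (c 2 1) * x\<^sup>2 * y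
    + of_real (c 1 2) * x * y\<^sup>2 + of_real (c 0 3) * y ^ 3 + of_real (c 2 0) * x\<^sup>2 + of_real (c 1 1) * x * y
    + of_real (c 0 2) * y\<^sup>2 + of_real (c 1 0) * x + of_real (c 0 1) * y + of_real (c 0 0)"
proof -
  have [simp]: "c i j = 0" if "4 < i + j" for i j using assms that by (simp add: deg4_coeffs_def)
  show ?thesis unfolding peval_def sum_atMost_4
    by (simp add: eval_nat_numeral algebra_simps)
qed

lemma of_real_pdx: "pdx c (of_real x) (of_real y) = of_real (pdx c x y)"
  and of_real_pdy: "pdy c (of_real x) (of_real y) = of_real (pdy c x y)"
  and of_real_hess_det: "hess_det c (of_real x) (of_real y) = of_real (hess_det c x y)"
  by (simp_all add: pdx_def pdy_def hess_det_def pdxx_def pdyy_def pdxy_def)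

section \<open>Binary quartic forms under linear substitutions\<close>

definition hom4 :: "(nat \<Rightarrow> real) \<Rightarrow> 'a::real_field \<Rightarrow> 'a \<Rightarrow> 'a" where
  "hom4 d x y = (\<Sum>i\<le>4. of_real (d i) * x ^ i * y ^ (4 - i))"

lemma hom4_expand: "hom4 d x y = of_real (d 4) * x ^ 4 + of_real (d 3) * x ^ 3 * y + of_real (d 2) * x\<^sup>2 * y\<^sup>2
    + of_real (d 1) * x * y ^ 3 + of_real (d 0) * y ^ 4"
  unfolding hom4_def sum_atMost_4 by simp

lemma top4_eq_hom4: "top4 c = hom4 (\<lambda>i. c i (4 - i))"
  by (simp add: fun_eq_iff top4_def hom4_def)

lemma of_real_hom4: "hom4 d (of_real x) (of_real y) = of_real (hom4 d x y)"
  by (simp add: hom4_def)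

lemma ex_hom4_linear:
  "\<exists>d. \<forall>x y :: complex. hom4 c (of_real \<alpha> * x + of_real \<beta> * y) (of_real \<gamma> * x + of_real \<delta> * y) = hom4 d x y"
proof -
  define d where "d i = (if i = 0 then c 0 * (\<delta> ^ 4)
        + c 1 * (\<beta> * \<delta> ^ 3)
        + c 2 * (\<beta> ^ 2 * \<delta> ^ 2)
        + c 3 * (\<beta> ^ 3 * \<delta>)
        + c 4 * (\<beta> ^ 4)
      else if i = 1 then c 0 * (4 * \<gamma> * \<delta> ^ 3)
        + c 1 * (3 * \<beta> * \<gamma> * \<delta> ^ 2 + \<alpha> * \<delta> ^ 3)
        + c 2 * (2 * \<beta> ^ 2 * \<gamma> * \<delta> + 2 * \<alpha> * \<beta> * \<delta> ^ 2)
        + c 3 * (\<beta> ^ 3 * \<gamma> + 3 * \<alpha> * \<beta> ^ 2 * \<delta>)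
        + c 4 * (4 * \<alpha> * \<beta> ^ 3)
      else if i = 2 then c 0 * (6 * \<gamma> ^ 2 * \<delta> ^ 2)
        + c 1 * (3 * \<beta> * \<gamma> ^ 2 * \<delta> + 3 * \<alpha> * \<gamma> * \<delta> ^ 2)
        + c 2 * (\<beta> ^ 2 * \<gamma> ^ 2 + 4 * \<alpha> * \<beta> * \<gamma> * \<delta> + \<alpha> ^ 2 * \<delta> ^ 2)
        + c 3 * (3 * \<alpha> * \<beta> ^ 2 * \<gamma> + 3 * \<alpha> ^ 2 * \<beta> * \<delta>)
        + c 4 * (6 * \<alpha> ^ 2 * \<beta> ^ 2)
      else if i = 3 then c 0 * (4 * \<gamma> ^ 3 * \<delta>)
        + c 1 * (\<beta> * \<gamma> ^ 3 + 3 * \<alpha> * \<gamma> ^ 2 * \<delta>)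
        + c 2 * (2 * \<alpha> * \<beta> * \<gamma> ^ 2 + 2 * \<alpha> ^ 2 * \<gamma> * \<delta>)
        + c 3 * (3 * \<alpha> ^ 2 * \<beta> * \<gamma> + \<alpha> ^ 3 * \<delta>)
        + c 4 * (4 * \<alpha> ^ 3 * \<beta>)
      else if i = 4 then c 0 * (\<gamma> ^ 4)
        + c 1 * (\<alpha> * \<gamma> ^ 3)
        + c 2 * (\<alpha> ^ 2 * \<gamma> ^ 2)
        + c 3 * (\<alpha> ^ 3 * \<gamma>)
        + c 4 * (\<alpha> ^ 4) else 0)" for i :: nat
  show ?thesis
    unfolding hom4_expand
    by (intro exI[of _ d] allI) (simp add: d_def power2_eq_square power3_eq_cube power4_eq_xxxx algebra_simps)
qed

definition linear_image :: "real \<Rightarrow> real \<Rightarrow> real \<Rightarrow> real \<Rightarrow> (nat \<Rightarrow> real) \<Rightarrow> (nat \<Rightarrow> real) \<Rightarrow> bool" where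
  "linear_image \<alpha> \<beta> \<gamma> \<delta> c d \<longleftrightarrow> \<alpha> * \<delta> - \<beta> * \<gamma> \<noteq> 0 \<and>
    (\<forall>x y :: complex. hom4 c (of_real \<alpha> * x + of_real \<beta> * y) (of_real \<gamma> * x + of_real \<delta> * y) = hom4 d x y)"

definition normal_form :: "real \<Rightarrow> nat \<Rightarrow> real" where
  "normal_form l i = (if i = 4 then 1 else if i = 2 then 2 * l else if i = 0 then - 1 else 0)"

definition has_normal_form :: "(nat \<Rightarrow> real) \<Rightarrow> bool" where
  "has_normal_form c \<longleftrightarrow> (\<exists>\<alpha> \<beta> \<gamma> \<delta> l. linear_image \<alpha> \<beta> \<gamma> \<delta> c (normal_form l))"

lemma has_normal_form_compose:
  assumes 1: "linear_image \<alpha> \<beta> \<gamma> \<delta> c d" and "has_normal_form d"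
  shows "has_normal_form c"
proof -
  obtain \<alpha>' \<beta>' \<gamma>' \<delta>' l where 2: "linear_image \<alpha>' \<beta>' \<gamma>' \<delta>' d (normal_form l)"
    using assms(2) by (auto simp: has_normal_form_def)
  have "linear_image (\<alpha> * \<alpha>' + \<beta> * \<gamma>') (\<alpha> * \<beta>' + \<beta> * \<delta>') (\<gamma> * \<alpha>' + \<delta> * \<gamma>') (\<gamma> * \<beta>' + \<delta> * \<delta>') c (normal_form l)"
    unfolding linear_image_def
  proof (intro conjI allI)
    have "(\<alpha> * \<alpha>' + \<beta> * \<gamma>') * (\<gamma> * \<beta>' + \<delta> * \<delta>') - (\<alpha> * \<beta>' + \<beta> * \<delta>') * (\<gamma> * \<alpha>' + \<delta> * \<gamma>')
      = (\<alpha> * \<delta> - \<beta> * \<gamma>) * (\<alpha>' * \<delta>' - \<beta>' * \<gamma>')" by (simp add: algebra_simps)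
    then show "(\<alpha> * \<alpha>' + \<beta> * \<gamma>') * (\<gamma> * \<beta>' + \<delta> * \<delta>') - (\<alpha> * \<beta>' + \<beta> * \<delta>') * (\<gamma> * \<alpha>' + \<delta> * \<gamma>') \<noteq> 0"
      using 1 2 by (simp add: linear_image_def)
    fix x y :: complex
    let ?x = "of_real \<alpha>' * x + of_real \<beta>' * y" and ?y = "of_real \<gamma>' * x + of_real \<delta>' * y"
    have "hom4 c (of_real (\<alpha> * \<alpha>' + \<beta> * \<gamma>') * x + of_real (\<alpha> * \<beta>' + \<beta> * \<delta>') * y)
        (of_real (\<gamma> * \<alpha>' + \<delta> * \<gamma>') * x + of_real (\<gamma> * \<beta>' + \<delta> * \<delta>') * y)
      = hom4 c (of_real \<alpha> * ?x + of_real \<beta> * ?y) (of_real \<gamma> * ?x + of_real \<delta> * ?y)"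
      by (simp add: algebra_simps)
    also have "\<dots> = hom4 (normal_form l) x y"
      using 1 2 by (simp only: linear_image_def)
    finally show "hom4 c (of_real (\<alpha> * \<alpha>' + \<beta> * \<gamma>') * x + of_real (\<alpha> * \<beta>' + \<beta> * \<delta>') * y)
        (of_real (\<gamma> * \<alpha>' + \<delta> * \<gamma>') * x + of_real (\<gamma> * \<beta>' + \<delta> * \<delta>') * y)
      = hom4 (normal_form l) x y" .
  qed
  then show ?thesis unfolding has_normal_form_def by blast
qed

text \<open>The form (x^2 - y^2) (m x^2 + n y^2).\<close>

definition split_form :: "real \<Rightarrow> real \<Rightarrow> nat \<Rightarrow> real" where
  "split_form m n i = (if i = 4 then m else if i = 2 then n - m else if i = 0 then - n else 0)"

lemma split_form_normal:
  assumes "m > 0" "n > 0"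
  shows "has_normal_form (split_form m n)"
proof -
  define a where "a = 1 / sqrt (sqrt m)"
  define b where "b = 1 / sqrt (sqrt n)"
  have ab: "a > 0" "b > 0" using assms by (auto simp: a_def b_def)
  have a4: "m * a ^ 4 = 1"
  proof -
    have "sqrt (sqrt m) ^ 4 = ((sqrt (sqrt m))\<^sup>2)\<^sup>2" by (simp flip: power_mult)
    then have "sqrt (sqrt m) ^ 4 = m" using assms by simp
    then show ?thesis using assms by (simp add: a_def power_one_over)
  qed
  have b4: "n * b ^ 4 = 1"
  proof -
    have "sqrt (sqrt n) ^ 4 = ((sqrt (sqrt n))\<^sup>2)\<^sup>2" by (simp flip: power_mult)
    then have "sqrt (sqrt n) ^ 4 = n" using assms by simp
    then show ?thesis using assms by (simp add: b_def power_one_over)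
  qed
  have "linear_image a 0 0 b (split_form m n) (normal_form ((n - m) * a\<^sup>2 * b\<^sup>2 / 2))"
    unfolding linear_image_def
  proof (intro conjI allI)
    fix x y :: complex
    have "hom4 (split_form m n) (of_real a * x + of_real 0 * y) (of_real 0 * x + of_real b * y)
       = of_real (m * a ^ 4) * x ^ 4 + of_real ((n - m) * a\<^sup>2 * b\<^sup>2) * x\<^sup>2 * y\<^sup>2 - of_real (n * b ^ 4) * y ^ 4"
      unfolding hom4_expand by (simp add: split_form_def power_mult_distrib)
    also have "\<dots> = hom4 (normal_form ((n - m) * a\<^sup>2 * b\<^sup>2 / 2)) x y"
      unfolding a4 b4 hom4_expand by (simp add: normal_form_def)
    finally show "hom4 (split_form m n) (of_real a * x + of_real 0 * y) (of_real 0 * x + of_real b * y)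
       = hom4 (normal_form ((n - m) * a\<^sup>2 * b\<^sup>2 / 2)) x y" .
  qed (use ab in simp)
  then show ?thesis unfolding has_normal_form_def by blast
qed

text \<open>The form is x y (d3 x^2 + d2 x y + d1 y^2) with a definite second factor. Substituting
  (p (x + y), r (x - y)) turns x y into a multiple of x^2 - y^2, and p^2 = |d1|, r^2 = |d3| balance
  the outer coefficients so that the second factor loses its mixed term.\<close>

lemma axes_form_normal:
  assumes d: "d 0 = 0" "d 4 = 0" and disc: "(d 2)\<^sup>2 < 4 * d 1 * d 3"
  shows "has_normal_form d"
proof -
  have AC: "d 1 * d 3 > 0" using disc zero_le_power2[of "d 2"] by linarith
  define s where "s = sgn (d 3)"
  define k where "k = sqrt (d 1 * d 3)"
  have k: "k > 0" "k\<^sup>2 = d 1 * d 3" using AC by (auto simp: k_def)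
  have s: "s = 1 \<or> s = - 1" "d 3 = s * \<bar>d 3\<bar>" "d 1 = s * \<bar>d 1\<bar>" "s * s = 1"
    using AC by (auto simp: s_def sgn_if zero_less_mult_iff)
  define p where "p = sqrt \<bar>d 1\<bar>"
  define r where "r = sqrt \<bar>d 3\<bar>"
  have pr: "p > 0" "r > 0" "p\<^sup>2 = \<bar>d 1\<bar>" "r\<^sup>2 = \<bar>d 3\<bar>" "p * r = k"
    using AC by (auto simp: p_def r_def k_def abs_mult[symmetric] simp flip: real_sqrt_mult)
  have d1: "d 1 = s * p\<^sup>2" and d3: "d 3 = s * r\<^sup>2" using s(2,3) pr(3,4) by simp_all
  define M where "M = 2 * k ^ 3 + s * d 2 * k\<^sup>2"
  define N where "N = 2 * k ^ 3 - s * d 2 * k\<^sup>2"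
  have "\<bar>d 2\<bar> < 2 * k"
  proof -
    have "\<bar>d 2\<bar>\<^sup>2 < (2 * k)\<^sup>2" using disc k(2) by (simp add: power_mult_distrib)
    then show ?thesis by (rule power_less_imp_less_base) (use k(1) in simp)
  qed
  then have "\<bar>s * d 2\<bar> < 2 * k" using s(1) by auto
  then have "2 * k + s * d 2 > 0" "2 * k - s * d 2 > 0" by linarith+
  moreover have "M = k\<^sup>2 * (2 * k + s * d 2)" "N = k\<^sup>2 * (2 * k - s * d 2)"
    by (simp_all add: M_def N_def algebra_simps power2_eq_square power3_eq_cube)
  ultimately have MN: "M > 0" "N > 0" using k(1) by simp_all
  have prod: "hom4 d (of_real p * (x + y)) (of_real r * (x - y)) =
     of_real (s * M) * x ^ 4 + of_real (s * (N - M)) * x\<^sup>2 * y\<^sup>2 - of_real (s * N) * y ^ 4" for x y :: complex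
  proof -
    have e1: "d 3 * p ^ 3 * r = s * k ^ 3" 
    proof -
      have "d 3 * p ^ 3 * r = s * (r\<^sup>2 * p\<^sup>2) * (p * r)"
        unfolding d3 by (simp add: power2_eq_square power3_eq_cube)
      also have "\<dots> = s * k ^ 3" unfolding pr(5)[symmetric] by (simp add: power2_eq_square power3_eq_cube)
      finally show ?thesis .
    qed
    have e2: "d 1 * p * r ^ 3 = s * k ^ 3" 
    proof -
      have "d 1 * p * r ^ 3 = s * (r\<^sup>2 * p\<^sup>2) * (p * r)"
        unfolding d1 by (simp add: power2_eq_square power3_eq_cube)
      also have "\<dots> = s * k ^ 3" unfolding pr(5)[symmetric] by (simp add: power2_eq_square power3_eq_cube)
      finally show ?thesis .
    qed
    have e3: "d 2 * p\<^sup>2 * r\<^sup>2 = s * (s * d 2 * k\<^sup>2)"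
      unfolding pr(5)[symmetric] using s(4) by (simp add: power_mult_distrib flip: mult.assoc)
    have "hom4 d (of_real p * (x + y)) (of_real r * (x - y)) =
      of_real (d 3 * p ^ 3 * r) * ((x + y) ^ 3 * (x - y)) + of_real (d 2 * p\<^sup>2 * r\<^sup>2) * ((x + y)\<^sup>2 * (x - y)\<^sup>2)
      + of_real (d 1 * p * r ^ 3) * ((x + y) * (x - y) ^ 3)"
      unfolding hom4_expand using d by (simp add: power_mult_distrib)
    also have "\<dots> = of_real (s * M) * x ^ 4 + of_real (s * (N - M)) * x\<^sup>2 * y\<^sup>2 - of_real (s * N) * y ^ 4"
      unfolding e1 e2 e3 M_def N_def
      by (simp add: algebra_simps power2_eq_square power3_eq_cube power4_eq_xxxx)
    finally show ?thesis .
  qed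
  from s(1) show ?thesis
  proof
    assume s1: "s = 1"
    have "linear_image p p r (- r) d (split_form M N)"
      unfolding linear_image_def
    proof (intro conjI allI)
      fix x y :: complex
      show "hom4 d (of_real p * x + of_real p * y) (of_real r * x + of_real (- r) * y) = hom4 (split_form M N) x y"
        using prod[of x y] unfolding s1 by (simp add: hom4_expand[of "split_form M N"] split_form_def algebra_simps)
    qed (use pr k(1) in simp)
    then show ?thesis using has_normal_form_compose split_form_normal MN by blast
  next
    \<comment> \<open>Exchanging the two new coordinates absorbs the sign.\<close>
    assume s1: "s = - 1"
    have "linear_image p p (- r) r d (split_form N M)"
      unfolding linear_image_def
    proof (intro conjI allI)
      fix x y :: complex
      show "hom4 d (of_real p * x + of_real p * y) (of_real (- r) * x + of_real r * y) = hom4 (split_form N M) x y"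
        using prod[of y x] unfolding s1 by (simp add: hom4_expand[of "split_form N M"] split_form_def algebra_simps)
    qed (use pr k(1) in simp)
    then show ?thesis using has_normal_form_compose split_form_normal MN by blast
  qed
qed

text \<open>Exactly one linear factor vanishes at v, and it cannot also vanish at w without being
  the zero form. So the zero at t = 0 on the line v + t w is simple.\<close>

lemma nondeg_top_no_double_zero:
  assumes nd: "nondeg_top c" and vw: "vx * wy - vy * wx \<noteq> (0 :: complex)"
    and zero: "\<And>t. top4 c (vx + t * wx) (vy + t * wy) = t\<^sup>2 * (r0 + r1 * t + r2 * t\<^sup>2)"
  shows False
proof -
  obtain a b :: "nat \<Rightarrow> complex" where
    ab: "(\<forall>x y :: complex. top4 c x y = (\<Prod>k<4. a k * x + b k * y)) \<and>
      (\<forall>k<4. \<forall>l<4. k \<noteq> l \<longrightarrow> a k * b l - a l * b k \<noteq> 0)"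
    using nd unfolding nondeg_top_def by (elim exE)
  have fac: "top4 c x y = (\<Prod>k<4. a k * x + b k * y)" for x y using ab by simp
  have np: "a k * b l - a l * b k \<noteq> 0" if "k < 4" "l < 4" "k \<noteq> l" for k l using ab that by blast
  have "(\<Prod>k<4. a k * vx + b k * vy) = 0" using zero[of 0] by (simp add: fac)
  then obtain k where k: "k < 4" "a k * vx + b k * vy = 0" by auto
  have others: "a j * vx + b j * vy \<noteq> 0" if "j < 4" "j \<noteq> k" for j
  proof
    assume j: "a j * vx + b j * vy = 0"
    have "(a k * b j - a j * b k) * vx = b j * (a k * vx + b k * vy) - b k * (a j * vx + b j * vy)"
      "(a k * b j - a j * b k) * vy = a k * (a j * vx + b j * vy) - a j * (a k * vx + b k * vy)"
      by (simp_all add: algebra_simps)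
    then have "(a k * b j - a j * b k) * vx = 0" "(a k * b j - a j * b k) * vy = 0"
      unfolding k(2) j by simp_all
    moreover have "a k * b j - a j * b k \<noteq> 0" using np k(1) that by blast
    ultimately have "vx = 0" "vy = 0" by (simp_all only: mult_eq_0_iff simp_thms)
    then show False using vw by simp
  qed
  have wk: "a k * wx + b k * wy \<noteq> 0"
  proof
    assume w: "a k * wx + b k * wy = 0"
    have "a k * (vx * wy - vy * wx) = wy * (a k * vx + b k * vy) - vy * (a k * wx + b k * wy)"
      "b k * (vx * wy - vy * wx) = vx * (a k * wx + b k * wy) - wx * (a k * vx + b k * vy)"
      by (simp_all add: algebra_simps)
    then have "a k * (vx * wy - vy * wx) = 0" "b k * (vx * wy - vy * wx) = 0"
      unfolding k(2) w by simp_all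
    then have ab0: "a k = 0" "b k = 0" using vw by (simp_all only: mult_eq_0_iff simp_thms)
    obtain j :: nat where "j < 4" "k \<noteq> j" by (metis zero_less_numeral one_less_numeral_iff semiring_norm(76) zero_neq_one)
    then show False using np[OF k(1)] ab0 by fastforce
  qed
  \<comment> \<open>The quartic divided by \<open>t\<close>, minus the claimed quotient. It vanishes
    for t \<noteq> 0, hence by continuity at 0, where it is a product of nonzero factors.\<close>
  define h where "h t = (a k * wx + b k * wy) * (\<Prod>j\<in>{..<4} - {k}. a j * (vx + t * wx) + b j * (vy + t * wy))
     - t * (r0 + r1 * t + r2 * t\<^sup>2)" for t
  have "h t = 0" if "t \<noteq> 0" for t
  proof -
    have "t * h t = (a k * (vx + t * wx) + b k * (vy + t * wy)) * (\<Prod>j\<in>{..<4} - {k}. a j * (vx + t * wx) + b j * (vy + t * wy))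
       - t\<^sup>2 * (r0 + r1 * t + r2 * t\<^sup>2)"
    proof -
      have "a k * (vx + t * wx) + b k * (vy + t * wy) = t * (a k * wx + b k * wy) + (a k * vx + b k * vy)"
        by (simp add: algebra_simps)
      then have e: "a k * (vx + t * wx) + b k * (vy + t * wy) = t * (a k * wx + b k * wy)"
        by (simp only: k(2) add_0_right)
      show ?thesis unfolding e h_def by (simp add: power2_eq_square right_diff_distrib mult.assoc)
    qed
    also have "\<dots> = 0"
      using zero[of t] k(1) unfolding fac by (subst (asm) prod.remove[of _ k]) auto
    finally show ?thesis using that by simp
  qed
  then have "(h \<longlongrightarrow> 0) (at 0)"
    by (intro tendsto_eventually) (simp add: eventually_at_filter)
  moreover have "(h \<longlongrightarrow> h 0) (at 0)"
    unfolding h_def by (intro tendsto_intros)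
  ultimately have "h 0 = 0" using tendsto_unique[OF trivial_limit_at[of "0::complex"]] by blast
  moreover have "h 0 \<noteq> 0" using wk others by (simp add: h_def)
  ultimately show False by simp
qed

text \<open>With the two real lines as coordinate axes the form is x y times a quadratic form.
  Simplicity of the zeros makes the outer coefficients of that form nonzero, and a nonnegative
  discriminant would produce a third real line.\<close>

lemma two_lines_normal_form:
  assumes nd: "nondeg_top c" and card: "card (real_zero_lines c) = 2"
  shows "has_normal_form (\<lambda>i. c i (4 - i))"
proof -
  define line where "line x y = {(t * x, t * y) | t. True}" for x y :: real
  have lines: "real_zero_lines c = {line x y | x y. (x, y) \<noteq> (0, 0) \<and> top4 c x y = (0::real)}"
    by (simp add: real_zero_lines_def line_def)
  obtain l1 l2 where l12: "real_zero_lines c = {l1, l2}" "l1 \<noteq> l2"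
    using card by (auto simp: card_2_iff)
  obtain x1 y1 where 1: "l1 = line x1 y1" "(x1, y1) \<noteq> (0, 0)" "top4 c x1 y1 = 0"
    using l12(1) unfolding lines by blast
  obtain x2 y2 where 2: "l2 = line x2 y2" "(x2, y2) \<noteq> (0, 0)" "top4 c x2 y2 = 0"
    using l12(1) unfolding lines by blast
  have line_eq: "line x y = line x' y'" if "(x, y) \<noteq> (0, 0)" "(x', y') = (s * x, s * y)" "s \<noteq> 0" for x y x' y' s
  proof -
    have "p \<in> line x' y'" if "p \<in> line x y" for p
    proof -
      obtain t where "p = (t * x, t * y)" using \<open>p \<in> line x y\<close> unfolding line_def by blast
      then have "p = (t / s * x', t / s * y')" using \<open>(x', y') = (s * x, s * y)\<close> \<open>s \<noteq> 0\<close> by simp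
      then show ?thesis unfolding line_def by blast
    qed
    moreover have "p \<in> line x y" if "p \<in> line x' y'" for p
    proof -
      obtain t where "p = (t * x', t * y')" using \<open>p \<in> line x' y'\<close> unfolding line_def by blast
      then have "p = (t * s * x, t * s * y)" using \<open>(x', y') = (s * x, s * y)\<close> by simp
      then show ?thesis unfolding line_def by blast
    qed
    ultimately show ?thesis by blast
  qed
  have in_line: "(x, y) \<in> line x y" for x y
    unfolding line_def by (rule CollectI, rule exI[of _ 1]) simp
  have det: "x1 * y2 - x2 * y1 \<noteq> 0"
  proof
    assume det: "x1 * y2 - x2 * y1 = 0"
    have "\<exists>s. (x2, y2) = (s * x1, s * y1)"
    proof (cases "x1 = 0")
      case True
      then have "y1 \<noteq> 0" using 1(2) by simp
      then show ?thesis using det True by (intro exI[of _ "y2 / y1"]) auto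
    next
      case False
      then show ?thesis using det by (intro exI[of _ "x2 / x1"]) (auto simp: field_simps)
    qed
    then obtain s where s: "(x2, y2) = (s * x1, s * y1)" by blast
    then have "s \<noteq> 0" using 2(2) by auto
    from line_eq[OF 1(2) s this] 1 2 l12(2) show False by simp
  qed
  define e where "e = (\<lambda>i. c i (4 - i))"
  obtain d where d: "\<And>x y :: complex. hom4 e (of_real x1 * x + of_real x2 * y) (of_real y1 * x + of_real y2 * y) = hom4 d x y"
    using ex_hom4_linear[of e x1 x2 y1 y2] by blast
  have d_real: "hom4 e (x1 * x + x2 * y) (y1 * x + y2 * y) = hom4 d x y" for x y :: real
  proof -
    have "complex_of_real (hom4 e (x1 * x + x2 * y) (y1 * x + y2 * y)) = of_real (hom4 d x y)"
      using d[of "of_real x" "of_real y"] by (simp flip: of_real_hom4)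
    then show ?thesis by (simp only: of_real_eq_iff)
  qed
  have top_real: "top4 c x y = hom4 e x y" for x y :: real by (simp add: top4_eq_hom4 e_def)
  have top_complex: "top4 c x y = hom4 e x y" for x y :: complex by (simp add: top4_eq_hom4 e_def)
  have d4: "d 4 = 0" using d_real[of 1 0] 1(3) by (simp add: top_real hom4_expand[of d])
  have d0: "d 0 = 0" using d_real[of 0 1] 2(3) by (simp add: top_real hom4_expand[of d])
  have detc: "complex_of_real x1 * of_real y2 - of_real y1 * of_real x2 \<noteq> 0"
  proof -
    have "complex_of_real (x1 * y2 - x2 * y1) \<noteq> 0" unfolding of_real_eq_0_iff by (rule det)
    then show ?thesis by (simp add: mult.commute)
  qed
  have d3: "d 3 \<noteq> 0"
  proof
    assume "d 3 = 0"
    then have "top4 c (of_real x1 + t * of_real x2) (of_real y1 + t * of_real y2)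
        = t\<^sup>2 * (of_real (d 2) + of_real (d 1) * t + 0 * t\<^sup>2)" for t :: complex
      using d[of 1 t] d4 d0 by (simp add: top_complex hom4_expand[of d] power2_eq_square power3_eq_cube algebra_simps)
    then show False by (rule nondeg_top_no_double_zero[OF nd detc])
  qed
  have detc': "complex_of_real x2 * of_real y1 - of_real y2 * of_real x1 \<noteq> 0"
    using detc by (simp add: algebra_simps)
  have d1: "d 1 \<noteq> 0"
  proof
    assume "d 1 = 0"
    then have "top4 c (of_real x2 + t * of_real x1) (of_real y2 + t * of_real y1)
        = t\<^sup>2 * (of_real (d 2) + of_real (d 3) * t + 0 * t\<^sup>2)" for t :: complex
      using d[of t 1] d4 d0 by (simp add: top_complex hom4_expand[of d] power2_eq_square power3_eq_cube algebra_simps)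
    then show False by (rule nondeg_top_no_double_zero[OF nd detc'])
  qed
  have "(d 2)\<^sup>2 < 4 * d 1 * d 3"
  proof (rule ccontr)
    assume "\<not> ?thesis"
    then have nn: "(d 2)\<^sup>2 - 4 * d 1 * d 3 \<ge> 0" by simp
    define t where "t = (- d 2 + sqrt ((d 2)\<^sup>2 - 4 * d 1 * d 3)) / (2 * d 3)"
    have root: "d 3 * t\<^sup>2 + d 2 * t + d 1 = 0"
    proof -
      have "(2 * d 3 * t + d 2)\<^sup>2 = (d 2)\<^sup>2 - 4 * d 1 * d 3" using nn d3 by (simp add: t_def)
      then have "4 * d 3 * (d 3 * t\<^sup>2 + d 2 * t + d 1) = 0" by (simp add: power2_eq_square algebra_simps)
      then show ?thesis using d3 by simp
    qed
    then have t0: "t \<noteq> 0" using d1 by auto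
    let ?x = "x1 * t + x2" and ?y = "y1 * t + y2"
    have ind: "?x * y2 - x2 * ?y = (x1 * y2 - x2 * y1) * t" "x1 * ?y - ?x * y1 = x1 * y2 - x2 * y1"
      by (simp_all add: algebra_simps)
    have nz: "(?x, ?y) \<noteq> (0, 0)" using ind(2) det by auto
    have "top4 c ?x ?y = t * (d 3 * t\<^sup>2 + d 2 * t + d 1)"
      using d_real[of t 1] d4 d0 by (simp add: top_real hom4_expand[of d] power2_eq_square power3_eq_cube algebra_simps)
    then have "line ?x ?y \<in> real_zero_lines c" using root nz unfolding lines by auto
    then have "(?x, ?y) \<in> line x1 y1 \<or> (?x, ?y) \<in> line x2 y2"
      using in_line[of ?x ?y] l12(1) 1(1) 2(1) by auto
    then show False
    proof
      assume "(?x, ?y) \<in> line x1 y1"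
      then obtain s where "?x = s * x1" "?y = s * y1" by (auto simp: line_def)
      then show False using ind(2) det by simp
    next
      assume "(?x, ?y) \<in> line x2 y2"
      then obtain s where "?x = s * x2" "?y = s * y2" by (auto simp: line_def)
      then show False using ind(1) det t0 by simp
    qed
  qed
  then have "has_normal_form d" using axes_form_normal d0 d4 by blast
  moreover have "linear_image x1 x2 y1 y2 e d"
    using d det by (simp add: linear_image_def)
  ultimately have "has_normal_form e" using has_normal_form_compose by blast
  then show ?thesis unfolding e_def .
qed

section \<open>The index formula for critical points\<close>

lemma quad_linear:
  "quad a (\<alpha> * x + \<beta> * y) (\<gamma> * x + \<delta> * y) =
    quad (quad_coeffs (a 2 0 * \<alpha>\<^sup>2 + a 1 1 * \<alpha> * \<gamma> + a 0 2 * \<gamma>\<^sup>2)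
      (2 * a 2 0 * \<alpha> * \<beta> + a 1 1 * (\<alpha> * \<delta> + \<beta> * \<gamma>) + 2 * a 0 2 * \<gamma> * \<delta>)
      (a 2 0 * \<beta>\<^sup>2 + a 1 1 * \<beta> * \<delta> + a 0 2 * \<delta>\<^sup>2)
      (a 1 0 * \<alpha> + a 0 1 * \<gamma>) (a 1 0 * \<beta> + a 0 1 * \<delta>) (a 0 0)) x y"
  by (simp add: quad_def quad_coeffs_def algebra_simps power2_eq_square)

lemma of_real_quad_coeffs:
  "of_real (quad_coeffs a b c d e f i j) = quad_coeffs (of_real a) (of_real b) (of_real c) (of_real d) (of_real e) (of_real f) i j"
  by (simp add: quad_coeffs_def)

lemma ex_quad_linear_comb:
  "\<exists>r. \<forall>x y :: complex. of_real s * quad (\<lambda>i j. of_real (a i j)) (of_real \<alpha> * x + of_real \<beta> * y) (of_real \<gamma> * x + of_real \<delta> * y)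
      + of_real t * quad (\<lambda>i j. of_real (b i j)) (of_real \<alpha> * x + of_real \<beta> * y) (of_real \<gamma> * x + of_real \<delta> * y)
    = quad (\<lambda>i j. of_real (r i j)) x y"
proof -
  define T where "T a = quad_coeffs (a 2 0 * \<alpha>\<^sup>2 + a 1 1 * \<alpha> * \<gamma> + a 0 2 * \<gamma>\<^sup>2)
      (2 * a 2 0 * \<alpha> * \<beta> + a 1 1 * (\<alpha> * \<delta> + \<beta> * \<gamma>) + 2 * a 0 2 * \<gamma> * \<delta>)
      (a 2 0 * \<beta>\<^sup>2 + a 1 1 * \<beta> * \<delta> + a 0 2 * \<delta>\<^sup>2)
      (a 1 0 * \<alpha> + a 0 1 * \<gamma>) (a 1 0 * \<beta> + a 0 1 * \<delta>) (a 0 0)"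
    for a :: "nat \<Rightarrow> nat \<Rightarrow> real"
  have T: "quad (\<lambda>i j. complex_of_real (a i j)) (of_real \<alpha> * x + of_real \<beta> * y) (of_real \<gamma> * x + of_real \<delta> * y)
    = quad (\<lambda>i j. of_real (T a i j)) x y" for a x y
    unfolding quad_linear T_def of_real_quad_coeffs by simp
  show ?thesis
    unfolding T by (intro exI[of _ "\<lambda>i j. s * T a i j + t * T b i j"] allI) (simp add: quad_def algebra_simps)
qed

text \<open>The chain rule over an arbitrary real normed field: over the complex numbers it computes
  the Jacobian after the change of coordinates, over the reals the derivatives along a line.\<close>

lemma pdx_line_deriv:
  fixes x y :: "'a::real_normed_field"
  assumes c: "deg4_coeffs c" and x: "(X has_field_derivative \<alpha>) (at t)" "X t = x"
    and y: "(Y has_field_derivative \<gamma>) (at t)" "Y t = y"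
  shows "((\<lambda>t. pdx c (X t) (Y t)) has_field_derivative \<alpha> * pdxx c x y + \<gamma> * pdxy c x y) (at t)"
    and "((\<lambda>t. pdy c (X t) (Y t)) has_field_derivative \<alpha> * pdxy c x y + \<gamma> * pdyy c x y) (at t)"
    and "((\<lambda>t. peval c (X t) (Y t)) has_field_derivative \<alpha> * pdx c x y + \<gamma> * pdy c x y) (at t)"
  unfolding pdx_expand[OF c] pdy_expand[OF c] pdxx_expand[OF c] pdxy_expand[OF c] pdyy_expand[OF c]
    peval_expand[OF c] quad_def
  by (rule derivative_eq_intros x(1) y(1) refl | simp add: x(2) y(2) quad_coeffs_def algebra_simps power2_eq_square power3_eq_cube)+


lemma hom4_line_deriv:
  fixes x y :: "'a::real_normed_field"
  assumes x: "(X has_field_derivative \<alpha>) (at t)" "X t = x" and y: "(Y has_field_derivative \<gamma>) (at t)" "Y t = y"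
  shows "((\<lambda>t. hom4 e (X t) (Y t)) has_field_derivative
      \<alpha> * (of_real (4 * e 4) * x ^ 3 + of_real (3 * e 3) * x\<^sup>2 * y + of_real (2 * e 2) * x * y\<^sup>2 + of_real (e 1) * y ^ 3)
    + \<gamma> * (of_real (e 3) * x ^ 3 + of_real (2 * e 2) * x\<^sup>2 * y + of_real (3 * e 1) * x * y\<^sup>2 + of_real (4 * e 0) * y ^ 3)) (at t)"
  unfolding hom4_expand
  by (rule derivative_eq_intros x(1) y(1) refl | simp add: x(2) y(2) algebra_simps power2_eq_square power3_eq_cube)+

context cubic_pair
begin

lemma P_deriv: "((\<lambda>x. P x y) has_field_derivative Px x y) (at x)" "((\<lambda>y. P x y) has_field_derivative Py x y) (at y)"
  and Q_deriv: "((\<lambda>x. Q x y) has_field_derivative Qx x y) (at x)" "((\<lambda>y. Q x y) has_field_derivative Qy x y) (at y)"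
  unfolding P_def Q_def Px_def Py_def Qx_def Qy_def quad_def
  by (rule derivative_eq_intros refl | simp add: algebra_simps power2_eq_square power3_eq_cube)+

end

lemma critical_point_index:
  assumes "morse4 c" "card (real_zero_lines c) = 2"
  defines "C \<equiv> crit_points c :: (real \<times> real) set"
  shows "finite C" "card C = 2 * card {p \<in> C. hess_det c (fst p) (snd p) > 0} + 1"
    "card {p \<in> C. hess_det c (fst p) (snd p) > 0} \<le> 4"
proof -
  have deg: "deg4_coeffs c" and nd: "nondeg_top c"
    and morse: "\<And>x y :: complex. pdx c x y = 0 \<Longrightarrow> pdy c x y = 0 \<Longrightarrow> hess_det c x y \<noteq> 0"
    using assms(1) by (auto simp: morse4_def crit_points_def)
  define e where "e = (\<lambda>i. c i (4 - i))"
  obtain \<alpha> \<beta> \<gamma> \<delta> l where LI: "linear_image \<alpha> \<beta> \<gamma> \<delta> e (normal_form l)"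
    using two_lines_normal_form[OF nd assms(2)] unfolding e_def has_normal_form_def by blast
  define D where "D = \<alpha> * \<delta> - \<beta> * \<gamma>"
  have D: "D \<noteq> 0" using LI by (simp add: linear_image_def D_def)
  define X where "X x y = of_real \<alpha> * x + of_real \<beta> * y" for x y :: complex
  define Y where "Y x y = of_real \<gamma> * x + of_real \<delta> * y" for x y :: complex
  have nf: "hom4 e (X x y) (Y x y) = x ^ 4 + of_real (2 * l) * x\<^sup>2 * y\<^sup>2 - y ^ 4" for x y
    using LI by (simp add: linear_image_def X_def Y_def hom4_expand[of "normal_form l"] normal_form_def)
  have X1: "((\<lambda>x. X x y) has_field_derivative of_real \<alpha>) (at x)" "((\<lambda>y. X x y) has_field_derivative of_real \<beta>) (at y)"
    and Y1: "((\<lambda>x. Y x y) has_field_derivative of_real \<gamma>) (at x)" "((\<lambda>y. Y x y) has_field_derivative of_real \<delta>) (at y)" for x y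
    unfolding X_def Y_def by (auto intro!: derivative_eq_intros)
  let ?fx = "\<lambda>x y :: complex. of_real (4 * e 4) * x ^ 3 + of_real (3 * e 3) * x\<^sup>2 * y + of_real (2 * e 2) * x * y\<^sup>2 + of_real (e 1) * y ^ 3"
  let ?fy = "\<lambda>x y :: complex. of_real (e 3) * x ^ 3 + of_real (2 * e 2) * x\<^sup>2 * y + of_real (3 * e 1) * x * y\<^sup>2 + of_real (4 * e 0) * y ^ 3"
  \<comment> \<open>Differentiating the normal form identity yields the leading part of the gradient
    without any comparison of coefficients.\<close>
  have top_x: "of_real \<alpha> * ?fx (X x y) (Y x y) + of_real \<gamma> * ?fy (X x y) (Y x y) = 4 * x ^ 3 + of_real (4 * l) * x * y\<^sup>2" for x y
  proof (rule DERIV_unique)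
    show "((\<lambda>x. hom4 e (X x y) (Y x y)) has_field_derivative of_real \<alpha> * ?fx (X x y) (Y x y) + of_real \<gamma> * ?fy (X x y) (Y x y)) (at x)"
      by (rule hom4_line_deriv[OF X1(1) refl Y1(1) refl])
    show "((\<lambda>x. hom4 e (X x y) (Y x y)) has_field_derivative 4 * x ^ 3 + of_real (4 * l) * x * y\<^sup>2) (at x)"
      unfolding nf by (rule derivative_eq_intros refl | simp)+
  qed
  have top_y: "of_real \<beta> * ?fx (X x y) (Y x y) + of_real \<delta> * ?fy (X x y) (Y x y) = of_real (4 * l) * x\<^sup>2 * y - 4 * y ^ 3" for x y
  proof (rule DERIV_unique)
    show "((\<lambda>y. hom4 e (X x y) (Y x y)) has_field_derivative of_real \<beta> * ?fx (X x y) (Y x y) + of_real \<delta> * ?fy (X x y) (Y x y)) (at y)"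
      by (rule hom4_line_deriv[OF X1(2) refl Y1(2) refl])
    show "((\<lambda>y. hom4 e (X x y) (Y x y)) has_field_derivative of_real (4 * l) * x\<^sup>2 * y - 4 * y ^ 3) (at y)"
      unfolding nf by (rule derivative_eq_intros refl | simp)+
  qed
  define A where "A = quad_coeffs (3 * c 3 0) (2 * c 2 1) (c 1 2) (2 * c 2 0) (c 1 1) (c 1 0)"
  define B where "B = quad_coeffs (c 2 1) (2 * c 1 2) (3 * c 0 3) (c 1 1) (2 * c 0 2) (c 0 1)"
  have fx: "pdx c x y = ?fx x y + quad (\<lambda>i j. of_real (A i j)) x y"
    and fy: "pdy c x y = ?fy x y + quad (\<lambda>i j. of_real (B i j)) x y" for x y :: complex
    unfolding pdx_expand[OF deg] pdy_expand[OF deg] A_def B_def e_def by simp_all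
  \<comment> \<open>Let F be the polynomial in the new coordinates. The cubics are F_x / 4 and - F_y
    / 4, which makes the leading parts x^3 + l x y^2 and y^3 - l x^2 y; \<open>pr\<close> and
    \<open>qr\<close> are their parts of degree at most 2.\<close>
  obtain pr where pr: "\<And>x y. of_real (\<alpha> / 4) * quad (\<lambda>i j. complex_of_real (A i j)) (X x y) (Y x y)
      + of_real (\<gamma> / 4) * quad (\<lambda>i j. complex_of_real (B i j)) (X x y) (Y x y) = quad (\<lambda>i j. of_real (pr i j)) x y"
    using ex_quad_linear_comb[of "\<alpha> / 4" A \<alpha> \<beta> \<gamma> \<delta> "\<gamma> / 4" B] unfolding X_def Y_def by blast
  obtain qr where qr: "\<And>x y. of_real (- \<beta> / 4) * quad (\<lambda>i j. complex_of_real (A i j)) (X x y) (Y x y)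
      + of_real (- \<delta> / 4) * quad (\<lambda>i j. complex_of_real (B i j)) (X x y) (Y x y) = quad (\<lambda>i j. of_real (qr i j)) x y"
    using ex_quad_linear_comb[of "- \<beta> / 4" A \<alpha> \<beta> \<gamma> \<delta> "- \<delta> / 4" B] unfolding X_def Y_def by blast
  interpret N: cubic_pair "complex_of_real l" "\<lambda>i j. complex_of_real (pr i j)" "\<lambda>i j. complex_of_real (qr i j)"
  proof
    have "1 + l\<^sup>2 > 0" by (simp add: add_pos_nonneg)
    then have "complex_of_real (1 + l\<^sup>2) \<noteq> 0" by (simp only: of_real_eq_0_iff)
    then show "1 + (complex_of_real l)\<^sup>2 \<noteq> 0" by simp
  qed
  have P: "N.P x y = (of_real \<alpha> * pdx c (X x y) (Y x y) + of_real \<gamma> * pdy c (X x y) (Y x y)) / 4" for x y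
  proof -
    have "N.P x y = (of_real \<alpha> * ?fx (X x y) (Y x y) + of_real \<gamma> * ?fy (X x y) (Y x y)) / 4
      + (of_real (\<alpha> / 4) * quad (\<lambda>i j. complex_of_real (A i j)) (X x y) (Y x y)
      + of_real (\<gamma> / 4) * quad (\<lambda>i j. complex_of_real (B i j)) (X x y) (Y x y))"
      unfolding pr top_x N.P_def by simp
    then show ?thesis unfolding fx fy by (simp add: algebra_simps add_divide_distrib)
  qed
  have Q: "N.Q x y = - (of_real \<beta> * pdx c (X x y) (Y x y) + of_real \<delta> * pdy c (X x y) (Y x y)) / 4" for x y
  proof -
    have "N.Q x y = - (of_real \<beta> * ?fx (X x y) (Y x y) + of_real \<delta> * ?fy (X x y) (Y x y)) / 4
      + (of_real (- \<beta> / 4) * quad (\<lambda>i j. complex_of_real (A i j)) (X x y) (Y x y)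
      + of_real (- \<delta> / 4) * quad (\<lambda>i j. complex_of_real (B i j)) (X x y) (Y x y))"
      unfolding qr top_y N.Q_def by simp
    then show ?thesis unfolding fx fy by (simp add: algebra_simps add_divide_distrib diff_divide_distrib)
  qed
  have Z: "(x, y) \<in> N.Z \<longleftrightarrow> pdx c (X x y) (Y x y) = 0 \<and> pdy c (X x y) (Y x y) = 0" for x y
  proof -
    let ?a = "pdx c (X x y) (Y x y)" and ?b = "pdy c (X x y) (Y x y)"
    have "of_real D * ?a = 4 * (of_real \<delta> * N.P x y + of_real \<gamma> * N.Q x y)"
      "of_real D * ?b = - 4 * (of_real \<beta> * N.P x y + of_real \<alpha> * N.Q x y)"
      unfolding P Q D_def by (simp_all add: field_simps)
    then have "N.P x y = 0 \<Longrightarrow> N.Q x y = 0 \<Longrightarrow> ?a = 0 \<and> ?b = 0" using D by simp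
    moreover have "?a = 0 \<Longrightarrow> ?b = 0 \<Longrightarrow> N.P x y = 0 \<and> N.Q x y = 0" unfolding P Q by simp
    ultimately show ?thesis unfolding N.Z_def by blast
  qed
  \<comment> \<open>The Jacobian of (F_x / 4, - F_y / 4) is - 1/16 of the Hessian determinant of F,
    which is D^2 times that of the original polynomial. Thus extrema are the real zeros with J <
    0.\<close>
  have J: "N.J x y = of_real (- D\<^sup>2 / 16) * hess_det c (X x y) (Y x y)" for x y
  proof -
    let ?xx = "pdxx c (X x y) (Y x y)" and ?xy = "pdxy c (X x y) (Y x y)" and ?yy = "pdyy c (X x y) (Y x y)"
    have d1: "((\<lambda>x. pdx c (X x y) (Y x y)) has_field_derivative of_real \<alpha> * ?xx + of_real \<gamma> * ?xy) (at x)"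
      "((\<lambda>x. pdy c (X x y) (Y x y)) has_field_derivative of_real \<alpha> * ?xy + of_real \<gamma> * ?yy) (at x)"
      by (rule pdx_line_deriv[OF deg X1(1) refl Y1(1) refl])+
    have d2: "((\<lambda>y. pdx c (X x y) (Y x y)) has_field_derivative of_real \<beta> * ?xx + of_real \<delta> * ?xy) (at y)"
      "((\<lambda>y. pdy c (X x y) (Y x y)) has_field_derivative of_real \<beta> * ?xy + of_real \<delta> * ?yy) (at y)"
      by (rule pdx_line_deriv[OF deg X1(2) refl Y1(2) refl])+
    have e1: "N.Px x y = (of_real \<alpha> * (of_real \<alpha> * ?xx + of_real \<gamma> * ?xy) + of_real \<gamma> * (of_real \<alpha> * ?xy + of_real \<gamma> * ?yy)) / 4"
      by (rule DERIV_unique[OF N.P_deriv(1)]) (unfold P, intro DERIV_cdivide DERIV_add DERIV_cmult d1)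
    have e2: "N.Py x y = (of_real \<alpha> * (of_real \<beta> * ?xx + of_real \<delta> * ?xy) + of_real \<gamma> * (of_real \<beta> * ?xy + of_real \<delta> * ?yy)) / 4"
      by (rule DERIV_unique[OF N.P_deriv(2)]) (unfold P, intro DERIV_cdivide DERIV_add DERIV_cmult d2)
    have e3: "N.Qx x y = - (of_real \<beta> * (of_real \<alpha> * ?xx + of_real \<gamma> * ?xy) + of_real \<delta> * (of_real \<alpha> * ?xy + of_real \<gamma> * ?yy)) / 4"
      by (rule DERIV_unique[OF N.Q_deriv(1)]) (unfold Q, intro DERIV_cdivide DERIV_minus DERIV_add DERIV_cmult d1)
    have e4: "N.Qy x y = - (of_real \<beta> * (of_real \<beta> * ?xx + of_real \<delta> * ?xy) + of_real \<delta> * (of_real \<beta> * ?xy + of_real \<delta> * ?yy)) / 4"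
      by (rule DERIV_unique[OF N.Q_deriv(2)]) (unfold Q, intro DERIV_cdivide DERIV_minus DERIV_add DERIV_cmult d2)
    show ?thesis
      unfolding N.J_def e1 e2 e3 e4 hess_det_def D_def by (simp add: field_simps power2_eq_square)
  qed
  interpret N: real_cubic_pair l pr qr
  proof
    fix z assume "z \<in> N.Z"
    then show "N.J (fst z) (snd z) \<noteq> 0"
      using Z[of "fst z" "snd z"] morse D unfolding J by auto
  qed
  define Xr where "Xr x y = \<alpha> * x + \<beta> * y" for x y
  define Yr where "Yr x y = \<gamma> * x + \<delta> * y" for x y
  have XY: "X (of_real x) (of_real y) = of_real (Xr x y)" "Y (of_real x) (of_real y) = of_real (Yr x y)" for x y
    by (simp_all add: X_def Y_def Xr_def Yr_def)
  define g where "g p = (Xr (fst p) (snd p), Yr (fst p) (snd p))" for p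
  define h where "h p = (complex_of_real (fst p), complex_of_real (snd p))" for p
  define S where "S = {p. h p \<in> N.Z}"
  have S_iff: "p \<in> S \<longleftrightarrow> g p \<in> C" for p
    unfolding S_def h_def mem_Collect_eq Z XY of_real_pdx of_real_pdy by (simp add: C_def crit_points_def g_def)
  have "inj g"
  proof (rule injI)
    fix p p' assume eq: "g p = g p'"
    define u where "u = fst p - fst p'"
    define v where "v = snd p - snd p'"
    have "\<alpha> * u + \<beta> * v = 0" "\<gamma> * u + \<delta> * v = 0"
      using eq by (simp_all add: g_def Xr_def Yr_def u_def v_def algebra_simps)
    moreover have "D * u = \<delta> * (\<alpha> * u + \<beta> * v) - \<beta> * (\<gamma> * u + \<delta> * v)"
      "D * v = \<alpha> * (\<gamma> * u + \<delta> * v) - \<gamma> * (\<alpha> * u + \<beta> * v)"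
      by (simp_all add: D_def algebra_simps)
    ultimately have "D * u = 0" "D * v = 0" by simp_all
    then show "p = p'" using D by (simp add: u_def v_def prod_eq_iff)
  qed
  have "surj g"
  proof (rule surjI)
    fix p
    have "\<alpha> * ((\<delta> * fst p - \<beta> * snd p) / D) + \<beta> * ((\<alpha> * snd p - \<gamma> * fst p) / D) = (D * fst p) / D"
      "\<gamma> * ((\<delta> * fst p - \<beta> * snd p) / D) + \<delta> * ((\<alpha> * snd p - \<gamma> * fst p) / D) = (D * snd p) / D"
      by (simp_all add: D_def add_divide_distrib[symmetric] algebra_simps)
    then show "g ((\<delta> * fst p - \<beta> * snd p) / D, (\<alpha> * snd p - \<gamma> * fst p) / D) = p"
      using D by (simp add: g_def Xr_def Yr_def prod_eq_iff)
  qed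
  have C_eq: "C = g ` S"
  proof -
    have "S = g -` C" by (simp add: set_eq_iff S_iff)
    then show ?thesis using \<open>surj g\<close> by (simp only: surj_image_vimage_eq)
  qed
  have "inj h" by (auto simp: inj_def h_def prod_eq_iff)
  have R_eq: "N.R = h ` S"
  proof
    show "N.R \<subseteq> h ` S"
    proof
      fix z assume z: "z \<in> N.R"
      then have "z = h (Re (fst z), Re (snd z))"
        by (simp add: N.R_def N.R_iff h_def prod_eq_iff complex_eq_iff)
      moreover have "z \<in> N.Z" using z by (simp add: N.R_def)
      ultimately show "z \<in> h ` S" unfolding S_def by (metis image_eqI mem_Collect_eq)
    qed
  qed (auto simp: S_def N.R_def N.R_iff h_def)
  have sign: "Re (N.J (fst (h p)) (snd (h p))) < 0 \<longleftrightarrow> hess_det c (fst (g p)) (snd (g p)) > 0" for p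
  proof -
    have "N.J (fst (h p)) (snd (h p)) = of_real (- D\<^sup>2 / 16 * hess_det c (fst (g p)) (snd (g p)))"
      unfolding J h_def fst_conv snd_conv XY of_real_hess_det by (simp add: g_def)
    then have "Re (N.J (fst (h p)) (snd (h p))) = - D\<^sup>2 / 16 * hess_det c (fst (g p)) (snd (g p))" by simp
    moreover have "D\<^sup>2 > 0" using D by simp
    ultimately show ?thesis by (simp add: zero_less_mult_iff)
  qed
  have card_g: "card (g ` A) = card A" for A
    by (rule card_image[OF inj_on_subset[OF \<open>inj g\<close> subset_UNIV]])
  have card_h: "card (h ` A) = card A" for A
    by (rule card_image[OF inj_on_subset[OF \<open>inj h\<close> subset_UNIV]])
  have cards: "card {z \<in> N.R. Re (N.J (fst z) (snd z)) < 0} = card {p \<in> C. hess_det c (fst p) (snd p) > 0}"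
  proof -
    have "{z \<in> N.R. Re (N.J (fst z) (snd z)) < 0} = h ` {p \<in> S. hess_det c (fst (g p)) (snd (g p)) > 0}"
      unfolding R_eq using sign by auto
    moreover have "{p \<in> C. hess_det c (fst p) (snd p) > 0} = g ` {p \<in> S. hess_det c (fst (g p)) (snd (g p)) > 0}"
      unfolding C_eq by auto
    ultimately show ?thesis by (simp only: card_g card_h)
  qed
  have "finite S" using N.finite_R \<open>inj h\<close> unfolding R_eq
    by (rule finite_imageD[OF _ inj_on_subset[OF _ subset_UNIV]])
  then show "finite C" by (simp add: C_eq)
  have "card C = card N.R"
    unfolding C_eq R_eq by (simp only: card_g card_h)
  then show "card C = 2 * card {p \<in> C. hess_det c (fst p) (snd p) > 0} + 1"
    "card {p \<in> C. hess_det c (fst p) (snd p) > 0} \<le> 4"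
    using N.real_zeros_count unfolding cards by simp_all
qed

section \<open>Local maxima\<close>

lemma has_field_derivative_peval_line:
  fixes x y h k :: real
  assumes "deg4_coeffs c"
  shows "((\<lambda>t. peval c (x + t * h) (y + t * k)) has_field_derivative
      h * pdx c (x + t * h) (y + t * k) + k * pdy c (x + t * h) (y + t * k)) (at t)"
    and "((\<lambda>t. h * pdx c (x + t * h) (y + t * k) + k * pdy c (x + t * h) (y + t * k)) has_field_derivative
      h\<^sup>2 * pdxx c (x + t * h) (y + t * k) + 2 * h * k * pdxy c (x + t * h) (y + t * k)
        + k\<^sup>2 * pdyy c (x + t * h) (y + t * k)) (at t)"
proof -
  have X: "((\<lambda>t. x + t * h) has_field_derivative h) (at t)"
    and Y: "((\<lambda>t. y + t * k) has_field_derivative k) (at t)"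
    by (auto intro!: derivative_eq_intros)
  note d = pdx_line_deriv[OF assms X refl Y refl]
  show "((\<lambda>t. peval c (x + t * h) (y + t * k)) has_field_derivative
      h * pdx c (x + t * h) (y + t * k) + k * pdy c (x + t * h) (y + t * k)) (at t)"
    by (rule d(3))
  show "((\<lambda>t. h * pdx c (x + t * h) (y + t * k) + k * pdy c (x + t * h) (y + t * k)) has_field_derivative
      h\<^sup>2 * pdxx c (x + t * h) (y + t * k) + 2 * h * k * pdxy c (x + t * h) (y + t * k)
        + k\<^sup>2 * pdyy c (x + t * h) (y + t * k)) (at t)"
    by (rule DERIV_cong[OF DERIV_add[OF DERIV_cmult[OF d(1)] DERIV_cmult[OF d(2)]]])
      (simp add: algebra_simps power2_eq_square)
qed

lemma local_max_necessary:
  assumes deg: "deg4_coeffs c" and max: "(x, y) \<in> local_max_points c"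
  shows "h * pdx c x y + k * pdy c x y = 0"
    and "h\<^sup>2 * pdxx c x y + 2 * h * k * pdxy c x y + k\<^sup>2 * pdyy c x y \<le> 0"
proof -
  obtain e where e: "e > 0" "\<And>q. dist q (x, y) < e \<Longrightarrow> peval c (fst q) (snd q) \<le> peval c x y"
    using max by (auto simp: local_max_points_def)
  define \<phi> where "\<phi> t = peval c (x + t * h) (y + t * k)" for t
  define \<psi> where "\<psi> t = h * pdx c (x + t * h) (y + t * k) + k * pdy c (x + t * h) (y + t * k)" for t
  define q where "q = h\<^sup>2 * pdxx c x y + 2 * h * k * pdxy c x y + k\<^sup>2 * pdyy c x y"
  have d1: "(\<phi> has_field_derivative \<psi> t) (at t)" for t
    unfolding \<phi>_def \<psi>_def by (rule has_field_derivative_peval_line[OF deg])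
  have d2: "(\<psi> has_field_derivative q) (at 0)"
    unfolding \<psi>_def q_def using has_field_derivative_peval_line(2)[OF deg, where x = x and h = h and y = y and k = k and t = 0] by simp
  \<comment> \<open>The summand 1 keeps the divisor positive when (h, k) = 0.\<close>
  define n where "n = 1 + norm (h, k)"
  have n: "n > 0" by (simp add: n_def add_pos_nonneg)
  have local: "\<phi> t \<le> \<phi> 0" if "\<bar>t\<bar> < e / n" for t
  proof -
    have "dist (x + t * h, y + t * k) (x, y) = \<bar>t\<bar> * norm (h, k)"
    proof -
      have "(x + t * h, y + t * k) - (x, y) = t *\<^sub>R (h, k)" by simp
      then show ?thesis by (simp only: dist_norm norm_scaleR)
    qed
    also have "\<dots> \<le> \<bar>t\<bar> * n" by (intro mult_left_mono) (auto simp: n_def)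
    also have "\<dots> < e" using that n by (simp add: pos_less_divide_eq)
    finally show ?thesis using e(2)[of "(x + t * h, y + t * k)"] by (simp add: \<phi>_def)
  qed
  have en: "e / n > 0" using e n by simp
  show zero: "h * pdx c x y + k * pdy c x y = 0"
  proof -
    have "\<psi> 0 = 0"
      by (rule DERIV_local_max[OF d1 en]) (simp add: local)
    then show ?thesis by (simp add: \<psi>_def)
  qed
  show "h\<^sup>2 * pdxx c x y + 2 * h * k * pdxy c x y + k\<^sup>2 * pdyy c x y \<le> 0"
  proof (rule ccontr)
    assume "\<not> ?thesis"
    then have "q > 0" by (simp add: q_def)
    then obtain d where d: "d > 0" "\<And>s. 0 < s \<Longrightarrow> s < d \<Longrightarrow> \<psi> 0 < \<psi> (0 + s)"
      using DERIV_pos_inc_right[OF d2] by blast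
    have "0 < min d (e / n)" using d(1) en by (simp only: min_less_iff_conj)
    from dense[OF this] obtain t where "0 < t \<and> t < min d (e / n)" by blast
    then have t: "0 < t" "t < d" "t < e / n" by (simp_all only: min_less_iff_conj)
    have "\<phi> 0 < \<phi> t"
    proof (rule DERIV_pos_imp_increasing_open[OF t(1)])
      fix s assume "0 < s" "s < t"
      then have "\<psi> 0 < \<psi> (0 + s)" using t(2) by (intro d(2)) simp_all
      moreover have "\<psi> 0 = 0" using zero by (simp add: \<psi>_def)
      ultimately show "\<exists>y. (\<phi> has_real_derivative y) (at s) \<and> y > 0"
        using d1[of s] by (intro exI[of _ "\<psi> s"]) simp
    next
      show "continuous_on {0..t} \<phi>"
        by (rule DERIV_continuous_on[OF has_field_derivative_at_within[OF d1]])
    qed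
    then show False using local[of t] t by simp
  qed
qed

text \<open>The Hessian stays negative definite on a ball around the point. On each segment from the
  centre the derivative is therefore nonincreasing and starts at 0.\<close>

lemma local_max_sufficient:
  fixes x y :: real
  assumes deg: "deg4_coeffs c" and crit: "pdx c x y = 0" "pdy c x y = 0"
    and neg: "pdxx c x y < 0" and hess: "hess_det c x y > 0"
  shows "(x, y) \<in> local_max_points c"
proof -
  define U where "U = {p :: real \<times> real. pdxx c (fst p) (snd p) < 0} \<inter> {p. 0 < hess_det c (fst p) (snd p)}"
  have "open U"
    unfolding U_def pdxx_def hess_det_def pdyy_def pdxy_def
    by (intro open_Int open_Collect_less continuous_intros)
  moreover have "(x, y) \<in> U" using neg hess by (simp add: U_def)
  ultimately obtain e where e: "e > 0" "ball (x, y) e \<subseteq> U" using open_contains_ball by blast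
  have "peval c (fst q) (snd q) \<le> peval c x y" if q: "dist q (x, y) < e" for q
  proof -
    define h where "h = fst q - x"
    define k where "k = snd q - y"
    have inU: "(x + t * h, y + t * k) \<in> U" if "0 \<le> t" "t \<le> 1" for t
    proof -
      have "(x + t * h, y + t * k) - (x, y) = t *\<^sub>R (q - (x, y))"
        by (simp add: h_def k_def prod_eq_iff)
      then have "dist (x + t * h, y + t * k) (x, y) = t * dist q (x, y)"
        using that by (simp only: dist_norm norm_scaleR abs_of_nonneg)
      also have "\<dots> \<le> dist q (x, y)" using that by (intro mult_left_le_one_le) auto
      finally show ?thesis using q e(2) by (auto simp: dist_commute)
    qed
    let ?q = "\<lambda>t. h\<^sup>2 * pdxx c (x + t * h) (y + t * k) + 2 * h * k * pdxy c (x + t * h) (y + t * k)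
        + k\<^sup>2 * pdyy c (x + t * h) (y + t * k)"
    have q_le: "?q t \<le> 0" if "0 \<le> t" "t \<le> 1" for t
    proof -
      let ?a = "pdxx c (x + t * h) (y + t * k)" and ?b = "pdxy c (x + t * h) (y + t * k)"
        and ?d = "pdyy c (x + t * h) (y + t * k)"
      have U: "?a < 0" "?a * ?d - ?b * ?b > 0" using inU[OF that] by (auto simp: U_def hess_det_def)
      have "?a * ?q t = (?a * h + ?b * k)\<^sup>2 + (?a * ?d - ?b * ?b) * k\<^sup>2"
        by (simp add: algebra_simps power2_eq_square)
      also have "\<dots> \<ge> 0" using U(2) by simp
      finally show ?thesis using U(1) by (simp add: zero_le_mult_iff)
    qed
    let ?p = "\<lambda>t. h * pdx c (x + t * h) (y + t * k) + k * pdy c (x + t * h) (y + t * k)"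
    have p_le: "?p t \<le> 0" if "0 \<le> t" "t \<le> 1" for t
    proof -
      have "?p t \<le> ?p 0"
      proof (rule DERIV_nonpos_imp_nonincreasing[OF that(1)])
        fix s assume "0 \<le> s" "s \<le> t"
        then show "\<exists>d. (?p has_real_derivative d) (at s) \<and> d \<le> 0"
          using has_field_derivative_peval_line(2)[OF deg] q_le[of s] that(2) by (intro exI[of _ "?q s"]) auto
      qed
      then show ?thesis using crit by simp
    qed
    have "peval c (x + 1 * h) (y + 1 * k) \<le> peval c (x + 0 * h) (y + 0 * k)"
    proof (rule DERIV_nonpos_imp_nonincreasing[OF zero_le_one])
      fix s :: real assume "0 \<le> s" "s \<le> 1"
      then show "\<exists>d. ((\<lambda>t. peval c (x + t * h) (y + t * k)) has_real_derivative d) (at s) \<and> d \<le> 0"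
        using has_field_derivative_peval_line(1)[OF deg] p_le[of s] by (intro exI[of _ "?p s"]) auto
    qed
    then show ?thesis by (simp add: h_def k_def)
  qed
  then show ?thesis using e(1) by (auto simp: local_max_points_def)
qed

text \<open>The nondegenerate local maxima for \<open>s = 1\<close>, the nondegenerate local minima for \<open>s = - 1\<close>.\<close>
definition definite_points :: "(nat \<Rightarrow> nat \<Rightarrow> real) \<Rightarrow> real \<Rightarrow> (real \<times> real) set" where
  "definite_points c s = {p \<in> crit_points c. hess_det c (fst p) (snd p) > 0 \<and> s * pdxx c (fst p) (snd p) < 0}"

lemma morse4_real_nondegenerate:
  assumes "morse4 c" "p \<in> (crit_points c :: (real \<times> real) set)"
  shows "hess_det c (fst p) (snd p) \<noteq> 0"
proof -
  obtain x y where p: "p = (x, y)" by (cases p)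
  have "(complex_of_real x, complex_of_real y) \<in> crit_points c"
    using assms(2) by (simp add: crit_points_def p of_real_pdx of_real_pdy)
  then have "hess_det c (complex_of_real x) (complex_of_real y) \<noteq> 0"
    using assms(1) unfolding morse4_def by blast
  then show ?thesis by (simp add: of_real_hess_det p)
qed

lemma local_max_points_eq:
  assumes "morse4 c"
  shows "local_max_points c = definite_points c 1"
proof (intro equalityI subsetI)
  have deg: "deg4_coeffs c" using assms by (simp add: morse4_def)
  fix p :: "real \<times> real"
  obtain x y where p: "p = (x, y)" by (cases p)
  { assume "p \<in> definite_points c 1"
    then show "p \<in> local_max_points c"
      using local_max_sufficient[OF deg] by (auto simp: definite_points_def crit_points_def p) }
  { assume max: "p \<in> local_max_points c"
    note nec = local_max_necessary[OF deg max[unfolded p]]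
    have crit: "p \<in> crit_points c" using nec(1)[of 1 0] nec(1)[of 0 1] by (simp add: crit_points_def p)
    let ?a = "pdxx c x y" and ?b = "pdxy c x y" and ?d = "pdyy c x y"
    have a: "?a \<le> 0" using nec(2)[of 1 0] by simp
    have "\<not> ?a * ?d - ?b * ?b < 0"
    proof
      assume lt: "?a * ?d - ?b * ?b < 0"
      show False
      proof (cases "?a = 0")
        case True
        then have "?b \<noteq> 0" using lt by auto
        \<comment> \<open>For a = 0 the second derivative along (h, 1) is 2 h b + d, and this h
          makes it 1. For a < 0 the direction (- b, a) gives a (a d - b^2) > 0.\<close>
        then have "((1 - ?d) / (2 * ?b))\<^sup>2 * ?a + 2 * ((1 - ?d) / (2 * ?b)) * 1 * ?b + 1\<^sup>2 * ?d = 1"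
          using True by (simp add: field_simps)
        then show False using nec(2)[of "(1 - ?d) / (2 * ?b)" 1] by simp
      next
        case False
        have "(- ?b)\<^sup>2 * ?a + 2 * (- ?b) * ?a * ?b + ?a\<^sup>2 * ?d = ?a * (?a * ?d - ?b * ?b)"
          by (simp add: algebra_simps power2_eq_square)
        moreover have "\<dots> > 0" using False a lt by (simp add: mult_neg_neg)
        ultimately show False using nec(2)[of "- ?b" ?a] by simp
      qed
    qed
    then have hess: "hess_det c x y > 0"
      using morse4_real_nondegenerate[OF assms crit] by (simp add: hess_det_def p)
    then have "?a \<noteq> 0" by (auto simp: hess_det_def not_less)
    then show "p \<in> definite_points c 1"
      using a hess crit by (simp add: definite_points_def p) }
qed

lemma definite_points_index:
  assumes "morse4 c" "card (real_zero_lines c) = 2"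
  shows "finite (definite_points c s)"
    "card (crit_points c :: (real \<times> real) set) = 2 * (card (definite_points c 1) + card (definite_points c (- 1))) + 1"
    "card (definite_points c 1) + card (definite_points c (- 1)) \<le> 4"
proof -
  note index = critical_point_index[OF assms]
  show fin: "finite (definite_points c s)" for s
    unfolding definite_points_def using index(1) by simp
  let ?E = "{p \<in> crit_points c :: (real \<times> real) set. hess_det c (fst p) (snd p) > 0}"
  have "pdxx c (fst p) (snd p) \<noteq> 0" if "hess_det c (fst p) (snd p) > 0" for p :: "real \<times> real"
    using that by (auto simp: hess_det_def not_less)
  then have E: "?E = definite_points c 1 \<union> definite_points c (- 1)"
    unfolding definite_points_def by (intro set_eqI) (simp add: neq_iff, blast)
  have disj: "definite_points c 1 \<inter> definite_points c (- 1) = {}"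
    unfolding definite_points_def by auto
  have "card ?E = card (definite_points c 1) + card (definite_points c (- 1))"
    unfolding E by (rule card_Un_disjoint[OF fin fin disj])
  with index show "card (crit_points c :: (real \<times> real) set) = 2 * (card (definite_points c 1) + card (definite_points c (- 1))) + 1"
    "card (definite_points c 1) + card (definite_points c (- 1)) \<le> 4" by simp_all
qed

definition realized :: "(nat \<times> nat) set" where
  "realized = {(card (crit_points c :: (real \<times> real) set), card (local_max_points c)) | c.
            morse4 c \<and> card (real_zero_lines c) = 2}"

lemma realized_subset: "realized \<subseteq> {(M, m). M \<in> {1, 3, 5, 7, 9} \<and> 2 * m < M}"
proof -
  have "M \<in> {1, 3, 5, 7, 9} \<and> 2 * m < M" if r: "(M, m) \<in> realized" for M m
  proof -
    obtain c where c: "morse4 c" "card (real_zero_lines c) = 2" "M = card (crit_points c :: (real \<times> real) set)"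
      "m = card (local_max_points c)"
      using r unfolding realized_def by blast
    define n where "n = card (definite_points c (- 1))"
    have M: "M = 2 * (m + n) + 1" "m + n \<le> 4"
      using definite_points_index[OF c(1,2)] c(3,4) local_max_points_eq[OF c(1)] by (simp_all add: n_def)
    then have "m + n = 0 \<or> m + n = 1 \<or> m + n = 2 \<or> m + n = 3 \<or> m + n = 4" by linarith
    then have "M \<in> {1, 3, 5, 7, 9}" using M(1) by (elim disjE) simp_all
    moreover have "2 * m < M" using M(1) by simp
    ultimately show ?thesis ..
  qed
  then show ?thesis by (intro subrelI) simp
qed

lemma realizedI:
  assumes "morse4 c" "card (real_zero_lines c) = 2"
    and "card (definite_points c 1) = m" "card (definite_points c (- 1)) = n"
  shows "(2 * (m + n) + 1, m) \<in> realized"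
proof -
  have "card (crit_points c :: (real \<times> real) set) = 2 * (m + n) + 1" "card (local_max_points c) = m"
    using definite_points_index(2)[OF assms(1,2)] local_max_points_eq[OF assms(1)] assms(3,4) by simp_all
  then show ?thesis
    unfolding realized_def using assms(1,2) by (intro CollectI exI[of _ c]) simp
qed

lemma realizedI_neg:
  assumes c: "morse4 c" "card (real_zero_lines c) = 2"
    and card: "card (definite_points c 1) = m" "card (definite_points c (- 1)) = n"
  shows "(2 * (m + n) + 1, n) \<in> realized"
proof -
  let ?c = "\<lambda>i j. - c i j"
  have top: "top4 ?c x y = - top4 c x y" for x y :: "'a::real_field"
    by (simp add: top4_def sum_negf)
  have pd: "pdx ?c x y = - pdx c x y" "pdy ?c x y = - pdy c x y" "pdxx ?c x y = - pdxx c x y"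
    "hess_det ?c x y = hess_det c x y" for x y :: "'a::real_field"
    by (simp_all add: pdx_def pdy_def pdxx_def pdyy_def pdxy_def hess_det_def sum_negf)
  have crit: "crit_points ?c = (crit_points c :: ('a::real_field \<times> 'a) set)"
    by (simp add: crit_points_def pd)
  have "nondeg_top ?c"
  proof -
    have nd: "nondeg_top c" using c(1) by (simp add: morse4_def)
    obtain a b :: "nat \<Rightarrow> complex" where
      ab: "(\<forall>x y :: complex. top4 c x y = (\<Prod>k<4. a k * x + b k * y)) \<and>
        (\<forall>k<4. \<forall>l<4. k \<noteq> l \<longrightarrow> a k * b l - a l * b k \<noteq> 0)"
      using nd unfolding nondeg_top_def by (elim exE)
    \<comment> \<open>The sign is put into one of the four linear forms.\<close>
    define s where "s k = (if k = 0 then - 1 else 1 :: complex)" for k :: nat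
    have fac: "top4 ?c x y = (\<Prod>k<4. s k * a k * x + s k * b k * y)" for x y
    proof -
      have "(\<Prod>k<4. s k * a k * x + s k * b k * y) = (\<Prod>k<4. s k * (a k * x + b k * y))"
        by (intro prod.cong refl) (simp add: algebra_simps)
      also have "\<dots> = (\<Prod>k<4. s k) * top4 c x y" using ab by (simp only: prod.distrib)
      also have "(\<Prod>k<4. s k) = - 1" by (simp add: s_def numeral_eq_Suc)
      finally show ?thesis by (simp only: top mult_minus1)
    qed
    have nonprop: "s k * a k * (s l * b l) - s l * a l * (s k * b k) \<noteq> 0" if "k < 4" "l < 4" "k \<noteq> l" for k l
    proof -
      have "s k * a k * (s l * b l) - s l * a l * (s k * b k) = s k * s l * (a k * b l - a l * b k)"
        by (simp add: algebra_simps)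
      moreover have "s k * s l \<noteq> 0" by (simp add: s_def)
      moreover have "a k * b l - a l * b k \<noteq> 0" using ab that by blast
      ultimately show ?thesis by (simp only: mult_eq_0_iff simp_thms)
    qed
    show ?thesis
      unfolding nondeg_top_def using fac nonprop
      by (intro exI[of _ "\<lambda>k. s k * a k"] exI[of _ "\<lambda>k. s k * b k"] conjI allI impI)
  qed
  then have m: "morse4 ?c" using c(1) unfolding morse4_def crit pd by (simp add: deg4_coeffs_def)
  have lines: "card (real_zero_lines ?c) = 2" using c(2) by (simp add: real_zero_lines_def top)
  have "definite_points ?c s = definite_points c (- s)" for s
    by (simp add: definite_points_def crit pd)
  then show ?thesis using realizedI[OF m lines, of n m] card by (simp add: add.commute)
qed

section \<open>Examples with a reflection symmetry\<close>

text \<open>The coefficients are those of (p1 x + q1 y) (p2 x + q2 y) (A x^2 + B x y + C y^2); the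
  definite third factor supplies two conjugate complex linear forms and no real line.\<close>

lemma two_real_lines:
  assumes p: "p1 * q2 - p2 * q1 \<noteq> (0 :: real)" and disc: "B\<^sup>2 < 4 * A * C"
    and c: "c 4 0 = p1 * p2 * A" "c 3 1 = (p1 * q2 + p2 * q1) * A + p1 * p2 * B"
      "c 2 2 = q1 * q2 * A + (p1 * q2 + p2 * q1) * B + p1 * p2 * C"
      "c 1 3 = q1 * q2 * B + (p1 * q2 + p2 * q1) * C" "c 0 4 = q1 * q2 * C"
  shows "nondeg_top c" "card (real_zero_lines c) = 2"
proof -
  have AC: "A * C > 0" using disc zero_le_power2[of B] by linarith
  then have A: "A \<noteq> 0" by auto
  have top: "top4 c x y = (of_real p1 * x + of_real q1 * y) * (of_real p2 * x + of_real q2 * y) *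
      (of_real A * x\<^sup>2 + of_real B * x * y + of_real C * y\<^sup>2)" for x y :: "'a::real_field"
    unfolding top4_def sum_atMost_4 using c
    by (simp add: algebra_simps power2_eq_square power3_eq_cube power4_eq_xxxx)
  \<comment> \<open>A nonreal root of A z^2 + B z + C.\<close>
  define r where "r = Complex (- B / (2 * A)) (sqrt (4 * A * C - B\<^sup>2) / (2 * A))"
  have Im_r: "Im r \<noteq> 0" using disc A by (simp add: r_def)
  have quad: "of_real A * x\<^sup>2 + of_real B * x * y + of_real C * y\<^sup>2 = of_real A * (x - r * y) * (x - cnj r * y)"
    for x y :: complex
  proof -
    have "r + cnj r = of_real (- B / A)" using A by (simp add: r_def complex_eq_iff)
    then have 1: "of_real A * (r + cnj r) = - complex_of_real B" using A by simp
    have "(Re r)\<^sup>2 + (Im r)\<^sup>2 = C / A"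
      using disc A by (simp add: r_def power_divide field_simps power2_eq_square)
    then have 2: "of_real A * (r * cnj r) = complex_of_real C"
      using A by (simp add: complex_mult_cnj)
    have "of_real A * (x - r * y) * (x - cnj r * y) =
      of_real A * x\<^sup>2 - of_real A * (r + cnj r) * x * y + of_real A * (r * cnj r) * y\<^sup>2"
      by (simp add: algebra_simps power2_eq_square)
    then show ?thesis unfolding 1 2 by simp
  qed
  have less4: "(\<forall>k<4. R k) \<longleftrightarrow> R 0 \<and> R 1 \<and> R 2 \<and> R (3::nat)" for R
    by (auto simp: less_Suc_eq numeral_eq_Suc)
  have nonprop: "complex_of_real p * (- z) - of_real q \<noteq> 0" if "(p, q) \<noteq> (0, 0)" "Im z \<noteq> 0" for p q z
    using that by (auto simp: complex_eq_iff)
  have pq: "(p1, q1) \<noteq> (0, 0)" "(p2, q2) \<noteq> (0, 0)" using p by auto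
  have p': "complex_of_real p1 * of_real q2 - of_real p2 * of_real q1 \<noteq> 0"
    unfolding of_real_mult[symmetric] of_real_diff[symmetric] of_real_eq_0_iff by (rule p)
  show "nondeg_top c"
    unfolding nondeg_top_def
  proof (intro exI conjI)
    define a :: "nat \<Rightarrow> complex" where "a k = (if k = 0 then of_real p1 else if k = 1 then of_real p2 else if k = 2 then of_real A else 1)" for k
    define b where "b k = (if k = 0 then of_real q1 else if k = 1 then of_real q2 else if k = 2 then - of_real A * r else - cnj r)" for k :: nat
    show "\<forall>x y. top4 c x y = (\<Prod>k<4. a k * x + b k * y)"
      unfolding top quad by (simp add: a_def b_def numeral_eq_Suc algebra_simps)
    have 1: "of_real p1 * (- of_real A * r) - of_real A * of_real q1 \<noteq> 0"
      "of_real p2 * (- of_real A * r) - of_real A * of_real q2 \<noteq> 0"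
    proof -
      have "of_real p * (- of_real A * r) - of_real A * of_real q = of_real A * (of_real p * (- r) - of_real q)" for p q
        by (simp add: algebra_simps)
      then show "of_real p1 * (- of_real A * r) - of_real A * of_real q1 \<noteq> 0"
        "of_real p2 * (- of_real A * r) - of_real A * of_real q2 \<noteq> 0"
        using nonprop[OF pq(1) Im_r] nonprop[OF pq(2) Im_r] A by simp_all
    qed
    have 2: "of_real p1 * (- cnj r) - of_real q1 \<noteq> 0" "of_real p2 * (- cnj r) - of_real q2 \<noteq> 0"
      using nonprop[OF pq(1), of "cnj r"] nonprop[OF pq(2), of "cnj r"] Im_r by simp_all
    have 3: "of_real A * (- cnj r) - (- of_real A * r) \<noteq> 0"
      using A Im_r by (simp add: complex_eq_iff)
    have upper: "a 0 * b 1 - a 1 * b 0 \<noteq> 0" "a 0 * b 2 - a 2 * b 0 \<noteq> 0" "a 0 * b 3 - a 3 * b 0 \<noteq> 0"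
      "a 1 * b 2 - a 2 * b 1 \<noteq> 0" "a 1 * b 3 - a 3 * b 1 \<noteq> 0" "a 2 * b 3 - a 3 * b 2 \<noteq> 0"
      using p' 1 2 3 by (simp_all add: a_def b_def)
    have sym: "a l * b k - a k * b l \<noteq> 0" if "a k * b l - a l * b k \<noteq> 0" for k l
      using that by auto
    show "\<forall>k<4. \<forall>l<4. k \<noteq> l \<longrightarrow> a k * b l - a l * b k \<noteq> 0"
      unfolding less4 using upper upper[THEN sym] by blast
  qed
  define line where "line x y = {(t * x, t * y) | t. True}" for x y :: real
  have lines: "real_zero_lines c = {line x y | x y. (x, y) \<noteq> (0, 0) \<and> top4 c x y = (0::real)}"
    by (simp add: real_zero_lines_def line_def)
  have line_eq: "line x y = line q (- p)" if "p * x + q * y = 0" "(x, y) \<noteq> (0, 0)" "(p, q) \<noteq> (0, 0)" for x y p q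
  proof -
    have "\<exists>s. s \<noteq> 0 \<and> x = s * q \<and> y = - s * p"
    proof (cases "q = 0")
      case True
      then show ?thesis using that by (intro exI[of _ "- y / p"]) auto
    next
      case False
      then have "y = - (x / q) * p" using that(1) by (simp add: field_simps)
      then show ?thesis using False that(2) by (intro exI[of _ "x / q"]) auto
    qed
    then obtain s where s: "s \<noteq> 0" "x = s * q" "y = - s * p" by blast
    have e1: "(t * x, t * y) = (t * s * q, t * s * - p)" for t using s by simp
    have e2: "(t * q, t * - p) = (t / s * x, t / s * y)" for t using s by simp
    show ?thesis
    proof (intro equalityI subsetI)
      fix z assume "z \<in> line x y"
      then obtain t where "z = (t * x, t * y)" unfolding line_def by blast
      then show "z \<in> line q (- p)" unfolding e1 line_def by blast
    next
      fix z assume "z \<in> line q (- p)"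
      then obtain t where "z = (t * q, t * - p)" unfolding line_def by blast
      then show "z \<in> line x y" unfolding e2 line_def by blast
    qed
  qed
  have definite: "A * x\<^sup>2 + B * x * y + C * y\<^sup>2 \<noteq> 0" if "(x, y) \<noteq> (0, 0)" for x y :: real
  proof
    assume 0: "A * x\<^sup>2 + B * x * y + C * y\<^sup>2 = 0"
    have "4 * A * (A * x\<^sup>2 + B * x * y + C * y\<^sup>2) = (2 * A * x + B * y)\<^sup>2 + (4 * A * C - B\<^sup>2) * y\<^sup>2"
      by (simp add: algebra_simps power2_eq_square)
    then have sum0: "(2 * A * x + B * y)\<^sup>2 + (4 * A * C - B\<^sup>2) * y\<^sup>2 = 0" unfolding 0 by simp
    moreover have "(4 * A * C - B\<^sup>2) * y\<^sup>2 \<ge> 0" using disc by simp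
    ultimately have "(4 * A * C - B\<^sup>2) * y\<^sup>2 = 0" using zero_le_power2[of "2 * A * x + B * y"] by linarith
    then have "y = 0" using disc by simp
    then show False using sum0 A that by simp
  qed
  have "real_zero_lines c = {line q1 (- p1), line q2 (- p2)}"
  proof (intro equalityI subsetI)
    fix S assume "S \<in> real_zero_lines c"
    then obtain x y where xy: "S = line x y" "(x, y) \<noteq> (0, 0)" "top4 c x y = (0::real)"
      unfolding lines by blast
    then have "p1 * x + q1 * y = 0 \<or> p2 * x + q2 * y = 0" using definite[OF xy(2)] by (simp add: top)
    then show "S \<in> {line q1 (- p1), line q2 (- p2)}"
      using line_eq[OF _ xy(2)] pq xy(1) by blast
  next
    fix S assume S: "S \<in> {line q1 (- p1), line q2 (- p2)}"
    have "top4 c q1 (- p1) = 0 \<and> (q1, - p1) \<noteq> (0, 0)" "top4 c q2 (- p2) = 0 \<and> (q2, - p2) \<noteq> (0, 0)"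
      using pq by (auto simp: top)
    then show "S \<in> real_zero_lines c" using S unfolding lines by blast
  qed
  moreover have "line q1 (- p1) \<noteq> line q2 (- p2)"
  proof
    assume eq: "line q1 (- p1) = line q2 (- p2)"
    have "(q1, - p1) \<in> line q1 (- p1)" unfolding line_def by (rule CollectI, rule exI[of _ 1]) simp
    then have "(q1, - p1) \<in> line q2 (- p2)" by (simp only: eq)
    then obtain t where "q1 = t * q2" "- p1 = t * - p2" unfolding line_def by blast
    then show False using p by simp
  qed
  ultimately show "card (real_zero_lines c) = 2" by simp
qed

text \<open>The parameters are the coefficients of b and of the derivative of C. The leading
  coefficient of that derivative is fixed so that the quartic part is (x^2 - y^2) (x^2 + (2 m + 1)
  y^2), where m \<ge> 0 makes the second factor definite.\<close>

locale even_family =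
  fixes m b1 b0 a2 a1 a0 :: real
  assumes m: "m \<ge> 0"
begin

definition b :: "'a::real_field \<Rightarrow> 'a" where "b y = of_real m * y\<^sup>2 + of_real b1 * y + of_real b0"
definition b' :: "'a::real_field \<Rightarrow> 'a" where "b' y = of_real (2 * m) * y + of_real b1"
definition C' :: "'a::real_field \<Rightarrow> 'a" where
  "C' y = - of_real (8 * m + 4) * y ^ 3 + of_real a2 * y\<^sup>2 + of_real a1 * y + of_real a0"
definition C'' :: "'a::real_field \<Rightarrow> 'a" where
  "C'' y = - of_real (24 * m + 12) * y\<^sup>2 + of_real (2 * a2) * y + of_real a1"
definition D' :: "'a::real_field \<Rightarrow> 'a" where "D' y = C' y - 2 * b y * b' y"
definition D'' :: "'a::real_field \<Rightarrow> 'a" where "D'' y = C'' y - 2 * (b' y)\<^sup>2 - of_real (4 * m) * b y"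

text \<open>The polynomial \<open>x\<^sup>4 + 2 b(y) x\<^sup>2 + C(y) = (x\<^sup>2 + b(y))\<^sup>2 + D(y)\<close> with \<open>D = C - b\<^sup>2\<close>. Its
  critical points lie over those of \<open>C\<close> on the axis \<open>x = 0\<close> and over those of \<open>D\<close> on the curve
  \<open>x\<^sup>2 = - b(y)\<close>.\<close>
definition poly :: "nat \<Rightarrow> nat \<Rightarrow> real" where
  "poly i j = (if i = 4 \<and> j = 0 then 1 else if i = 2 \<and> j = 2 then 2 * m else if i = 2 \<and> j = 1 then 2 * b1
    else if i = 2 \<and> j = 0 then 2 * b0 else if i = 0 \<and> j = 4 then - (2 * m + 1) else if i = 0 \<and> j = 3 then a2 / 3
    else if i = 0 \<and> j = 2 then a1 / 2 else if i = 0 \<and> j = 1 then a0 else 0)"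

lemma deg4: "deg4_coeffs poly"
  by (auto simp: deg4_coeffs_def poly_def)

lemma derivs:
  fixes x y :: "'a::real_field"
  shows "pdx poly x y = 4 * x * (x\<^sup>2 + b y)" "pdy poly x y = 2 * b' y * x\<^sup>2 + C' y"
    "pdxx poly x y = 12 * x\<^sup>2 + 4 * b y" "pdxy poly x y = 4 * b' y * x"
    "pdyy poly x y = of_real (4 * m) * x\<^sup>2 + C'' y"
  unfolding pdx_expand[OF deg4] pdy_expand[OF deg4] pdxx_expand[OF deg4] pdxy_expand[OF deg4] pdyy_expand[OF deg4]
  by (simp_all add: poly_def quad_def quad_coeffs_def b_def b'_def C'_def C''_def algebra_simps power2_eq_square power3_eq_cube)

lemma crit_iff:
  fixes x y :: "'a::real_field"
  shows "pdx poly x y = 0 \<and> pdy poly x y = 0 \<longleftrightarrow>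
    x = 0 \<and> C' y = 0 \<or> x \<noteq> 0 \<and> x\<^sup>2 = - b y \<and> D' y = 0"
proof (cases "x = 0")
  case False
  then have "pdx poly x y = 0 \<longleftrightarrow> x\<^sup>2 = - b y" by (simp add: derivs eq_neg_iff_add_eq_0)
  then show ?thesis using False by (auto simp: derivs D'_def)
qed (auto simp: derivs)

lemma hess_axis: "hess_det poly 0 y = 4 * b y * C'' y"
  by (simp add: hess_det_def derivs)

lemma hess_curve: "x\<^sup>2 = - b y \<Longrightarrow> hess_det poly x y = 8 * x\<^sup>2 * D'' y"
proof -
  assume x: "x\<^sup>2 = - b y"
  have "hess_det poly x y = (12 * x\<^sup>2 + 4 * b y) * (of_real (4 * m) * x\<^sup>2 + C'' y) - 16 * (b' y)\<^sup>2 * x\<^sup>2"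
    by (simp add: hess_det_def derivs power2_eq_square)
  also have "\<dots> = 8 * x\<^sup>2 * D'' y" unfolding x by (simp add: D''_def algebra_simps power2_eq_square)
  finally show ?thesis .
qed

lemma morse:
  assumes "\<And>y :: complex. C' y = 0 \<Longrightarrow> b y \<noteq> 0 \<and> C'' y \<noteq> 0"
    and "\<And>y :: complex. D' y = 0 \<Longrightarrow> D'' y \<noteq> 0"
  shows "morse4 poly" "card (real_zero_lines poly) = 2"
proof -
  have 1: "1 * 1 - 1 * (- 1) \<noteq> (0::real)" "0\<^sup>2 < 4 * 1 * (2 * m + 1)" using m by simp_all
  note tl = two_real_lines[OF 1, of poly]
  have "nondeg_top poly" by (rule tl) (simp_all add: poly_def)
  moreover have "hess_det poly x y \<noteq> 0" if "pdx poly x y = 0" "pdy poly x y = 0" for x y :: complex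
  proof (cases "x = 0")
    case True
    then have "C' y = 0" using that crit_iff[of x y] by simp
    then show ?thesis using assms(1) True by (simp add: hess_axis)
  next
    case False
    then have "x\<^sup>2 = - b y" "D' y = 0" using that crit_iff[of x y] by simp_all
    then have "hess_det poly x y = 8 * x\<^sup>2 * D'' y" by (intro hess_curve)
    moreover have "D'' y \<noteq> 0" using \<open>D' y = 0\<close> by (rule assms(2))
    moreover have "x\<^sup>2 \<noteq> 0" using False by simp
    ultimately show ?thesis by (simp only: mult_eq_0_iff) simp
  qed
  ultimately show "morse4 poly" using deg4 by (auto simp: morse4_def crit_points_def)
  show "card (real_zero_lines poly) = 2" by (rule tl) (simp_all add: poly_def)
qed

text \<open>On the curve x^2 = - b the second x-derivative is 8 x^2 > 0, so maxima lie on the axis,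
  while minima off the axis come in mirror pairs. Since C' and D' are cubics with negative leading
  coefficient, each has at most one root with positive derivative: the family reaches at most two
  maxima and three minima.\<close>

lemma card_definite_points:
  shows "card (definite_points poly 1) = card {y :: real. C' y = 0 \<and> C'' y < 0 \<and> b y < 0}"
    and "finite (definite_points poly (- 1)) \<Longrightarrow> card (definite_points poly (- 1)) =
      card {y :: real. C' y = 0 \<and> C'' y > 0 \<and> b y > 0} + 2 * card {y :: real. D' y = 0 \<and> D'' y > 0 \<and> b y < 0}"
proof -
  have axis: "0 < hess_det poly (0::real) y \<longleftrightarrow> (b y > 0 \<and> C'' y > 0) \<or> (b y < 0 \<and> C'' y < 0)" for y
    by (auto simp: hess_axis zero_less_mult_iff)
  have curve: "0 < hess_det poly x y \<longleftrightarrow> D'' y > 0" "pdxx poly x y > 0" if "x \<noteq> 0" "x\<^sup>2 = - b y" for x y :: real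
  proof -
    have "x\<^sup>2 > 0" using that(1) by simp
    then show "0 < hess_det poly x y \<longleftrightarrow> D'' y > 0"
      by (simp add: hess_curve[OF that(2)] zero_less_mult_iff)
    have "pdxx poly x y = 8 * x\<^sup>2" using that(2) by (simp add: derivs)
    then show "pdxx poly x y > 0" using \<open>x\<^sup>2 > 0\<close> by simp
  qed
  have "definite_points poly 1 = Pair 0 ` {y. C' y = 0 \<and> C'' y < 0 \<and> b y < 0}"
  proof (intro equalityI subsetI)
    fix p assume p: "p \<in> definite_points poly 1"
    obtain x y where xy: "p = (x, y)" by (cases p)
    have c: "pdx poly x y = 0 \<and> pdy poly x y = 0" "0 < hess_det poly x y" "pdxx poly x y < 0"
      using p by (auto simp: definite_points_def crit_points_def xy)
    have "x = 0 \<and> C' y = 0" using c(1,3) curve(2)[of x y] unfolding crit_iff by auto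
    then show "p \<in> Pair 0 ` {y. C' y = 0 \<and> C'' y < 0 \<and> b y < 0}"
      using c(2,3) axis[of y] by (auto simp: xy derivs)
  next
    fix p assume "p \<in> Pair (0::real) ` {y :: real. C' y = 0 \<and> C'' y < 0 \<and> b y < 0}"
    then obtain y where "p = (0, y)" "C' y = 0" "C'' y < 0" "b y < 0" by auto
    then show "p \<in> definite_points poly 1"
      using axis[of y] crit_iff[of 0 y] by (auto simp: definite_points_def crit_points_def derivs(3))
  qed
  then show "card (definite_points poly 1) = card {y :: real. C' y = 0 \<and> C'' y < 0 \<and> b y < 0}"
    by (simp add: card_image inj_on_def)
  define Y1 where "Y1 = {y :: real. C' y = 0 \<and> C'' y > 0 \<and> b y > 0}"
  define Y2 where "Y2 = {y :: real. D' y = 0 \<and> D'' y > 0 \<and> b y < 0}"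
  define f where "f s y = (s * sqrt (- b y), y)" for s y :: real
  have E: "definite_points poly (- 1) = Pair 0 ` Y1 \<union> (f 1 ` Y2 \<union> f (- 1) ` Y2)"
  proof (intro equalityI subsetI)
    fix p assume p: "p \<in> definite_points poly (- 1)"
    obtain x y where xy: "p = (x, y)" by (cases p)
    have c: "pdx poly x y = 0 \<and> pdy poly x y = 0" "0 < hess_det poly x y" "pdxx poly x y > 0"
      using p by (auto simp: definite_points_def crit_points_def xy)
    show "p \<in> Pair 0 ` Y1 \<union> (f 1 ` Y2 \<union> f (- 1) ` Y2)"
    proof (cases "x = 0")
      case True
      then have "y \<in> Y1" using c axis[of y] crit_iff[of x y] by (auto simp: Y1_def derivs(3))
      then show ?thesis by (simp add: xy True)
    next
      case False
      then have D: "x\<^sup>2 = - b y" "D' y = 0" using c(1) crit_iff[of x y] by auto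
      have "x\<^sup>2 > 0" using False by simp
      then have "y \<in> Y2" using D c(2) curve(1)[OF False D(1)] by (simp add: Y2_def)
      moreover have "sqrt (- b y) = \<bar>x\<bar>" unfolding D(1)[symmetric] by simp
      then have "p = f 1 y \<or> p = f (- 1) y" by (auto simp: f_def xy)
      ultimately show ?thesis by auto
    qed
  next
    fix p assume "p \<in> Pair 0 ` Y1 \<union> (f 1 ` Y2 \<union> f (- 1) ` Y2)"
    then consider y where "p = (0, y)" "y \<in> Y1" | s y where "p = f s y" "y \<in> Y2" "s = 1 \<or> s = - 1"
      by auto
    then show "p \<in> definite_points poly (- 1)"
    proof cases
      case 1
      then show ?thesis
        using axis[of y] crit_iff[of 0 y] by (auto simp: definite_points_def crit_points_def derivs(3) Y1_def)
    next
      case 2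
      have y: "D' y = 0" "D'' y > 0" "b y < 0" using 2(2) by (auto simp: Y2_def)
      define x where "x = s * sqrt (- b y)"
      have x: "x \<noteq> 0" "x\<^sup>2 = - b y" using y(3) 2(3) by (auto simp: x_def power_mult_distrib)
      then show ?thesis
        using curve[OF x] crit_iff[of x y] y 2(1) by (auto simp: definite_points_def crit_points_def f_def x_def)
    qed
  qed
  assume fin: "finite (definite_points poly (- 1))"
  have inj: "inj_on (Pair (0::real)) Y1" "inj_on (f s) Y2" for s
    by (auto simp: inj_on_def f_def)
  have "finite (Pair (0::real) ` Y1)" "finite (f 1 ` Y2)" using fin unfolding E by simp_all
  then have finY: "finite Y1" "finite Y2" using inj by (auto dest: finite_imageD)
  have disj: "f 1 ` Y2 \<inter> f (- 1) ` Y2 = {}" "Pair 0 ` Y1 \<inter> (f 1 ` Y2 \<union> f (- 1) ` Y2) = {}"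
    by (auto simp: f_def Y2_def Y1_def)
  have "card (definite_points poly (- 1)) = card (Pair (0::real) ` Y1) + (card (f 1 ` Y2) + card (f (- 1) ` Y2))"
    unfolding E using finY disj by (simp add: card_Un_disjoint)
  then show "card (definite_points poly (- 1)) =
      card {y :: real. C' y = 0 \<and> C'' y > 0 \<and> b y > 0} + 2 * card {y :: real. D' y = 0 \<and> D'' y > 0 \<and> b y < 0}"
    using inj by (simp add: card_image Y1_def Y2_def)
qed

lemma realizes:
  assumes "\<And>y :: complex. C' y = 0 \<Longrightarrow> b y \<noteq> 0 \<and> C'' y \<noteq> 0"
    and "\<And>y :: complex. D' y = 0 \<Longrightarrow> D'' y \<noteq> 0"
    and "card {y :: real. C' y = 0 \<and> C'' y < 0 \<and> b y < 0} = k"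
    and "card {y :: real. C' y = 0 \<and> C'' y > 0 \<and> b y > 0} + 2 * card {y :: real. D' y = 0 \<and> D'' y > 0 \<and> b y < 0} = n"
  shows "(2 * (k + n) + 1, k) \<in> realized" "(2 * (k + n) + 1, n) \<in> realized"
proof -
  note M = morse[OF assms(1,2)]
  have "card (definite_points poly 1) = k" "card (definite_points poly (- 1)) = n"
    using card_definite_points definite_points_index(1)[OF M] assms(3,4) by simp_all
  then show "(2 * (k + n) + 1, k) \<in> realized" "(2 * (k + n) + 1, n) \<in> realized"
    using realizedI[OF M] realizedI_neg[OF M] by blast+
qed

end

text \<open>With b constant, C' and D' coincide. All three roots lie where b < 0, so each gives one
  critical point on the axis and two off it.\<close>

lemma realized_9_2_2:
  "(9, 2) \<in> realized"
proof -
  interpret even_family 0 0 "- 1" 0 4 0 by unfold_locales simp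
  have C: "C' y = - 4 * y * (y - (- 1)) * (y - 1)" and D: "D' y = - 4 * y * (y - (- 1)) * (y - 1)" for y :: "'a::real_field"
    by (simp_all add: C'_def D'_def b_def b'_def algebra_simps power2_eq_square power3_eq_cube)
  have C0: "C' y = 0 \<longleftrightarrow> y = 0 \<or> y = - 1 \<or> y = 1" for y :: "'a::real_field"
    unfolding C mult_eq_0_iff right_minus_eq by simp
  have D0: "D' y = 0 \<longleftrightarrow> y = 0 \<or> y = - 1 \<or> y = 1" for y :: "'a::real_field"
    unfolding D mult_eq_0_iff right_minus_eq by simp
  note vals = C''_def D''_def b_def b'_def power2_eq_square
  have nd1: "C' y = 0 \<Longrightarrow> b y \<noteq> 0 \<and> C'' y \<noteq> 0" for y :: complex
    unfolding C0 by (elim disjE; hypsubst; simp add: vals)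
  have nd2: "D' y = 0 \<Longrightarrow> D'' y \<noteq> 0" for y :: complex
    unfolding D0 by (elim disjE; hypsubst; simp add: vals)
  have S1: "{y :: real. C' y = 0 \<and> C'' y < 0 \<and> b y < 0} = {- 1, 1}"
    unfolding C0 by (safe; simp add: vals)
  have S2: "{y :: real. C' y = 0 \<and> C'' y > 0 \<and> b y > 0} = {}"
    unfolding C0 by (safe; simp add: vals)
  have S3: "{y :: real. D' y = 0 \<and> D'' y > 0 \<and> b y < 0} = {0}"
    unfolding D0 by (safe; simp add: vals)
  note r = realizes[OF nd1 nd2, of 2 2, unfolded S1 S2 S3]
  show "(9, 2) \<in> realized"
    using r by simp_all
qed

text \<open>The parameters make C' and D' split over the rationals, so all sign conditions are
  arithmetic. Here b = (y + 3) (y - 1) is positive at the largest root of D', which therefore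
  carries no real critical point.\<close>

lemma realized_7_1_2:
  "(7, 1) \<in> realized" "(7, 2) \<in> realized"
proof -
  interpret even_family 1 2 "- 3" 12 24 0 by unfold_locales simp
  have C: "C' y = - 12 * (y - (- 1)) * y * (y - 2)" and D: "D' y = - 16 * (y - (- 1)) * (y - (- 1 / 2)) * (y - 3 / 2)" for y :: "'a::real_field"
    by (simp_all add: C'_def D'_def b_def b'_def algebra_simps power2_eq_square power3_eq_cube)
  have C0: "C' y = 0 \<longleftrightarrow> y = - 1 \<or> y = 0 \<or> y = 2" for y :: "'a::real_field"
    unfolding C mult_eq_0_iff right_minus_eq by simp
  have D0: "D' y = 0 \<longleftrightarrow> y = - 1 \<or> y = - 1 / 2 \<or> y = 3 / 2" for y :: "'a::real_field"
    unfolding D mult_eq_0_iff right_minus_eq by simp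
  note vals = C''_def D''_def b_def b'_def power2_eq_square
  have nd1: "C' y = 0 \<Longrightarrow> b y \<noteq> 0 \<and> C'' y \<noteq> 0" for y :: complex
    unfolding C0 by (elim disjE; hypsubst; simp add: vals)
  have nd2: "D' y = 0 \<Longrightarrow> D'' y \<noteq> 0" for y :: complex
    unfolding D0 by (elim disjE; hypsubst; simp add: vals)
  have S1: "{y :: real. C' y = 0 \<and> C'' y < 0 \<and> b y < 0} = {- 1}"
    unfolding C0 by (safe; simp add: vals)
  have S2: "{y :: real. C' y = 0 \<and> C'' y > 0 \<and> b y > 0} = {}"
    unfolding C0 by (safe; simp add: vals)
  have S3: "{y :: real. D' y = 0 \<and> D'' y > 0 \<and> b y < 0} = {- 1 / 2}"
    unfolding D0 by (safe; simp add: vals)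
  note r = realizes[OF nd1 nd2, of 1 2, unfolded S1 S2 S3]
  show "(7, 1) \<in> realized" "(7, 2) \<in> realized"
    using r by simp_all
qed

text \<open>b = 3 (y^2 - 81) is positive at all roots of C', so the axis carries one minimum and no
  maximum; the root -7 of D' adds two minima.\<close>

lemma realized_7_0_3:
  "(7, 0) \<in> realized" "(7, 3) \<in> realized"
proof -
  interpret even_family 3 0 "- 243" "- 112" 6916 52360 by unfold_locales simp
  have C: "C' y = - 28 * (y - (- 11)) * (y - (- 10)) * (y - 17)" and D: "D' y = - 64 * (y - (- 17 / 2)) * (y - (- 7)) * (y - 55 / 4)" for y :: "'a::real_field"
    by (simp_all add: C'_def D'_def b_def b'_def algebra_simps power2_eq_square power3_eq_cube)
  have C0: "C' y = 0 \<longleftrightarrow> y = - 11 \<or> y = - 10 \<or> y = 17" for y :: "'a::real_field"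
    unfolding C mult_eq_0_iff right_minus_eq by simp
  have D0: "D' y = 0 \<longleftrightarrow> y = - 17 / 2 \<or> y = - 7 \<or> y = 55 / 4" for y :: "'a::real_field"
    unfolding D mult_eq_0_iff right_minus_eq by simp
  note vals = C''_def D''_def b_def b'_def power2_eq_square
  have nd1: "C' y = 0 \<Longrightarrow> b y \<noteq> 0 \<and> C'' y \<noteq> 0" for y :: complex
    unfolding C0 by (elim disjE; hypsubst; simp add: vals)
  have nd2: "D' y = 0 \<Longrightarrow> D'' y \<noteq> 0" for y :: complex
    unfolding D0 by (elim disjE; hypsubst; simp add: vals)
  have S1: "{y :: real. C' y = 0 \<and> C'' y < 0 \<and> b y < 0} = {}"
    unfolding C0 by (safe; simp add: vals)
  have S2: "{y :: real. C' y = 0 \<and> C'' y > 0 \<and> b y > 0} = {- 10}"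
    unfolding C0 by (safe; simp add: vals)
  have S3: "{y :: real. D' y = 0 \<and> D'' y > 0 \<and> b y < 0} = {- 7}"
    unfolding D0 by (safe; simp add: vals)
  note r = realizes[OF nd1 nd2, of 0 3, unfolded S1 S2 S3]
  show "(7, 0) \<in> realized" "(7, 3) \<in> realized"
    using r by simp_all
qed

text \<open>All roots of D' lie where b < 0, while b changes sign between the roots -1 and 2 of C'.
  The axis thus carries a maximum, a minimum and a saddle.\<close>

lemma realized_9_1_3:
  "(9, 1) \<in> realized" "(9, 3) \<in> realized"
proof -
  interpret even_family 1 4 "- 9" 48 "- 12" "- 72" by unfold_locales simp
  have C: "C' y = - 12 * (y - (- 1)) * (y - 2) * (y - 3)" and D: "D' y = - 16 * y * (y - 1 / 2) * (y - 1)" for y :: "'a::real_field"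
    by (simp_all add: C'_def D'_def b_def b'_def algebra_simps power2_eq_square power3_eq_cube)
  have C0: "C' y = 0 \<longleftrightarrow> y = - 1 \<or> y = 2 \<or> y = 3" for y :: "'a::real_field"
    unfolding C mult_eq_0_iff right_minus_eq by simp
  have D0: "D' y = 0 \<longleftrightarrow> y = 0 \<or> y = 1 / 2 \<or> y = 1" for y :: "'a::real_field"
    unfolding D mult_eq_0_iff right_minus_eq by simp
  note vals = C''_def D''_def b_def b'_def power2_eq_square
  have nd1: "C' y = 0 \<Longrightarrow> b y \<noteq> 0 \<and> C'' y \<noteq> 0" for y :: complex
    unfolding C0 by (elim disjE; hypsubst; simp add: vals)
  have nd2: "D' y = 0 \<Longrightarrow> D'' y \<noteq> 0" for y :: complex
    unfolding D0 by (elim disjE; hypsubst; simp add: vals)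
  have S1: "{y :: real. C' y = 0 \<and> C'' y < 0 \<and> b y < 0} = {- 1}"
    unfolding C0 by (safe; simp add: vals)
  have S2: "{y :: real. C' y = 0 \<and> C'' y > 0 \<and> b y > 0} = {2}"
    unfolding C0 by (safe; simp add: vals)
  have S3: "{y :: real. D' y = 0 \<and> D'' y > 0 \<and> b y < 0} = {1 / 2}"
    unfolding D0 by (safe; simp add: vals)
  note r = realizes[OF nd1 nd2, of 1 3, unfolded S1 S2 S3]
  show "(9, 1) \<in> realized" "(9, 3) \<in> realized"
    using r by simp_all
qed


text \<open>b = 1 leaves no real point on x^2 = - b, and the only real root of C' gives a
  saddle.\<close>

lemma realized_1_0: "(1, 0) \<in> realized"
proof -
  interpret even_family 0 0 1 0 "- 4" 0 by unfold_locales simp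
  have C: "C' y = - 4 * y * (y\<^sup>2 + 1)" and D: "D' y = - 4 * y * (y\<^sup>2 + 1)" for y :: "'a::real_field"
    by (simp_all add: C'_def D'_def b_def b'_def algebra_simps power2_eq_square power3_eq_cube)
  have C2: "C'' y = - 12 * y\<^sup>2 - 4" and D2: "D'' y = - 12 * y\<^sup>2 - 4" and b: "b y = 1" for y :: "'a::real_field"
    by (simp_all add: C''_def D''_def b_def b'_def)
  have CD0: "C' y = 0 \<longleftrightarrow> y = 0 \<or> y\<^sup>2 = - 1" "D' y = 0 \<longleftrightarrow> y = 0 \<or> y\<^sup>2 = - 1" for y :: "'a::real_field"
    by (auto simp: C D eq_neg_iff_add_eq_0)
  have nd1: "C' y = 0 \<Longrightarrow> b y \<noteq> 0 \<and> C'' y \<noteq> 0" for y :: complex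
    unfolding CD0 by (auto simp: C2 b)
  have nd2: "D' y = 0 \<Longrightarrow> D'' y \<noteq> 0" for y :: complex
    unfolding CD0 by (auto simp: D2)
  have neg: "C'' y < 0 \<and> D'' y < 0" for y :: real
    using zero_le_power2[of y] unfolding C2 D2 by (intro conjI; linarith)
  have S1: "{y :: real. C' y = 0 \<and> C'' y > 0 \<and> b y > 0} = {}" "{y :: real. D' y = 0 \<and> D'' y > 0 \<and> b y < 0} = {}"
    using neg less_asym by blast+
  have S2: "{y :: real. C' y = 0 \<and> C'' y < 0 \<and> b y < 0} = {}"
    by (simp add: b)
  note r = realizes[OF nd1 nd2, of 0 0, unfolded S1 S2]
  show "(1, 0) \<in> realized"
    using r by simp_all
qed

text \<open>Here b = - 1, so the origin is a maximum, and the curve x^2 = 1 carries two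
  saddles.\<close>

lemma realized_3_1_0: "(3, 1) \<in> realized" "(3, 0) \<in> realized"
proof -
  interpret even_family 0 0 "- 1" 0 "- 4" 0 by unfold_locales simp
  have C: "C' y = - 4 * y * (y\<^sup>2 + 1)" and D: "D' y = - 4 * y * (y\<^sup>2 + 1)" for y :: "'a::real_field"
    by (simp_all add: C'_def D'_def b_def b'_def algebra_simps power2_eq_square power3_eq_cube)
  have C2: "C'' y = - 12 * y\<^sup>2 - 4" and D2: "D'' y = - 12 * y\<^sup>2 - 4" and b: "b y = - 1" for y :: "'a::real_field"
    by (simp_all add: C''_def D''_def b_def b'_def)
  have CD0: "C' y = 0 \<longleftrightarrow> y = 0 \<or> y\<^sup>2 = - 1" "D' y = 0 \<longleftrightarrow> y = 0 \<or> y\<^sup>2 = - 1" for y :: "'a::real_field"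
    by (auto simp: C D eq_neg_iff_add_eq_0)
  have nd1: "C' y = 0 \<Longrightarrow> b y \<noteq> 0 \<and> C'' y \<noteq> 0" for y :: complex
    unfolding CD0 by (auto simp: C2 b)
  have nd2: "D' y = 0 \<Longrightarrow> D'' y \<noteq> 0" for y :: complex
    unfolding CD0 by (auto simp: D2)
  have neg: "C'' y < 0 \<and> D'' y < 0" for y :: real
    using zero_le_power2[of y] unfolding C2 D2 by (intro conjI; linarith)
  have S1: "{y :: real. C' y = 0 \<and> C'' y > 0 \<and> b y > 0} = {}" "{y :: real. D' y = 0 \<and> D'' y > 0 \<and> b y < 0} = {}"
    using neg less_asym by blast+
  have S2: "{y :: real. C' y = 0 \<and> C'' y < 0 \<and> b y < 0} = {0}"
  proof -
    have "y\<^sup>2 \<noteq> - 1" for y :: real using zero_le_power2[of y] by linarith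
    then show ?thesis using neg by (auto simp: b CD0)
  qed
  note r = realizes[OF nd1 nd2, of 1 0, unfolded S1 S2]
  show "(3, 1) \<in> realized" "(3, 0) \<in> realized"
    using r by simp_all
qed

text \<open>The nonzero roots of C' and D' are irrational, so the conditions are checked through
  y^2. The axis carries three saddles, and the root 0 of D' gives two minima.\<close>

lemma realized_5_0_2: "(5, 0) \<in> realized" "(5, 2) \<in> realized"
proof -
  interpret even_family 1 0 "- 1" 0 24 0 by unfold_locales simp
  have C: "C' y = - 12 * y * (y\<^sup>2 - 2)" and D: "D' y = - 4 * y * (4 * y\<^sup>2 - 7)" for y :: "'a::real_field"
    by (simp_all add: C'_def D'_def b_def b'_def algebra_simps power2_eq_square power3_eq_cube)
  have C2: "C'' y = 24 - 36 * y\<^sup>2" and D2: "D'' y = 28 - 12 * (4 * y\<^sup>2)" and b: "b y = y\<^sup>2 - 1" for y :: "'a::real_field"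
    by (simp_all add: C''_def D''_def b_def b'_def algebra_simps power2_eq_square)
  have C0: "C' y = 0 \<longleftrightarrow> y = 0 \<or> y\<^sup>2 = 2" and D0: "D' y = 0 \<longleftrightarrow> y = 0 \<or> 4 * y\<^sup>2 = 7" for y :: "'a::real_field"
    by (auto simp: C D field_simps)
  have nd1: "C' y = 0 \<Longrightarrow> b y \<noteq> 0 \<and> C'' y \<noteq> 0" for y :: complex
    unfolding C0 by (auto simp: C2 b)
  have nd2: "D' y = 0 \<Longrightarrow> D'' y \<noteq> 0" for y :: complex
    unfolding D0 by (elim disjE; simp only: D2; simp)
  have S1: "{y :: real. C' y = 0 \<and> C'' y < 0 \<and> b y < 0} = {}" "{y :: real. C' y = 0 \<and> C'' y > 0 \<and> b y > 0} = {}"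
    unfolding C0 by (auto simp: C2 b)
  have S2: "{y :: real. D' y = 0 \<and> D'' y > 0 \<and> b y < 0} = {0}"
    unfolding D0 by (auto simp: D2 b)
  note r = realizes[OF nd1 nd2, of 0 2, unfolded S1 S2]
  show "(5, 0) \<in> realized" "(5, 2) \<in> realized"
    using r by simp_all
qed

lemma realized_5_1: "(5, 1) \<in> realized"
proof -
  interpret even_family 0 4 0 0 28 "- 24" by unfold_locales simp
  have C: "C' y = - 4 * (y - (- 3)) * (y - 1) * (y - 2)" and D: "D' y = - 4 * (y * (y\<^sup>2 + 1) + 6)" for y :: "'a::real_field"
    by (simp_all add: C'_def D'_def b_def b'_def algebra_simps power2_eq_square power3_eq_cube)
  have C0: "C' y = 0 \<longleftrightarrow> y = - 3 \<or> y = 1 \<or> y = 2" for y :: "'a::real_field"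
    unfolding C mult_eq_0_iff right_minus_eq by simp
  have C2: "C'' y = 28 - 12 * y\<^sup>2" and D2: "D'' y = - 4 * (3 * y\<^sup>2 + 1)" and b: "b y = 4 * y" for y :: "'a::real_field"
    by (simp_all add: C''_def D''_def b_def b'_def algebra_simps power2_eq_square)
  have nd1: "C' y = 0 \<Longrightarrow> b y \<noteq> 0 \<and> C'' y \<noteq> 0" for y :: complex
    unfolding C0 by (elim disjE) (simp_all add: C2 b)
  have nd2: "D'' y \<noteq> 0" if "D' y = 0" for y :: complex
  proof
    assume "D'' y = 0"
    then have "3 * y\<^sup>2 + 1 = 0" by (simp only: D2 mult_eq_0_iff) simp
    then have y2: "3 * y\<^sup>2 = - 1" by (simp only: eq_neg_iff_add_eq_0)
    have "y * (y\<^sup>2 + 1) + 6 = 0" using that by (simp only: D mult_eq_0_iff) simp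
    \<comment> \<open>Three times the cubic y^3 + y + 6, so that 3 y^2 = - 1 reduces it to a linear
      equation.\<close>
    then have "y * (3 * y\<^sup>2) + 3 * y + 18 = 0" by algebra
    then have "2 * (y + 9) = 0" unfolding y2 by (simp add: algebra_simps)
    then have "y = - 9" by (simp only: mult_eq_0_iff eq_neg_iff_add_eq_0) simp
    then show False using y2 by simp
  qed
  have S1: "{y :: real. C' y = 0 \<and> C'' y < 0 \<and> b y < 0} = {- 3}" "{y :: real. C' y = 0 \<and> C'' y > 0 \<and> b y > 0} = {1}"
    unfolding C0 by (auto simp: C2 b)
  have neg: "D'' y < 0" for y :: real
    unfolding D2 by (intro mult_neg_pos add_nonneg_pos) simp_all
  have S2: "{y :: real. D' y = 0 \<and> D'' y > 0 \<and> b y < 0} = {}"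
    using neg less_asym by blast
  note r = realizes[OF nd1 nd2, of 1 1, unfolded S1 S2]
  show "(5, 1) \<in> realized"
    using r by simp_all
qed

section \<open>An example with four minima\<close>

text \<open>A Nullstellensatz certificate, found by solving a linear system over the rationals.\<close>
lemma four_wells_certificate:
  fixes x y :: complex
  assumes P: "46 * x ^ 3 - 63 * x ^ 2 * y - 27 * x * y ^ 2 + 15 * y ^ 3 - 86 * x ^ 2 + 86 * x * y + 7 * y ^ 2
      + 40 * x - 22 * y = 0"
    and Q: "- 21 * x ^ 3 - 27 * x ^ 2 * y + 45 * x * y ^ 2 + 32 * y ^ 3 + 43 * x ^ 2 + 14 * x * y - 48 * y
      ^ 2 - 22 * x + 16 * y = 0"
    and H: "- 7695 * x ^ 4 + 9018 * x ^ 3 * y + 5391 * x ^ 2 * y ^ 2 - 9666 * x * y ^ 3 - 4617 * y ^ 4 +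
      17412 * x ^ 3 - 21762 * x ^ 2 * y - 3282 * x * y ^ 2 + 9588 * y ^ 3 - 11448 * x ^ 2 + 14516 * x
      * y - 3064 * y ^ 2 + 1592 * x - 1848 * y + 156 = 0"
  shows False
proof -
  \<comment> \<open>With P, Q, H the three left-hand sides this reads A P + B Q = k - E H for a
    nonzero constant k, so P, Q and H have no common zero.\<close>
  have "(- 167967383893117997321123369768613782231933490 * x ^ 2 * y ^ 3 -
      143972043336958283418105745515954670484514420 * x * y ^ 4 +
      119976702780798569515088121263295558737095350 * y ^ 5 -
      93925490919451045354405127747327665945922415 * x ^ 2 * y ^ 2 +
      1319796428377314420258338723226061732537426551 * x * y ^ 3 +
      836089140857682396621047854815562300630835301 * y ^ 4 +
      365257621818006061239798414598953060019905015 * x ^ 3 +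
      18091138934895199788260693904588722928384612 * x ^ 2 * y +
      178522847872887634589564992089170206710523515 * x * y ^ 2 -
      956139592607026305470903267001750431431113918 * y ^ 3 -
      471576094645858132065974672105011721474179533 * x ^ 2 +
      56516010379071473511522111828954863152962792 * x * y +
      99474725052628813440350757455595798392993742 * y ^ 2 +
      102155362175509889371164700017949371247652862 * x +
      20339714883199507012494861009636890684477796 * y - 9757367227578958632356866520860089509147676) *
      (46 * x ^ 3 - 63 * x ^ 2 * y - 27 * x * y ^ 2 + 15 * y ^ 3 - 86 * x ^ 2 + 86 * x * y + 7 * y ^ 2
      + 40 * x - 22 * y)
    + (- 367928555194448946512936905207439713460425740 * x ^ 2 * y ^ 3 +
      335934767786235994642246739537227564463866980 * x * y ^ 4 +
      71986021668479141709052872757977335242257210 * y ^ 5 +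
      1033993560484703296716870911985801359226170550 * x ^ 2 * y ^ 2 +
      605885390103227563495335984370640069838897510 * x * y ^ 3 -
      687084485261572534046538635232506497676089368 * y ^ 4 +
      1215236716422926111047090421721169559746471953 * x ^ 2 * y -
      2220462579471058794312391459695091193026491459 * x * y ^ 2 -
      711423504188817166696280828973814936121859132 * y ^ 3 +
      26595478038466780271874901376856586676501616 * x ^ 2 -
      1473430947853092319414448643645718420428940174 * x * y +
      919093985400377466192463975596788406339286577 * y ^ 2 +
      22419339590119270173324019109413155973669148 * x +
      195457971799849563024964458697931563321505814 * y -
      30825844889043857344146540310176967866443736) *
      (- 21 * x ^ 3 - 27 * x ^ 2 * y + 45 * x * y ^ 2 + 32 * y ^ 3 + 43 * x ^ 2 + 14 * x * y - 48 * y
      ^ 2 - 22 * x + 16 * y)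
    = 2869631448787142978639811525342330365172600 - (888716316894804218630282379728115249904410 * y ^ 4 -
      3383292703375375869702004552057037190027552 * x * y ^ 2 -
      766698395005222245478729064741920636897883 * y ^ 3 +
      2183476361745065473298340100266645972828542 * x ^ 2 -
      3639820532578772002811146982724224678135990 * x * y -
      2130562890479952086481195201476376771739671 * y ^ 2 -
      2033069585206071176906585272957979336041592 * x + 2003497018218323558894944543616145262741934 *
      y + 18395073389661172939998791829117502340850) *
      (- 7695 * x ^ 4 + 9018 * x ^ 3 * y + 5391 * x ^ 2 * y ^ 2 - 9666 * x * y ^ 3 - 4617 * y ^ 4 +
      17412 * x ^ 3 - 21762 * x ^ 2 * y - 3282 * x * y ^ 2 + 9588 * y ^ 3 - 11448 * x ^ 2 + 14516 * x
      * y - 3064 * y ^ 2 + 1592 * x - 1848 * y + 156)"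
    by algebra
  then show False unfolding P Q H by simp
qed

text \<open>Found by prescribing the critical points \<open>(0, 0), (1, 0), (0, 1), (2, - 2)\<close> and the real lines
  \<open>x = 2 y\<close> and \<open>x = y\<close>.\<close>
definition four_wells :: "nat \<Rightarrow> nat \<Rightarrow> real" where
  "four_wells i j =
    (if i = 4 \<and> j = 0 then 69 else if i = 3 \<and> j = 1 then - 126 else if i = 2 \<and> j = 2 then - 81
     else if i = 1 \<and> j = 3 then 90 else if i = 0 \<and> j = 4 then 48 else if i = 3 \<and> j = 0 then - 172
     else if i = 2 \<and> j = 1 then 258 else if i = 1 \<and> j = 2 then 42 else if i = 0 \<and> j = 3 then - 96
     else if i = 2 \<and> j = 0 then 120 else if i = 1 \<and> j = 1 then - 132 else if i = 0 \<and> j = 2 then 48 else 0)"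

lemma four_wells_deg4: "deg4_coeffs four_wells"
  by (auto simp: deg4_coeffs_def four_wells_def)

lemma four_wells_derivs:
  fixes x y :: "'a::real_field"
  shows "pdx four_wells x y = 6 * (46 * x ^ 3 - 63 * x ^ 2 * y - 27 * x * y ^ 2 + 15 * y ^ 3 - 86 * x ^ 2 + 86 * x * y + 7 * y ^ 2
      + 40 * x - 22 * y)"
    "pdy four_wells x y = 6 * (- 21 * x ^ 3 - 27 * x ^ 2 * y + 45 * x * y ^ 2 + 32 * y ^ 3 + 43 * x ^ 2 + 14 * x * y - 48 * y
      ^ 2 - 22 * x + 16 * y)"
    "pdxx four_wells x y = 828 * x\<^sup>2 - 756 * x * y - 162 * y\<^sup>2 - 1032 * x + 516 * y + 240"
    "pdxy four_wells x y = - 378 * x\<^sup>2 - 324 * x * y + 270 * y\<^sup>2 + 516 * x + 84 * y - 132"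
    "pdyy four_wells x y = - 162 * x\<^sup>2 + 540 * x * y + 576 * y\<^sup>2 + 84 * x - 576 * y + 96"
  unfolding pdx_expand[OF four_wells_deg4] pdy_expand[OF four_wells_deg4] pdxx_expand[OF four_wells_deg4]
    pdxy_expand[OF four_wells_deg4] pdyy_expand[OF four_wells_deg4]
  by (simp_all add: four_wells_def quad_def quad_coeffs_def algebra_simps)

lemma four_wells_morse: "morse4 four_wells" "card (real_zero_lines four_wells) = 2"
proof -
  \<comment> \<open>The quartic part is (x - 2 y) (x - y) (69 x^2 + 81 x y + 24 y^2).\<close>
  have 1: "1 * (- 1) - 1 * (- 2) \<noteq> (0::real)" "81\<^sup>2 < 4 * 69 * (24::real)" by simp_all
  note tl = two_real_lines[OF 1, of four_wells]
  have "nondeg_top four_wells" by (rule tl) (simp_all add: four_wells_def)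
  moreover have "hess_det four_wells x y \<noteq> 0"
    if crit: "pdx four_wells x y = 0" "pdy four_wells x y = 0" for x y :: complex
  proof
    assume hess: "hess_det four_wells x y = 0"
    have "hess_det four_wells x y = 36 * (- 7695 * x ^ 4 + 9018 * x ^ 3 * y + 5391 * x ^ 2 * y ^ 2 - 9666 * x * y ^ 3 - 4617 * y ^ 4 +
      17412 * x ^ 3 - 21762 * x ^ 2 * y - 3282 * x * y ^ 2 + 9588 * y ^ 3 - 11448 * x ^ 2 + 14516 * x
      * y - 3064 * y ^ 2 + 1592 * x - 1848 * y + 156)"
      unfolding hess_det_def four_wells_derivs by algebra
    note hess = hess[unfolded this]
    have cancel: "a = 0" if "k * a = 0" "k \<noteq> 0" for k a :: complex using that by simp
    show False
      by (rule four_wells_certificate[OF cancel[OF crit(1)[unfolded four_wells_derivs]]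
            cancel[OF crit(2)[unfolded four_wells_derivs]] cancel[OF hess]]) simp_all
  qed
  ultimately show "morse4 four_wells" using four_wells_deg4 by (auto simp: morse4_def crit_points_def)
  show "card (real_zero_lines four_wells) = 2" by (rule tl) (simp_all add: four_wells_def)
qed

text \<open>Four minima are exhibited, and at most four extrema exist; the index formula then yields
  the five saddles without locating them.\<close>

lemma realized_9_0_4: "(9, 0) \<in> realized" "(9, 4) \<in> realized"
proof -
  have "{(0, 0), (1, 0), (0, 1), (2, - 2)} \<subseteq> definite_points four_wells (- 1)"
    by (simp add: definite_points_def crit_points_def hess_det_def four_wells_derivs power2_eq_square power3_eq_cube)
  then have "card {(0, 0), (1, 0), (0, 1), (2, - 2) :: real \<times> real} \<le> card (definite_points four_wells (- 1))"
    by (intro card_mono definite_points_index(1) four_wells_morse)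
  then have "card (definite_points four_wells (- 1)) = 4" "card (definite_points four_wells 1) = 0"
    using definite_points_index(3)[OF four_wells_morse] by simp_all
  then show "(9, 0) \<in> realized" "(9, 4) \<in> realized"
    using realizedI[OF four_wells_morse, of 0 4] realizedI_neg[OF four_wells_morse, of 0 4] by simp_all
qed

theorem theorem2:
  shows "{(card (crit_points c :: (real \<times> real) set), card (local_max_points c)) | c.
            morse4 c \<and> card (real_zero_lines c) = 2}
         = {(M, m). M \<in> {1, 3, 5, 7, 9} \<and> 2 * m < M}"
proof -
  have "(M, m) \<in> realized" if M: "M \<in> {1, 3, 5, 7, 9}" and m: "2 * m < M" for M m
  proof -
    from M consider "M = 1" | "M = 3" | "M = 5" | "M = 7" | "M = 9" by blast
    then show ?thesis
    proof cases
      case 1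
      with m have "m = 0" by simp
      with 1 show ?thesis using realized_1_0 by simp
    next
      case 2
      with m have "m = 0 \<or> m = 1" by linarith
      with 2 show ?thesis using realized_3_1_0 by (elim disjE) simp_all
    next
      case 3
      with m have "m = 0 \<or> m = 1 \<or> m = 2" by linarith
      with 3 show ?thesis using realized_5_0_2 realized_5_1 by (elim disjE) simp_all
    next
      case 4
      with m have "m = 0 \<or> m = 1 \<or> m = 2 \<or> m = 3" by linarith
      with 4 show ?thesis using realized_7_0_3 realized_7_1_2 by (elim disjE) simp_all
    next
      case 5
      with m have "m = 0 \<or> m = 1 \<or> m = 2 \<or> m = 3 \<or> m = 4" by linarith
      with 5 show ?thesis using realized_9_0_4 realized_9_1_3 realized_9_2_2 by (elim disjE) simp_all
    qed
  qed
  then have "{(M, m). M \<in> {1, 3, 5, 7, 9} \<and> 2 * m < M} \<subseteq> realized" by (intro subrelI) simp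
  with realized_subset have "realized = {(M, m). M \<in> {1, 3, 5, 7, 9} \<and> 2 * m < M}"
    by (rule subset_antisym)
  then show ?thesis unfolding realized_def .
qed

end
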